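(* Let $q$ be a discrete complex-valued measure on $\mathbb{R}_+$ with $\operatorname{supp}q\subset\mathbb{Z}_+$, and let $\mathcal D_q$ be the corresponding Dirac operator with main spectral measure $\mu_q$. If $\sum_{k\ge0}|q(\{k\})|<\infty$, then $\sigma_p(\mathcal D_q)=\sigma_{sc}(\mathcal D_q)=\emptyset$, and $\mu_q$ has the form $\mu_q=w_q\,dx$, where $w_q(x)=\sum_{k\in\mathbb{Z}}c_ke^{2ikx}$ is such that $\sum_{k\in\mathbb{Z}}|c_k|<\infty$ and $\min_{\mathbb{R}}w_q>0$. The converse is also true: if $\mu_q=w_q\,dx$ with $w_q$ of this form, then $\sum_{k\ge0}|q(\{k\})|<\infty$.
   Context: $\mathbb{R}_+=[0,\infty)$, $\mathbb{Z}_+=\{0,1,2,\dots\}$, $\mathbb{C}_+=\{\operatorname{Im}z>0\}$. The measure is $q=\sum_{k\ge0}q(\{k\})\delta_k$ with arbitrary complex masses. $\sigma_p$, $\sigma_{sc}$ denote the pure point and singular continuous parts of the spectrum. Put $J=\begin{pmatrix}0&-1\\ 1&0\end{pmatrix}$, $Q=\begin{pmatrix}\operatorname{Im}q&\operatorname{Re}q\\ \operatorname{Re}q&-\operatorname{Im}q\end{pmatrix}$ (a matrix-valued measure), and $\mathbf g(T)=I+\sum_{n\ge2}T^{n-1}/n!$ for $2\times2$ matrices $T$. For $z\in\mathbb{C}$ the Dirac system $JN'+QN=zN$ with $N=I$ on $(-\infty,0)$ is understood in the sense of Persson: $N(\cdot,z)=\begin{pmatrix}n_{11}&n_{12}\\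 n_{21}&n_{22}\end{pmatrix}$ is the unique right-continuous (in $x$) matrix function, of locally bounded variation, with $$JN(x,z)+\int_{(-\infty,x]}\mathbf g\bigl(Q(\{x_1\})J^*\bigr)\bigl(dQ(x_1)-z\,\chi_{\mathbb{R}_+}(x_1)\,dx_1\bigr)N(x_1,z)=J,\qquad x\in\mathbb{R}.$$ The Weyl function of $\mathcal D_q$ is $m_q(z)=\lim_{x\to+\infty}n_{22}(x,z)/n_{21}(x,z)$, $z\in\mathbb{C}_+$; the Schur function $f_q$ is defined by $m_q=i\frac{1+f_q}{1-f_q}$. The main spectral measure $\mu_q$ of $\mathcal D_q$ is the nonnegative Borel measure on $\mathbb{R}$ with $$\frac{1-|f_q(z)|^2}{|1-f_q(z)|^2}=\frac1\pi\int_{\mathbb{R}}\frac{\operatorname{Im}z}{|x-z|^2}\,d\mu_q(x),\qquad z\in\mathbb{C}_+.$$ The self-adjoint Dirac operator $\mathcal D_q$ on $L^2(\mathbb{R}_+,\mathbb{C}^2)$ (given by $X\mapsto JX'+QX$ in the sense of Persson, with the boundary condition that the second component of $X(0-)$ vanishes) is unitarily equivalent to multiplication by the independent variable in $L^2(\mu_q)$, so the spectral parts of $\mathcal D_q$ are those of $\mu_q$. *)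

theory Defs
  imports "HOL-Analysis.Analysis"
begin

section \<open>The Dirac system in the sense of Persson\<close>

text \<open>
  A discrete measure \<open>q = (\<Sum>k. q({k}) \<delta>\<^sub>k)\<close> supported on the nonnegative integers, with arbitrary
  complex masses, is given by the sequence of its masses \<open>q({k})\<close>, a function of type
  \<^typ>\<open>nat \<Rightarrow> complex\<close>.
\<close>

definition point_mass :: "(nat \<Rightarrow> complex) \<Rightarrow> real \<Rightarrow> complex" where
  "point_mass q x = (if x \<in> \<nat> then q (nat \<lfloor>x\<rfloor>) else 0)"

definition J :: "complex^2^2" where
  "J = vector [vector [0, -1], vector [1, 0]]"

text \<open>The value \<open>Q({x})\<close> of the matrix-valued measure \<open>Q\<close> on a singleton.\<close>

definition Q_mass :: "(nat \<Rightarrow> complex) \<Rightarrow> real \<Rightarrow> complex^2^2" where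
  "Q_mass q x =
     vector [vector [of_real (Im (point_mass q x)), of_real (Re (point_mass q x))],
             vector [of_real (Re (point_mass q x)), - of_real (Im (point_mass q x))]]"

primrec matpow :: "complex^2^2 \<Rightarrow> nat \<Rightarrow> complex^2^2" where
  "matpow T 0 = mat 1"
| "matpow T (Suc n) = T ** matpow T n"

definition g_fun :: "complex^2^2 \<Rightarrow> complex^2^2" where
  "g_fun T = mat 1 + (\<Sum>\<^sub>\<infinity>n\<in>{2..}. matpow T (n - 1) /\<^sub>R fact n)"

definition locally_bounded_variation :: "(real \<Rightarrow> 'a::real_normed_vector) \<Rightarrow> bool" where
  "locally_bounded_variation F \<longleftrightarrow>
     (\<forall>a b. \<exists>B. \<forall>n t. t 0 = a \<and> t n = b \<and> (\<forall>i<n. t i \<le> t (Suc i)) \<longrightarrow>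
        (\<Sum>i<n. norm (F (t (Suc i)) - F (t i))) \<le> B)"

text \<open>
  In the integral equation, the integral against the purely atomic measure \<open>dQ\<close> is a sum over the
  (finitely many) possible atoms \<open>k \<le> x\<close>. The entries of \<open>J\<close> are real, so \<open>J\<^sup>*\<close> is the transpose.
\<close>

definition persson_solution ::
  "(nat \<Rightarrow> complex) \<Rightarrow> complex \<Rightarrow> (real \<Rightarrow> complex^2^2) \<Rightarrow> bool" where
  "persson_solution q z N \<longleftrightarrow>
     (\<forall>x. continuous (at_right x) N) \<and>
     locally_bounded_variation N \<and>
     (\<forall>x. J ** N x
          + ((\<Sum>k | real k \<le> x.
                g_fun (Q_mass q (real k) ** transpose J) ** Q_mass q (real k) ** N (real k))
             - (LINT t:{..x}|lborel. indicat_real {0..} t *\<^sub>R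
                  (g_fun (Q_mass q t ** transpose J) ** mat z ** N t)))
          = J)"

definition dirac_solution :: "(nat \<Rightarrow> complex) \<Rightarrow> complex \<Rightarrow> real \<Rightarrow> complex^2^2" where
  "dirac_solution q z = (THE N. persson_solution q z N)"


section \<open>Weyl function, Schur function, main spectral measure\<close>

definition weyl_function :: "(nat \<Rightarrow> complex) \<Rightarrow> complex \<Rightarrow> complex" where
  "weyl_function q z =
     Lim at_top (\<lambda>x. dirac_solution q z x $ 2 $ 2 / dirac_solution q z x $ 2 $ 1)"

text \<open>The condition \<open>f \<noteq> 1\<close> excludes the junk solution produced by division by zero.\<close>

definition schur_function :: "(nat \<Rightarrow> complex) \<Rightarrow> complex \<Rightarrow> complex" where
  "schur_function q z = (THE f. f \<noteq> 1 \<and> weyl_function q z = \<i> * (1 + f) / (1 - f))"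

definition main_spectral_measure :: "(nat \<Rightarrow> complex) \<Rightarrow> real measure \<Rightarrow> bool" where
  "main_spectral_measure q \<mu> \<longleftrightarrow>
     sets \<mu> = sets borel \<and>
     (\<forall>z. Im z > 0 \<longrightarrow>
        integrable \<mu> (\<lambda>x. Im z / (norm (of_real x - z))\<^sup>2) \<and>
        (1 - (norm (schur_function q z))\<^sup>2) / (norm (1 - schur_function q z))\<^sup>2
          = 1 / pi * (LINT x|\<mu>. Im z / (norm (of_real x - z))\<^sup>2))"


section \<open>Spectral parts\<close>

definition pure_point :: "real measure \<Rightarrow> bool" where
  "pure_point \<nu> \<longleftrightarrow> sets \<nu> = sets borel \<and> (\<exists>C. countable C \<and> emeasure \<nu> (- C) = 0)"

definition singular_continuous :: "real measure \<Rightarrow> bool" where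
  "singular_continuous \<nu> \<longleftrightarrow> sets \<nu> = sets borel \<and> (\<forall>x. emeasure \<nu> {x} = 0) \<and>
     (\<exists>S\<in>null_sets lborel. emeasure \<nu> (- S) = 0)"

definition lebesgue_decomposition ::
  "real measure \<Rightarrow> real measure \<Rightarrow> real measure \<Rightarrow> real measure \<Rightarrow> bool" where
  "lebesgue_decomposition \<mu> \<mu>ac \<mu>pp \<mu>sc \<longleftrightarrow>
     sets \<mu>ac = sets borel \<and> absolutely_continuous lborel \<mu>ac \<and>
     pure_point \<mu>pp \<and> singular_continuous \<mu>sc \<and>
     (\<forall>A\<in>sets borel. emeasure \<mu> A = emeasure \<mu>ac A + emeasure \<mu>pp A + emeasure \<mu>sc A)"

definition pp_part :: "real measure \<Rightarrow> real measure" where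
  "pp_part \<mu> = (THE \<mu>pp. \<exists>\<mu>ac \<mu>sc. lebesgue_decomposition \<mu> \<mu>ac \<mu>pp \<mu>sc)"

definition sc_part :: "real measure \<Rightarrow> real measure" where
  "sc_part \<mu> = (THE \<mu>sc. \<exists>\<mu>ac \<mu>pp. lebesgue_decomposition \<mu> \<mu>ac \<mu>pp \<mu>sc)"

definition measure_support :: "real measure \<Rightarrow> real set" where
  "measure_support \<nu> = {x. \<forall>U. open U \<and> x \<in> U \<longrightarrow> emeasure \<nu> U > 0}"

text \<open>
  The Dirac operator \<open>\<D>\<^sub>q\<close> is unitarily equivalent to multiplication by the independent variable in
  \<open>L\<^sup>2(\<mu>)\<close>, where \<open>\<mu>\<close> is its main spectral measure. The spectrum of multiplication by the variable
  in \<open>L\<^sup>2(\<nu>)\<close> is the support of \<open>\<nu>\<close>, so the pure point and singular continuous parts of the spectrum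
  of \<open>\<D>\<^sub>q\<close> are the supports of the corresponding parts of \<open>\<mu>\<close>.
\<close>

definition sigma_p :: "real measure \<Rightarrow> real set" where
  "sigma_p \<mu> = measure_support (pp_part \<mu>)"

definition sigma_sc :: "real measure \<Rightarrow> real set" where
  "sigma_sc \<mu> = measure_support (sc_part \<mu>)"


section \<open>Densities with absolutely convergent Fourier series and positive minimum\<close>

definition positive_wiener_density :: "(real \<Rightarrow> real) \<Rightarrow> bool" where
  "positive_wiener_density w \<longleftrightarrow>
     (\<exists>c :: int \<Rightarrow> complex.
        (\<lambda>k. norm (c k)) summable_on UNIV \<and>
        (\<forall>x. of_real (w x) = (\<Sum>\<^sub>\<infinity>k. c k * exp (2 * \<i> * of_int k * of_real x)))) \<and>
     (\<exists>x0. (\<forall>x. w x0 \<le> w x) \<and> w x0 > 0)"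

end

theory Submission
  imports Defs "HOL-Complex_Analysis.Complex_Analysis" "HOL-Real_Asymp.Real_Asymp"
begin

text \<open>
  Put \<open>\<zeta> = exp (2\<i>z)\<close>, which maps the upper half plane onto the punctured unit disc.

  \<^emph>\<open>From the Dirac system to the Schur algorithm.\<close> Between two integers the Dirac system is free, and
  in the coordinates \<open>u = N\<^sub>2 + \<i>N\<^sub>1\<close>, \<open>v = N\<^sub>2 - \<i>N\<^sub>1\<close> of a column of \<open>N\<close> its flow is diagonal. At the
  integer \<open>k\<close> the solution is multiplied by a hyperbolic matrix, which in these coordinates is
  \<open>cosh \<bar>q\<^sub>k\<bar>\<close> times the matrix with unit diagonal and off-diagonal entries \<open>\<gamma>\<^sub>k\<close>, \<open>cnj \<gamma>\<^sub>k\<close>, where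
  \<open>\<gamma>\<^sub>k = cnj q\<^sub>k tanh \<bar>q\<^sub>k\<bar> / \<bar>q\<^sub>k\<bar>\<close>. Scalar factors cancel in the quotient that defines the Weyl
  function, and what is left is the inverse Schur algorithm: \<open>f\<^sub>q(z) = F(\<zeta>)\<close> for the Schur function
  \<open>F\<close> with parameters \<open>\<gamma>\<^sub>k\<close> (\<open>schur_function_eq\<close>). Since \<open>\<bar>\<gamma>\<^sub>k\<bar> = tanh \<bar>q\<^sub>k\<bar>\<close>, the masses are summable
  exactly if the parameters are.

  \<^emph>\<open>Baxter's theorem.\<close> The parameters are summable if and only if \<open>F\<close> has an absolutely convergent
  power series and \<open>sup \<bar>F\<bar> < 1\<close> on the closed disc. If the sum of the parameters is small, the
  recursion converges in the Wiener algebra and its denominator is close to \<open>1\<close>; finitely many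
  further steps of the algorithm stay in the class because \<open>1 + cnj \<gamma> \<zeta> F\<close> can be inverted there
  (\<open>summable_imp_strict_schur_wiener\<close>). Conversely, suppose first that the Wiener norm \<open>T\<close> of \<open>F\<close> is
  below \<open>1\<close>. Stripping the parameter \<open>\<gamma>\<close> of modulus \<open>g\<close> lowers the norm to at most
  \<open>(T - g) / (1 - gT) \<le> T - g(1 - T\<^sup>2)\<close>; as norms stay nonnegative, the \<open>g\<close> are summable
  (\<open>small_schur_wiener_summable\<close>). The general case reduces to this one: writing
  \<open>1 - \<bar>F\<bar>\<^sup>2 = \<bar>a\<bar>\<^sup>2\<close> on the circle, with \<open>a\<close> invertible in the analytic algebra, the Schur function
  \<open>F\<^sub>N\<close> that is left after stripping \<open>N\<close> parameters is a quotient \<open>y / x\<close> of solutions of a pair of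
  Marchenko equations, whose kernel is the tail of the symbol \<open>cnj F a / cnj a\<close> beyond the index \<open>N\<close>. That tail is small
  for large \<open>N\<close> (\<open>schur_wiener_tail\<close>).

  \<^emph>\<open>From the Schur function to the measure.\<close> The left side of the equation that defines \<open>\<mu>\<^sub>q\<close> is the
  real part of \<open>W = (1 + F) / (1 - F)\<close>. For \<open>F\<close> as in Baxter's theorem, \<open>w(x) = Re W(exp (2\<i>x))\<close> is
  continuous and positive with an absolutely convergent Fourier series, and it has the same Poisson
  integrals as \<open>\<mu>\<^sub>q\<close>; Stieltjes inversion yields \<open>\<mu>\<^sub>q = w dx\<close> (\<open>poisson_unique\<close>). Conversely, a
  density \<open>w\<close> of this kind is the real part on the circle of an analytic \<open>u\<close> with absolutely
  convergent series, \<open>W\<close> differs from \<open>u\<close> by an imaginary constant, and \<open>F = (W - 1) / (W + 1)\<close> is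
  strict because \<open>Re W > 0\<close> on the compact closed disc.
\<close>

section \<open>Absolutely convergent series of characters\<close>

lemma finite_sums_close:
  fixes c :: "'e \<Rightarrow> real"
  assumes "c summable_on UNIV" "\<epsilon> > 0"
  shows "\<exists>T. finite T \<and> (\<forall>Y. finite Y \<longrightarrow> T \<subseteq> Y \<longrightarrow> dist (\<Sum>k\<in>Y. c k) (\<Sum>\<^sub>\<infinity>k. c k) < \<epsilon>)"
proof -
  have "(c has_sum (\<Sum>\<^sub>\<infinity>k. c k)) UNIV" using assms by simp
  from tendstoD[OF this[unfolded has_sum_def] assms(2)] show ?thesis
    by (auto simp: eventually_finite_subsets_at_top)
qed

text \<open>
  The two instances are the monomials \<open>\<zeta>\<^sup>n\<close>, \<open>n \<ge> 0\<close>, on the closed disc and \<open>x\<^sup>k\<close>, \<open>k\<close> an integer, on the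
  unit circle. The Cauchy estimate \<open>finite_coeff_le_sup\<close> is all that is used of orthogonality, and
  the linear growth in \<open>card_len\<close> is what makes the spectral radius equal to the sup norm.
\<close>

locale character_series =
  fixes X :: "complex set" and ch :: "'e::comm_monoid_add \<Rightarrow> complex \<Rightarrow> complex"
    and len :: "'e \<Rightarrow> nat"
  assumes ch_zero: "x \<in> X \<Longrightarrow> ch 0 x = 1"
    and ch_add: "x \<in> X \<Longrightarrow> ch (j + k) x = ch j x * ch k x"
    and norm_ch: "x \<in> X \<Longrightarrow> norm (ch k x) \<le> 1"
    and len_zero: "len 0 = 0"
    and len_add: "len (j + k) \<le> len j + len k"
    and finite_len: "finite {k. len k \<le> d}"
    and card_len: "card {k. len k \<le> d} \<le> 2 * d + 1"
    and finite_coeff_le_sup: "finite S \<Longrightarrow> (\<And>x. x \<in> X \<Longrightarrow> norm (\<Sum>k\<in>S. c k * ch k x) \<le> M) \<Longrightarrow>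
            k \<in> S \<Longrightarrow> norm (c k) \<le> M"
begin

definition expansion :: "('e \<Rightarrow> complex) \<Rightarrow> (complex \<Rightarrow> complex) \<Rightarrow> bool" where
  "expansion c f \<longleftrightarrow> (\<lambda>k. norm (c k)) summable_on UNIV \<and> (\<forall>x\<in>X. f x = (\<Sum>\<^sub>\<infinity>k. c k * ch k x))"

text \<open>
  A bound \<open>C\<close> is carried instead of the norm of \<open>f\<close> in the algebra: bounds compose under all operations
  below without reference to the coefficients, and make sense before these are known to be unique.
\<close>

definition wiener :: "(complex \<Rightarrow> complex) \<Rightarrow> real \<Rightarrow> bool" where
  "wiener f C \<longleftrightarrow> (\<exists>c. expansion c f \<and> (\<Sum>\<^sub>\<infinity>k. norm (c k)) \<le> C)"

lemma abs_summable_char: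
  assumes "(\<lambda>i. norm (b i)) summable_on A" "x \<in> X"
  shows "(\<lambda>i. norm (b i * ch (e i) x)) summable_on A"
  by (rule summable_on_comparison_test[OF assms(1)])
     (auto simp: norm_mult intro!: mult_left_le norm_ch assms)

lemma summable_char:
  assumes "(\<lambda>i. norm (b i)) summable_on A" "x \<in> X"
  shows "(\<lambda>i. b i * ch (e i) x) summable_on A"
  by (rule abs_summable_summable[OF abs_summable_char[OF assms]])

text \<open>
  Products are indexed by pairs of exponents, sums of series by pairs of an index and an exponent.
  Collecting the terms that belong to one character treats both at once.
\<close>

lemma wiener_regroup:
  fixes b :: "'i \<Rightarrow> complex" and e :: "'i \<Rightarrow> 'e"
  assumes b: "(\<lambda>i. norm (b i)) summable_on UNIV"
    and f: "\<And>x. x \<in> X \<Longrightarrow> f x = (\<Sum>\<^sub>\<infinity>i. b i * ch (e i) x)"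
  shows "wiener f (\<Sum>\<^sub>\<infinity>i. norm (b i))"
proof -
  \<comment> \<open>the fibres of \<open>e\<close>: the index set is their disjoint union\<close>
  define A where "A m = {i. e i = m}" for m
  define c where "c m = infsum b (A m)" for m
  have bij: "bij_betw (\<lambda>i. (e i, i)) UNIV (Sigma UNIV A)"
    by (rule bij_betwI[where g = snd]) (auto simp: A_def)
  have re: "(\<Sum>\<^sub>\<infinity>i. g i) = (\<Sum>\<^sub>\<infinity>m. infsum g (A m)) \<and> (\<lambda>m. infsum g (A m)) summable_on UNIV"
    if "g summable_on UNIV" for g :: "'i \<Rightarrow> 'b::banach"
  proof -
    have s: "(\<lambda>(m, i). g i) summable_on Sigma UNIV A"
      using that summable_on_reindex_bij_betw[OF bij, where f = "\<lambda>(m, i). g i"] by simp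
    have "(\<Sum>\<^sub>\<infinity>i. g i) = infsum (\<lambda>(m, i). g i) (Sigma UNIV A)"
      using infsum_reindex_bij_betw[OF bij, where f = "\<lambda>(m, i). g i"] by simp
    also have "\<dots> = (\<Sum>\<^sub>\<infinity>m. infsum g (A m))"
      using infsum_Sigma'_banach[OF s] by simp
    finally show ?thesis
      using summable_on_Sigma_banach[OF s] by auto
  qed
  have nb: "(\<lambda>m. \<Sum>\<^sub>\<infinity>i\<in>A m. norm (b i)) summable_on UNIV"
    and nbs: "(\<Sum>\<^sub>\<infinity>i. norm (b i)) = (\<Sum>\<^sub>\<infinity>m. \<Sum>\<^sub>\<infinity>i\<in>A m. norm (b i))"
    using re[OF b] by auto
  have nbA: "(\<lambda>i. norm (b i)) summable_on A m" for m
    using summable_on_subset_banach[OF b] by blast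
  have cle: "norm (c m) \<le> (\<Sum>\<^sub>\<infinity>i\<in>A m. norm (b i))" for m
    unfolding c_def by (rule norm_infsum_bound) (rule nbA)
  have nc: "(\<lambda>m. norm (c m)) summable_on UNIV"
    by (rule summable_on_comparison_test[OF nb]) (auto intro: cle)
  have "f x = (\<Sum>\<^sub>\<infinity>m. c m * ch m x)" if x: "x \<in> X" for x
  proof -
    have "f x = (\<Sum>\<^sub>\<infinity>m. \<Sum>\<^sub>\<infinity>i\<in>A m. b i * ch (e i) x)"
      using f[OF x] re[OF summable_char[OF b x, of e]] by simp
    also have "\<dots> = (\<Sum>\<^sub>\<infinity>m. c m * ch m x)"
    proof (rule infsum_cong)
      fix m
      have "(\<Sum>\<^sub>\<infinity>i\<in>A m. b i * ch (e i) x) = (\<Sum>\<^sub>\<infinity>i\<in>A m. b i * ch m x)"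
        by (rule infsum_cong) (auto simp: A_def)
      also have "\<dots> = c m * ch m x"
        unfolding c_def by (rule infsum_cmult_left) (rule abs_summable_summable[OF nbA])
      finally show "(\<Sum>\<^sub>\<infinity>i\<in>A m. b i * ch (e i) x) = c m * ch m x" .
    qed
    finally show ?thesis .
  qed
  then have "expansion c f" using nc by (auto simp: expansion_def)
  moreover have "(\<Sum>\<^sub>\<infinity>m. norm (c m)) \<le> (\<Sum>\<^sub>\<infinity>i. norm (b i))"
    unfolding nbs by (rule infsum_mono[OF nc nb cle])
  ultimately show ?thesis by (auto simp: wiener_def)
qed

lemma wiener_mono: "wiener f C \<Longrightarrow> C \<le> D \<Longrightarrow> wiener f D"
  by (force simp: wiener_def)

lemma wiener_cong: "wiener f C \<Longrightarrow> (\<And>x. x \<in> X \<Longrightarrow> f x = g x) \<Longrightarrow> wiener g C"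
  by (force simp: wiener_def expansion_def)

lemma wiener_nonneg: "wiener f C \<Longrightarrow> C \<ge> 0"
  unfolding wiener_def by (metis infsum_nonneg norm_ge_zero order_trans)

lemma wiener_norm_le: assumes "wiener f C" "x \<in> X" shows "norm (f x) \<le> C"
proof -
  obtain c where c: "expansion c f" "(\<Sum>\<^sub>\<infinity>k. norm (c k)) \<le> C" using assms by (auto simp: wiener_def)
  then have s: "(\<lambda>k. norm (c k)) summable_on UNIV" by (auto simp: expansion_def)
  have "norm (f x) \<le> (\<Sum>\<^sub>\<infinity>k. norm (c k * ch k x))"
    using c assms(2) norm_infsum_bound[OF abs_summable_char[OF s assms(2), of id]]
    by (auto simp: expansion_def)
  also have "\<dots> \<le> (\<Sum>\<^sub>\<infinity>k. norm (c k))"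
    using abs_summable_char[OF s assms(2), of id] s
    by (intro infsum_mono) (auto simp: norm_mult intro!: mult_left_le norm_ch assms)
  finally show ?thesis using c by simp
qed

lemma wiener_mult:
  assumes "wiener f C" "wiener g D"
  shows "wiener (\<lambda>x. f x * g x) (C * D)"
proof -
  obtain c where c: "(\<lambda>k. norm (c k)) summable_on UNIV" "\<And>x. x \<in> X \<Longrightarrow> f x = (\<Sum>\<^sub>\<infinity>k. c k * ch k x)"
      "(\<Sum>\<^sub>\<infinity>k. norm (c k)) \<le> C" using assms by (auto simp: wiener_def expansion_def)
  obtain d where d: "(\<lambda>k. norm (d k)) summable_on UNIV" "\<And>x. x \<in> X \<Longrightarrow> g x = (\<Sum>\<^sub>\<infinity>k. d k * ch k x)"
      "(\<Sum>\<^sub>\<infinity>k. norm (d k)) \<le> D" using assms by (auto simp: wiener_def expansion_def)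
  define b where "b = (\<lambda>(j, k). c j * d k)"
  have fg: "(\<Sum>\<^sub>\<infinity>j. u j) * (\<Sum>\<^sub>\<infinity>k. v k) = (\<Sum>\<^sub>\<infinity>(j, k). u j * v k) \<and>
      (\<lambda>(j, k). norm (u j * v k)) summable_on UNIV"
    if "(\<lambda>j. norm (u j)) summable_on UNIV" "(\<lambda>j. norm (v j)) summable_on UNIV"
    for u v :: "'e \<Rightarrow> 'b::{banach,real_normed_algebra,real_normed_div_algebra}"
  proof -
    have "(\<lambda>p. norm ((\<lambda>(j, k). u j * v k) p)) summable_on UNIV \<times> UNIV"
      unfolding Infinite_Sum.abs_summable_on_Sigma_iff using that
      by (simp add: norm_mult infsum_cmult_right infsum_nonneg summable_on_cmult_right summable_on_cmult_left)
    then have a: "(\<lambda>(j, k). norm (u j * v k)) summable_on UNIV \<times> UNIV"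
      by (simp add: case_prod_unfold)
    then have "(\<lambda>(j, k). u j * v k) summable_on UNIV \<times> UNIV"
      using abs_summable_summable[of "\<lambda>(j, k). u j * v k"] by (simp add: case_prod_unfold)
    then have "(\<Sum>\<^sub>\<infinity>(j, k). u j * v k) = (\<Sum>\<^sub>\<infinity>j. \<Sum>\<^sub>\<infinity>k. u j * v k)"
      using infsum_Sigma'_banach[of "\<lambda>j k. u j * v k" UNIV "\<lambda>_. UNIV"] by simp
    also have "\<dots> = (\<Sum>\<^sub>\<infinity>j. u j) * (\<Sum>\<^sub>\<infinity>k. v k)"
      using abs_summable_summable[OF that(1)] abs_summable_summable[OF that(2)]
      by (simp add: infsum_cmult_right infsum_cmult_left)
    finally show ?thesis using a by simp
  qed
  have "wiener (\<lambda>x. f x * g x) (\<Sum>\<^sub>\<infinity>p. norm (b p))"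
  proof (rule wiener_regroup[where e = "\<lambda>(j, k). j + k"])
    show "(\<lambda>p. norm (b p)) summable_on UNIV"
      using fg[of c d] c d by (simp add: b_def case_prod_unfold)
    fix x assume x: "x \<in> X"
    have "f x * g x = (\<Sum>\<^sub>\<infinity>j. c j * ch j x) * (\<Sum>\<^sub>\<infinity>k. d k * ch k x)" using c d x by simp
    also have "\<dots> = (\<Sum>\<^sub>\<infinity>(j, k). (c j * ch j x) * (d k * ch k x))"
      using fg[OF abs_summable_char[OF c(1) x] abs_summable_char[OF d(1) x]] by simp
    also have "\<dots> = (\<Sum>\<^sub>\<infinity>p. b p * ch (case p of (j, k) \<Rightarrow> j + k) x)"
      by (rule infsum_cong) (auto simp: b_def ch_add x)
    finally show "f x * g x = (\<Sum>\<^sub>\<infinity>p. b p * ch (case p of (j, k) \<Rightarrow> j + k) x)" .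
  qed
  moreover have "(\<Sum>\<^sub>\<infinity>p. norm (b p)) = (\<Sum>\<^sub>\<infinity>j. norm (c j)) * (\<Sum>\<^sub>\<infinity>k. norm (d k))"
    using fg[of "\<lambda>j. norm (c j)" "\<lambda>k. norm (d k)"] c d
    by (simp add: b_def case_prod_unfold norm_mult)
  moreover have "\<dots> \<le> C * D"
    using c(3) d(3) wiener_nonneg[OF assms(1)] by (intro mult_mono) (auto intro: infsum_nonneg)
  ultimately show ?thesis using wiener_mono by metis
qed

text \<open>
  Completeness of the algebra, in the form needed for power series of a function.
\<close>

lemma wiener_suminf:
  assumes f: "\<And>n. wiener (f n) (C n)" and C: "summable C"
    and g: "\<And>x. x \<in> X \<Longrightarrow> g x = (\<Sum>n. f n x)"
  shows "wiener g (\<Sum>n. C n)"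
proof -
  have C0: "C n \<ge> 0" for n by (rule wiener_nonneg[OF f])
  obtain c where c: "\<And>n. (\<lambda>k. norm (c n k)) summable_on UNIV"
      "\<And>n x. x \<in> X \<Longrightarrow> f n x = (\<Sum>\<^sub>\<infinity>k. c n k * ch k x)"
      "\<And>n. (\<Sum>\<^sub>\<infinity>k. norm (c n k)) \<le> C n"
    using f unfolding wiener_def expansion_def by metis
  define b where "b = (\<lambda>(n, k). c n k)"
  have Cs: "C summable_on UNIV" using C C0 by (simp add: summable_on_UNIV_nonneg_real_iff)
  have s: "(\<lambda>n. \<Sum>\<^sub>\<infinity>k. norm (c n k)) summable_on UNIV"
    by (rule summable_on_comparison_test[OF Cs]) (auto intro: c infsum_nonneg)
  have bs: "(\<lambda>p. norm (b p)) summable_on UNIV \<times> UNIV"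
    unfolding Infinite_Sum.abs_summable_on_Sigma_iff using s c
    by (auto simp: b_def infsum_nonneg)
  have "wiener g (\<Sum>\<^sub>\<infinity>p. norm (b p))"
  proof (rule wiener_regroup[where e = snd])
    show bs': "(\<lambda>p. norm (b p)) summable_on UNIV" using bs by simp
    fix x assume x: "x \<in> X"
    have "norm (f n x) \<le> C n" for n using f x by (rule wiener_norm_le)
    then have fa: "(\<lambda>n. norm (f n x)) summable_on UNIV"
      by (intro summable_on_comparison_test[OF Cs]) auto
    have "g x = (\<Sum>n. f n x)" using g x by simp
    also have "\<dots> = (\<Sum>\<^sub>\<infinity>n. f n x)"
      using fa abs_summable_summable has_sum_imp_sums has_sum_infsum sums_unique by metis
    also have "\<dots> = (\<Sum>\<^sub>\<infinity>n. \<Sum>\<^sub>\<infinity>k. b (n, k) * ch k x)"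
      using c x by (simp add: b_def)
    also have "\<dots> = (\<Sum>\<^sub>\<infinity>p\<in>UNIV \<times> UNIV. b p * ch (snd p) x)"
      using infsum_Sigma'_banach[of "\<lambda>n k. b (n, k) * ch k x" UNIV "\<lambda>_. UNIV"]
        summable_char[OF bs' x, of snd] by (simp add: case_prod_unfold)
    finally show "g x = (\<Sum>\<^sub>\<infinity>p. b p * ch (snd p) x)" by simp
  qed
  moreover have "(\<Sum>\<^sub>\<infinity>p. norm (b p)) = (\<Sum>\<^sub>\<infinity>n. \<Sum>\<^sub>\<infinity>k. norm (c n k))"
    using infsum_Sigma'_banach[of "\<lambda>n k. norm (b (n, k))" UNIV "\<lambda>_. UNIV"] bs
    by (simp add: case_prod_unfold b_def)
  moreover have "\<dots> \<le> (\<Sum>\<^sub>\<infinity>n. C n)" by (rule infsum_mono[OF s Cs c(3)])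
  moreover have "\<dots> = (\<Sum>n. C n)"
    using Cs has_sum_imp_sums has_sum_infsum sums_unique by metis
  ultimately show ?thesis using wiener_mono by metis
qed

lemma expansion_add:
  assumes "expansion c f" "expansion d g"
  shows "expansion (\<lambda>k. c k + d k) (\<lambda>x. f x + g x)"
    "(\<Sum>\<^sub>\<infinity>k. norm (c k + d k)) \<le> (\<Sum>\<^sub>\<infinity>k. norm (c k)) + (\<Sum>\<^sub>\<infinity>k. norm (d k))"
proof -
  have c: "(\<lambda>k. norm (c k)) summable_on UNIV" "\<And>x. x \<in> X \<Longrightarrow> f x = (\<Sum>\<^sub>\<infinity>k. c k * ch k x)"
    and d: "(\<lambda>k. norm (d k)) summable_on UNIV" "\<And>x. x \<in> X \<Longrightarrow> g x = (\<Sum>\<^sub>\<infinity>k. d k * ch k x)"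
    using assms by (auto simp: expansion_def)
  have s: "(\<lambda>k. norm (c k + d k)) summable_on UNIV"
    by (rule summable_on_comparison_test[OF summable_on_add[OF c(1) d(1)]]) (auto intro: norm_triangle_ineq)
  have "(\<Sum>\<^sub>\<infinity>k. (c k + d k) * ch k x) = f x + g x" if "x \<in> X" for x
    using infsum_add[OF summable_char[OF c(1) that, of id] summable_char[OF d(1) that, of id]]
       c(2)[OF that] d(2)[OF that] by (simp add: algebra_simps)
  with s show "expansion (\<lambda>k. c k + d k) (\<lambda>x. f x + g x)" by (auto simp: expansion_def)
  have "(\<Sum>\<^sub>\<infinity>k. norm (c k + d k)) \<le> (\<Sum>\<^sub>\<infinity>k. norm (c k) + norm (d k))"
    by (rule infsum_mono[OF s summable_on_add[OF c(1) d(1)]]) (rule norm_triangle_ineq)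
  also have "\<dots> = (\<Sum>\<^sub>\<infinity>k. norm (c k)) + (\<Sum>\<^sub>\<infinity>k. norm (d k))" by (rule infsum_add[OF c(1) d(1)])
  finally show "(\<Sum>\<^sub>\<infinity>k. norm (c k + d k)) \<le> (\<Sum>\<^sub>\<infinity>k. norm (c k)) + (\<Sum>\<^sub>\<infinity>k. norm (d k))" .
qed

lemma wiener_add:
  assumes "wiener f C" "wiener g D"
  shows "wiener (\<lambda>x. f x + g x) (C + D)"
proof -
  obtain c d where c: "expansion c f" "(\<Sum>\<^sub>\<infinity>k. norm (c k)) \<le> C" and d: "expansion d g" "(\<Sum>\<^sub>\<infinity>k. norm (d k)) \<le> D"
    using assms by (auto simp: wiener_def)
  show ?thesis unfolding wiener_def
    using expansion_add[OF c(1) d(1)] c(2) d(2) by (intro exI[of _ "\<lambda>k. c k + d k"]) auto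
qed

lemma expansion_single: "expansion (\<lambda>k. if k = j then a else 0) (\<lambda>x. a * ch j x)"
    "(\<Sum>\<^sub>\<infinity>k. norm (if k = j then a else 0)) = norm a"
proof -
  have 1: "((\<lambda>k. if k = j then b else 0) has_sum b) UNIV" for b :: "'b::{topological_comm_monoid_add,t2_space}"
    using has_sum_cong_neutral[of "{j}" UNIV "\<lambda>k. if k = j then b else 0" "\<lambda>k. if k = j then b else 0" b]
      has_sum_finite[of "{j}" "\<lambda>k. if k = j then b else 0"] by (auto split: if_splits)
  have "(\<lambda>k. norm (if k = j then a else 0)) = (\<lambda>k. if k = j then norm a else 0)" by auto
  then have 2: "((\<lambda>k. norm (if k = j then a else 0)) has_sum norm a) UNIV" using 1 by simp
  then show "(\<Sum>\<^sub>\<infinity>k. norm (if k = j then a else 0)) = norm a" by (rule infsumI)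
  have "(\<lambda>k. (if k = j then a else 0) * ch k x) = (\<lambda>k. if k = j then a * ch j x else 0)" for x by auto
  then have "a * ch j x = (\<Sum>\<^sub>\<infinity>k. (if k = j then a else 0) * ch k x)" for x
    using infsumI[OF 1[of "a * ch j x"]] by simp
  then show "expansion (\<lambda>k. if k = j then a else 0) (\<lambda>x. a * ch j x)"
    using 2 by (auto simp: expansion_def has_sum_imp_summable)
qed

lemma wiener_monomial: "wiener (\<lambda>x. a * ch k x) (norm a)"
  using expansion_single[of k a] unfolding wiener_def by force

lemma wiener_char: "wiener (ch k) 1"
  using wiener_monomial[of 1 k] by simp

lemma wiener_const: "wiener (\<lambda>x. a) (norm a)"
  by (rule wiener_cong[OF wiener_monomial[of a 0]]) (simp add: ch_zero)

lemma wiener_scale: "wiener f C \<Longrightarrow> wiener (\<lambda>x. a * f x) (norm a * C)"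
  by (rule wiener_mult[OF wiener_const])

lemma wiener_minus: "wiener f C \<Longrightarrow> wiener (\<lambda>x. - f x) C"
  using wiener_scale[of f C "-1"] by simp

lemma wiener_diff: "wiener f C \<Longrightarrow> wiener g D \<Longrightarrow> wiener (\<lambda>x. f x - g x) (C + D)"
  using wiener_add[OF _ wiener_minus, of f C g D] by simp

lemma wiener_power: "wiener f C \<Longrightarrow> wiener (\<lambda>x. f x ^ n) (C ^ n)"
proof (induction n)
  case 0 show ?case using wiener_const[of 1] by simp
next
  case (Suc n) then show ?case using wiener_mult[OF Suc.prems Suc.IH[OF Suc.prems]] by simp
qed

lemma wiener_sum:
  assumes "finite I" "\<And>i. i \<in> I \<Longrightarrow> wiener (f i) (C i)"
  shows "wiener (\<lambda>x. \<Sum>i\<in>I. f i x) (\<Sum>i\<in>I. C i)"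
  using assms
proof (induction I rule: finite_induct)
  case empty show ?case using wiener_const[of 0] by simp
next
  case (insert i I) then show ?case using wiener_add[of "f i" "C i"] by simp
qed

lemma wiener_geometric:
  assumes "wiener f C" "C < 1"
  shows "wiener (\<lambda>x. 1 / (1 - f x)) (1 / (1 - C))"
proof -
  have C: "0 \<le> C" by (rule wiener_nonneg[OF assms(1)])
  have "wiener (\<lambda>x. 1 / (1 - f x)) (\<Sum>n. C ^ n)"
  proof (rule wiener_suminf)
    show "wiener (\<lambda>x. f x ^ n) (C ^ n)" for n by (rule wiener_power[OF assms(1)])
    show "summable (\<lambda>n. C ^ n)" using C assms by (intro summable_geometric) auto
    fix x assume "x \<in> X"
    then have "norm (f x) < 1" using wiener_norm_le[OF assms(1)] assms(2) by force
    then show "1 / (1 - f x) = (\<Sum>n. f x ^ n)" by (simp add: suminf_geometric)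
  qed
  then show ?thesis using C assms by (simp add: suminf_geometric)
qed

lemma wiener_exp:
  assumes "wiener f C"
  shows "wiener (\<lambda>x. exp (f x)) (exp C)"
proof -
  have "wiener (\<lambda>x. exp (f x)) (\<Sum>n. (1 / fact n) * C ^ n)"
  proof (rule wiener_suminf)
    show "wiener (\<lambda>x. (1 / of_nat (fact n)) * f x ^ n) ((1 / fact n) * C ^ n)" for n
      using wiener_scale[OF wiener_power[OF assms], of "1 / of_nat (fact n)" n] by (simp add: norm_divide)
    show "summable (\<lambda>n. (1 / fact n) * C ^ n)"
      using summable_exp_generic[of C] by (simp add: norm_divide divide_inverse)
    fix x
    show "exp (f x) = (\<Sum>n. 1 / of_nat (fact n) * f x ^ n)"
      by (simp add: exp_def scaleR_conv_of_real divide_inverse)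
  qed
  also have "(\<Sum>n. (1 / fact n) * C ^ n) = exp C"
    by (simp add: exp_def norm_divide divide_inverse)
  finally show ?thesis .
qed

text \<open>
  The Cauchy estimate passes from finite sums to series by truncation. Applied to a difference of
  two expansions it shows that the coefficients are unique, so that bounds \<open>C\<close> in \<open>wiener f C\<close> can be
  compared with the coefficient sum of any given expansion.
\<close>

lemma coeff_le_sup:
  assumes e: "expansion c f" and M: "\<And>x. x \<in> X \<Longrightarrow> norm (f x) \<le> M"
  shows "norm (c k) \<le> M"
proof (rule field_le_epsilon)
  fix \<epsilon> :: real assume \<epsilon>: "\<epsilon> > 0"
  have c: "(\<lambda>k. norm (c k)) summable_on UNIV" using e by (auto simp: expansion_def)
  obtain S where S: "finite S" "k \<in> S" "(\<Sum>\<^sub>\<infinity>k\<in>-S. norm (c k)) \<le> \<epsilon>"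
  proof -
    obtain T where T: "finite T" "\<And>Y. finite Y \<Longrightarrow> T \<subseteq> Y \<Longrightarrow> dist (\<Sum>k\<in>Y. norm (c k)) (\<Sum>\<^sub>\<infinity>k. norm (c k)) < \<epsilon>"
      using finite_sums_close[OF c \<epsilon>] by blast
    define S where "S = insert k T"
    have "(\<Sum>\<^sub>\<infinity>k. norm (c k)) = (\<Sum>k\<in>S. norm (c k)) + (\<Sum>\<^sub>\<infinity>k\<in>-S. norm (c k))"
      using infsum_Un_disjoint[of "\<lambda>k. norm (c k)" S "-S"] c T(1)
      by (auto simp: S_def summable_on_subset_banach[OF c])
    moreover have "dist (\<Sum>k\<in>S. norm (c k)) (\<Sum>\<^sub>\<infinity>k. norm (c k)) < \<epsilon>"
      using T(1) by (intro T(2)[rule_format]) (auto simp: S_def)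
    ultimately show ?thesis using T(1) that[of S] by (auto simp: S_def dist_real_def)
  qed
  have "norm (\<Sum>k\<in>S. c k * ch k x) \<le> M + \<epsilon>" if x: "x \<in> X" for x
  proof -
    have cS: "(\<lambda>k. norm (c k)) summable_on - S" using summable_on_subset_banach[OF c] by blast
    have "f x = (\<Sum>k\<in>S. c k * ch k x) + (\<Sum>\<^sub>\<infinity>k\<in>-S. c k * ch k x)"
      using infsum_Un_disjoint[of "\<lambda>k. c k * ch k x" S "-S"] S(1) e x
       summable_on_subset_banach[OF summable_char[OF c x, of id], of "-S"]
      by (auto simp: expansion_def)
    moreover have "norm (\<Sum>\<^sub>\<infinity>k\<in>-S. c k * ch k x) \<le> (\<Sum>\<^sub>\<infinity>k\<in>-S. norm (c k * ch k x))"
      using norm_infsum_bound[OF abs_summable_char[OF cS x, of id]] by simp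
    moreover have "\<dots> \<le> (\<Sum>\<^sub>\<infinity>k\<in>-S. norm (c k))"
      using abs_summable_char[OF cS x, of id] cS
      by (intro infsum_mono) (auto simp: norm_mult intro!: mult_left_le norm_ch x)
    moreover have "norm (\<Sum>k\<in>S. c k * ch k x) \<le> norm (f x) + norm (\<Sum>\<^sub>\<infinity>k\<in>-S. c k * ch k x)"
      using calculation(1) norm_triangle_ineq4[of "f x" "\<Sum>\<^sub>\<infinity>k\<in>-S. c k * ch k x"] by simp
    ultimately show ?thesis using S M[OF x] by linarith
  qed
  then show "norm (c k) \<le> M + \<epsilon>" using finite_coeff_le_sup[OF S(1)] S(2) by blast
qed

lemma expansion_unique:
  assumes "expansion c f" "expansion d f"
  shows "c = d"
proof
  fix k
  have "expansion (\<lambda>k. - d k) (\<lambda>x. - f x)"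
    using assms(2) by (auto simp: expansion_def infsum_uminus)
  from expansion_add(1)[OF assms(1) this] have "expansion (\<lambda>k. c k - d k) (\<lambda>x. 0)" by simp
  from coeff_le_sup[OF this, of 0 k] show "c k = d k" by simp
qed

lemma expansion_norm_le:
  assumes "expansion c f" "wiener f C"
  shows "(\<Sum>\<^sub>\<infinity>k. norm (c k)) \<le> C"
  using assms expansion_unique unfolding wiener_def by blast

definition polynomial_deg :: "nat \<Rightarrow> (complex \<Rightarrow> complex) \<Rightarrow> bool" where
  "polynomial_deg d f \<longleftrightarrow> (\<exists>c. \<forall>x\<in>X. f x = (\<Sum>k | len k \<le> d. c k * ch k x))"

lemma polynomial_deg_mult:
  assumes "polynomial_deg d f" "polynomial_deg d' g"
  shows "polynomial_deg (d + d') (\<lambda>x. f x * g x)"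
proof -
  obtain a b where a: "\<And>x. x \<in> X \<Longrightarrow> f x = (\<Sum>k | len k \<le> d. a k * ch k x)"
    and b: "\<And>x. x \<in> X \<Longrightarrow> g x = (\<Sum>k | len k \<le> d'. b k * ch k x)"
    using assms by (auto simp: polynomial_deg_def)
  define P where "P = {k. len k \<le> d} \<times> {k. len k \<le> d'}"
  define T where "T = {k. len k \<le> d + d'}"
  define s where "s = (\<lambda>(j, k). j + k :: 'e)"
  define c where "c m = (\<Sum>(j, k)\<in>{p\<in>P. s p = m}. a j * b k)" for m
  have fin: "finite P" "finite T" by (auto simp: P_def T_def finite_len)
  have sub: "s ` P \<subseteq> T" unfolding s_def P_def T_def using len_add by (fastforce intro: order_trans)
  have "f x * g x = (\<Sum>m\<in>T. c m * ch m x)" if x: "x \<in> X" for x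
  proof -
    have "f x * g x = (\<Sum>p\<in>P. a (fst p) * b (snd p) * ch (s p) x)"
      unfolding a[OF x] b[OF x] sum_product sum.cartesian_product P_def
      by (intro sum.cong) (auto simp: s_def ch_add x)
    also have "\<dots> = (\<Sum>m\<in>T. \<Sum>p\<in>{p\<in>P. s p = m}. a (fst p) * b (snd p) * ch (s p) x)"
      by (rule sum.group[OF fin sub, symmetric])
    also have "\<dots> = (\<Sum>m\<in>T. c m * ch m x)"
      by (intro sum.cong refl) (auto simp: c_def sum_distrib_right case_prod_unfold)
    finally show ?thesis .
  qed
  then show ?thesis by (auto simp: polynomial_deg_def T_def)
qed

lemma polynomial_deg_power:
  "polynomial_deg d f \<Longrightarrow> polynomial_deg (n * d) (\<lambda>x. f x ^ n)"
proof (induction n)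
  case 0
  have "(\<Sum>k | len k \<le> 0. (if k = 0 then 1 else 0) * ch k x) = 1" if "x \<in> X" for x
  proof -
    have "(\<Sum>k | len k \<le> 0. (if k = 0 then 1 else 0) * ch k x) = (\<Sum>k | len k \<le> 0. if k = 0 then ch k x else 0)"
      by (intro sum.cong) auto
    then show ?thesis using finite_len[of 0] by (simp add: len_zero ch_zero that)
  qed
  then show ?case by (auto simp: polynomial_deg_def intro!: exI[of _ "\<lambda>k. if k = 0 then 1 else 0"])
next
  case (Suc n)
  then show ?case using polynomial_deg_mult[OF Suc.prems Suc.IH[OF Suc.prems]] by (simp add: add.commute)
qed

text \<open>
  A polynomial of degree \<open>d\<close> has at most \<open>2d + 1\<close> coefficients, and each is bounded by the sup norm.
\<close>

lemma wiener_polynomial: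
  assumes "polynomial_deg d f" "\<And>x. x \<in> X \<Longrightarrow> norm (f x) \<le> M" "X \<noteq> {}"
  shows "wiener f ((2 * real d + 1) * M)"
proof -
  have M0: "M \<ge> 0" using assms(2,3) norm_ge_zero order_trans by (metis ex_in_conv)
  obtain a where a: "\<And>x. x \<in> X \<Longrightarrow> f x = (\<Sum>k | len k \<le> d. a k * ch k x)"
    using assms by (auto simp: polynomial_deg_def)
  have aM: "norm (a k) \<le> M" if "len k \<le> d" for k
    using finite_coeff_le_sup[OF finite_len[of d], of a M k] a assms(2) that by force
  have "wiener (\<lambda>x. \<Sum>k | len k \<le> d. a k * ch k x) (\<Sum>k | len k \<le> d. norm (a k))"
    by (rule wiener_sum[OF finite_len wiener_monomial])
  then have "wiener f (\<Sum>k | len k \<le> d. norm (a k))" by (rule wiener_cong) (simp add: a)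
  moreover have "(\<Sum>k | len k \<le> d. norm (a k)) \<le> real (card {k. len k \<le> d}) * M"
    using sum_bounded_above[of "{k. len k \<le> d}" "\<lambda>k. norm (a k)" M] aM by auto
  moreover have "\<dots> \<le> (2 * real d + 1) * M"
    using card_len[of d] M0 by (intro mult_right_mono) (auto simp flip: of_nat_mult of_nat_Suc simp: of_nat_le_iff)
  ultimately show ?thesis using wiener_mono by (meson order_trans)
qed

lemma wiener_split:
  assumes "wiener f C" "\<epsilon> > 0"
  shows "\<exists>d t. polynomial_deg d t \<and> wiener (\<lambda>x. f x - t x) \<epsilon>"
proof -
  obtain c where c: "expansion c f" using assms by (auto simp: wiener_def)
  then have cs: "(\<lambda>k. norm (c k)) summable_on UNIV" by (auto simp: expansion_def)
  obtain T where T: "finite T" "\<And>Y. finite Y \<Longrightarrow> T \<subseteq> Y \<Longrightarrow> dist (\<Sum>k\<in>Y. norm (c k)) (\<Sum>\<^sub>\<infinity>k. norm (c k)) < \<epsilon>"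
    using finite_sums_close[OF cs assms(2)] by blast
  define d where "d = Max (insert 0 (len ` T))"
  define S where "S = {k. len k \<le> d}"
  have S: "finite S" "T \<subseteq> S" using T(1) by (auto simp: S_def finite_len d_def intro!: Max_ge)
  define t where "t x = (\<Sum>k\<in>S. c k * ch k x)" for x
  define b where "b k = (if k \<in> S then 0 else c k)" for k
  have bn: "(\<lambda>k. norm (b k)) summable_on UNIV"
    by (rule summable_on_comparison_test[OF cs]) (auto simp: b_def)
  have sp: "infsum g UNIV = (\<Sum>k\<in>S. g k) + (\<Sum>\<^sub>\<infinity>k\<in>-S. g k)" if "g summable_on UNIV"
    for g :: "'e \<Rightarrow> 'z::banach"
    using infsum_Un_disjoint[of g S "-S"] S(1) summable_on_subset_banach[OF that, of "-S"] by simp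
  have "wiener (\<lambda>x. f x - t x) (\<Sum>\<^sub>\<infinity>k. norm (b k))"
  proof (rule wiener_regroup[where e = id, OF bn])
    fix x assume x: "x \<in> X"
    have "f x = t x + (\<Sum>\<^sub>\<infinity>k\<in>-S. c k * ch k x)"
      using sp[OF summable_char[OF cs x, of id]] c x by (simp add: expansion_def t_def)
    moreover have "(\<Sum>\<^sub>\<infinity>k\<in>-S. c k * ch k x) = (\<Sum>\<^sub>\<infinity>k. b k * ch k x)"
      by (rule infsum_cong_neutral) (auto simp: b_def)
    ultimately show "f x - t x = (\<Sum>\<^sub>\<infinity>k. b k * ch (id k) x)" by simp
  qed
  moreover have "(\<Sum>\<^sub>\<infinity>k. norm (b k)) = (\<Sum>\<^sub>\<infinity>k\<in>-S. norm (c k))"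
    by (rule infsum_cong_neutral) (auto simp: b_def)
  moreover have "\<dots> \<le> \<epsilon>" using sp[OF cs] T(2)[OF S] by (simp add: dist_real_def)
  ultimately have "wiener (\<lambda>x. f x - t x) \<epsilon>" using wiener_mono by metis
  moreover have "polynomial_deg d t" by (auto simp: polynomial_deg_def t_def S_def)
  ultimately show ?thesis by blast
qed

text \<open>
  The spectral radius of \<open>f\<close> is at most its sup norm. Write \<open>f = t + s\<close> with a polynomial \<open>t\<close> and \<open>s\<close>
  of small Wiener norm, and expand \<open>f\<^sup>n\<close> binomially. The powers of \<open>t\<close> that occur are polynomials of
  degree at most \<open>nd\<close>, so passing from their sup norms to Wiener norms costs only a factor that is
  linear in \<open>n\<close>.
\<close>

lemma wiener_power_sup:
  assumes f: "wiener f C" and r0: "\<And>x. x \<in> X \<Longrightarrow> norm (f x) \<le> r0" and r: "r0 < r" and X: "X \<noteq> {}"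
  shows "\<exists>K. \<forall>n. wiener (\<lambda>x. f x ^ n) (K * r ^ n)"
proof -
  have r00: "r0 \<ge> 0" using r0 X norm_ge_zero order_trans by (metis ex_in_conv)
  define \<epsilon> where "\<epsilon> = (r - r0) / 3"
  have \<epsilon>: "\<epsilon> > 0" using r by (simp add: \<epsilon>_def)
  obtain d t where t: "polynomial_deg d t" "wiener (\<lambda>x. f x - t x) \<epsilon>" using wiener_split[OF f \<epsilon>] by (elim exE conjE)
  have tb: "norm (t x) \<le> r0 + \<epsilon>" if "x \<in> X" for x
    using wiener_norm_le[OF t(2) that] r0[OF that] norm_triangle_ineq2[of "t x" "f x"]
    by (simp add: norm_minus_commute)
  define \<rho> where "\<rho> = r0 + 2 * \<epsilon>"
  have \<rho>: "0 < \<rho>" "\<rho> < r" using r00 \<epsilon> r by (auto simp: \<rho>_def \<epsilon>_def field_simps)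
  have 1: "wiener (\<lambda>x. f x ^ n) ((2 * real (n * d) + 1) * \<rho> ^ n)" for n
  proof -
    have tk: "wiener (\<lambda>x. t x ^ k) ((2 * real (n * d) + 1) * (r0 + \<epsilon>) ^ k)" if "k \<le> n" for k
    proof (rule wiener_mono[OF wiener_polynomial[OF polynomial_deg_power[OF t(1)] _ X]])
      show "norm (t x ^ k) \<le> (r0 + \<epsilon>) ^ k" if "x \<in> X" for x
        using tb[OF that] by (simp add: norm_power power_mono)
      show "(2 * real (k * d) + 1) * (r0 + \<epsilon>) ^ k \<le> (2 * real (n * d) + 1) * (r0 + \<epsilon>) ^ k"
        using that r00 \<epsilon> by (intro mult_right_mono) (auto intro!: mult_right_mono)
    qed
    have "wiener (\<lambda>x. \<Sum>k\<le>n. of_nat (n choose k) * (t x ^ k * (f x - t x) ^ (n - k)))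
        (\<Sum>k\<le>n. norm (of_nat (n choose k) :: complex) * ((2 * real (n * d) + 1) * (r0 + \<epsilon>) ^ k * \<epsilon> ^ (n - k)))"
      by (intro wiener_sum wiener_scale wiener_mult tk wiener_power t(2)) auto
    moreover have "(\<Sum>k\<le>n. norm (of_nat (n choose k) :: complex) * ((2 * real (n * d) + 1) * (r0 + \<epsilon>) ^ k * \<epsilon> ^ (n - k)))
        = (2 * real (n * d) + 1) * (\<Sum>k\<le>n. of_nat (n choose k) * (r0 + \<epsilon>) ^ k * \<epsilon> ^ (n - k))"
      by (simp add: sum_distrib_left algebra_simps)
    moreover have "\<dots> = (2 * real (n * d) + 1) * (r0 + \<epsilon> + \<epsilon>) ^ n"
      by (simp only: binomial_ring)
    moreover have "(\<lambda>x. \<Sum>k\<le>n. of_nat (n choose k) * (t x ^ k * (f x - t x) ^ (n - k))) = (\<lambda>x. f x ^ n)"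
      by (rule ext, subst (2) diff_add_cancel[symmetric, of _ "t _"], subst add.commute, subst binomial_ring)
         (simp add: mult.assoc)
    ultimately show ?thesis by (simp add: \<rho>_def algebra_simps)
  qed
  have "(\<lambda>n. (2 * real (n * d) + 1) * (\<rho> / r) ^ n) \<longlonglongrightarrow> 0"
  proof -
    have q: "norm (\<rho> / r) < 1" using \<rho> by simp
    have "(\<lambda>n. 2 * real d * (real n * (\<rho> / r) ^ n) + (\<rho> / r) ^ n) \<longlonglongrightarrow> 2 * real d * 0 + 0"
      by (intro tendsto_intros powser_times_n_limit_0[OF q] LIMSEQ_power_zero[OF q])
    then show ?thesis by (simp add: algebra_simps)
  qed
  then have "Bseq (\<lambda>n. (2 * real (n * d) + 1) * (\<rho> / r) ^ n)" by (auto intro: convergent_imp_Bseq convergentI)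
  then obtain K where K: "\<And>n. norm ((2 * real (n * d) + 1) * (\<rho> / r) ^ n) \<le> K" by (auto simp: Bseq_def)
  have "wiener (\<lambda>x. f x ^ n) (K * r ^ n)" for n
  proof (rule wiener_mono[OF 1])
    have "(2 * real (n * d) + 1) * (\<rho> / r) ^ n \<le> K" using K[of n] by simp
    then have "(2 * real (n * d) + 1) * (\<rho> / r) ^ n * r ^ n \<le> K * r ^ n"
      using \<rho> by (intro mult_right_mono) auto
    then show "(2 * real (n * d) + 1) * \<rho> ^ n \<le> K * r ^ n" using \<rho> by (simp add: power_divide)
  qed
  then show ?thesis by blast
qed

text \<open>
  A power series with bounded coefficients may be applied to \<open>f\<close> as soon as the sup norm of \<open>f\<close> is
  below \<open>1\<close>, however large its Wiener norm. The geometric series gives inverses, the logarithmic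
  series gives the spectral factor.
\<close>

lemma wiener_power_series:
  assumes f: "wiener f C" and r0: "\<And>x. x \<in> X \<Longrightarrow> norm (f x) \<le> r0" and r: "r0 < 1" and X: "X \<noteq> {}"
    and b: "\<And>n. norm (b n) \<le> 1"
  shows "\<exists>D. wiener (\<lambda>x. \<Sum>n. b n * f x ^ n) D"
proof -
  \<comment> \<open>strictly between the sup norm and \<open>1\<close>\<close>
  define r where "r = (1 + max 0 r0) / 2"
  have rr: "0 < r" "r0 < r" "r < 1" using assms(3) by (auto simp: r_def max_def)
  obtain K where K: "\<And>n. wiener (\<lambda>x. f x ^ n) (K * r ^ n)" using wiener_power_sup[OF f r0 rr(2) X] by blast
  have "wiener (\<lambda>x. \<Sum>n. b n * f x ^ n) (\<Sum>n. K * r ^ n)"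
  proof (rule wiener_suminf[OF _ _ refl])
    show "wiener (\<lambda>x. b n * f x ^ n) (K * r ^ n)" for n
      by (rule wiener_mono[OF wiener_scale[OF K]])
         (use mult_right_mono[OF b[of n] wiener_nonneg[OF K[of n]]] in auto)
    show "summable (\<lambda>n. K * r ^ n)" using rr by (intro summable_mult summable_geometric) auto
  qed
  then show ?thesis by blast
qed

lemma wiener_inverse_one_minus:
  assumes f: "wiener f C" and r0: "\<And>x. x \<in> X \<Longrightarrow> norm (f x) \<le> r0" and r: "r0 < 1" and X: "X \<noteq> {}"
  shows "\<exists>D. wiener (\<lambda>x. 1 / (1 - f x)) D"
proof -
  obtain D where "wiener (\<lambda>x. \<Sum>n. 1 * f x ^ n) D"
    using wiener_power_series[OF f r0 r X, of "\<lambda>n. 1"] by auto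
  then have "wiener (\<lambda>x. 1 / (1 - f x)) D"
    by (rule wiener_cong) (use r r0 in \<open>force simp: suminf_geometric\<close>)
  then show ?thesis by blast
qed

end

section \<open>Absolutely convergent series on the circle and on the disc\<close>

lemma root_of_unity_sum:
  assumes "\<bar>m\<bar> < int N"
  shows "(\<Sum>i<N. (cis (2 * pi / real N) ^ i) powi m) = (if m = 0 then of_nat N else 0)"
proof (cases "m = 0")
  case False
  have N: "N > 0" using assms by linarith
  define z where "z = cis (2 * pi / real N * of_int m)"
  have "z \<noteq> 1"
  proof
    assume "z = 1"
    then obtain n :: int where n: "2 * pi / real N * of_int m = of_int (2 * n) * pi"
      by (auto simp: z_def cis_conv_exp exp_eq_1)
    then have "of_int m = of_int n * real N" using N by (simp add: field_simps)
    then have "m = n * int N" by (metis of_int_eq_iff of_int_mult of_int_of_nat_eq)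
    with assms False show False by (auto simp: abs_mult)
  qed
  moreover have "z ^ N = 1"
  proof -
    have "z ^ N = cis (real N * (2 * pi / real N * of_int m))" unfolding z_def by (rule Complex.DeMoivre)
    also have "real N * (2 * pi / real N * of_int m) = 2 * pi * of_int m" using N by simp
    also have "cis (2 * pi * of_int m) = 1" by (rule cis_multiple_2pi) simp
    finally show ?thesis .
  qed
  moreover have "(cis (2 * pi / real N) ^ i) powi m = z ^ i" for i
    unfolding z_def Complex.DeMoivre cis_power_int by (simp add: algebra_simps)
  ultimately show ?thesis using False geometric_sum[of z N] by simp
qed simp

text \<open>
  A finite substitute for the Fourier integral: averaging over the \<open>N\<close>-th roots of unity isolates
  the coefficient \<open>c k\<close> exactly, once \<open>N\<close> exceeds every difference \<open>\<bar>j - k\<bar>\<close> of exponents.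
\<close>

lemma laurent_coeff_le_sup:
  fixes c :: "int \<Rightarrow> complex"
  assumes S: "finite S" "k \<in> S"
    and M: "\<And>x. norm x = 1 \<Longrightarrow> norm (\<Sum>k\<in>S. c k * x powi k) \<le> M"
  shows "norm (c k) \<le> M"
proof -
  \<comment> \<open>more roots of unity than any difference of exponents, so that no other exponent aliases to \<open>k\<close>\<close>
  define N where "N = nat (Max ((\<lambda>j. \<bar>j - k\<bar>) ` S)) + 1"
  have N: "\<bar>j - k\<bar> < int N" if "j \<in> S" for j
  proof -
    have "\<bar>j - k\<bar> \<le> Max ((\<lambda>j. \<bar>j - k\<bar>) ` S)" using S that by (intro Max_ge) auto
    then show ?thesis unfolding N_def by linarith
  qed
  define w where "w i = cis (2 * pi / real N) ^ i" for i
  have w: "norm (w i) = 1" for i by (simp add: w_def norm_power)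
  then have w0: "w i \<noteq> 0" for i by (metis norm_zero zero_neq_one)
  have "(\<Sum>i<N. (\<Sum>j\<in>S. c j * w i powi j) * w i powi (- k)) = (\<Sum>i<N. \<Sum>j\<in>S. c j * w i powi (j - k))"
    by (intro sum.cong refl) (simp add: sum_distrib_right mult.assoc power_int_diff w0 power_int_minus divide_inverse)
  also have "\<dots> = (\<Sum>j\<in>S. c j * (\<Sum>i<N. w i powi (j - k)))"
    by (subst sum.swap) (simp add: sum_distrib_left)
  also have "\<dots> = (\<Sum>j\<in>S. if j = k then of_nat N * c k else 0)"
    unfolding w_def by (intro sum.cong refl) (auto simp: root_of_unity_sum[OF N])
  also have "\<dots> = of_nat N * c k" using S by simp
  finally have "real N * norm (c k) = norm (\<Sum>i<N. (\<Sum>j\<in>S. c j * w i powi j) * w i powi (- k))"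
    by (simp add: norm_mult)
  also have "\<dots> \<le> (\<Sum>i<N. M)"
    by (rule sum_norm_le) (auto intro!: M simp: norm_mult norm_power_int w)
  finally have "real N * norm (c k) \<le> real N * M" by simp
  then show ?thesis by (simp add: N_def)
qed

interpretation circle: character_series "sphere 0 1" "\<lambda>k x. x powi k" "\<lambda>k::int. nat \<bar>k\<bar>"
proof
  show "norm (c k) \<le> M" if "finite S" "\<And>x. x \<in> sphere 0 1 \<Longrightarrow> norm (\<Sum>k\<in>S. c k * x powi k) \<le> M" "k \<in> S"
    for c :: "int \<Rightarrow> complex" and S k M
    using laurent_coeff_le_sup[OF that(1,3)] that(2) by simp
  have *: "{k::int. nat \<bar>k\<bar> \<le> d} = {- int d..int d}" for d by auto
  show "finite {k::int. nat \<bar>k\<bar> \<le> d}" "card {k::int. nat \<bar>k\<bar> \<le> d} \<le> 2 * d + 1" for d unfolding * by auto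
qed (auto simp: norm_power_int intro!: power_int_add)

interpretation disc: character_series "cball 0 1" "\<lambda>n x. x ^ n" "\<lambda>n::nat. n"
proof
  show "norm (c k) \<le> M" if "finite S" "\<And>x. x \<in> cball 0 1 \<Longrightarrow> norm (\<Sum>k\<in>S. c k * x ^ k) \<le> M" "k \<in> S"
    for c :: "nat \<Rightarrow> complex" and S k M
  proof -
    have "norm ((c \<circ> nat) (int k)) \<le> M"
    proof (rule laurent_coeff_le_sup[of "int ` S"])
      fix x :: complex assume "norm x = 1"
      then show "norm (\<Sum>k\<in>int ` S. (c \<circ> nat) k * x powi k) \<le> M"
        using that(2)[of x] by (simp add: sum.reindex)
    qed (use that in auto)
    then show ?thesis by simp
  qed
  have *: "{k::nat. k \<le> d} = {..d}" for d by auto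
  show "finite {k::nat. k \<le> d}" "card {k::nat. k \<le> d} \<le> 2 * d + 1" for d unfolding * by auto
qed (auto simp: power_add norm_power power_le_one)

lemma cnj_eq_inverse:
  assumes "norm x = 1"
  shows "cnj x = inverse x"
proof -
  have "x * cnj x = 1" using complex_norm_square[of x] assms by simp
  then show ?thesis by (metis inverse_unique)
qed

lemma circle_expansion_of_disc:
  assumes "disc.expansion c f"
  shows "circle.expansion (\<lambda>k. if k \<ge> 0 then c (nat k) else 0) f"
proof -
  have bij: "bij_betw int UNIV {0..}" by (rule bij_betwI[where g = nat]) auto
  have c: "(\<lambda>n. norm (c n)) summable_on UNIV" using assms by (auto simp: disc.expansion_def)
  have "(\<lambda>k. norm (c (nat k))) summable_on {0..}"
    using summable_on_reindex_bij_betw[OF bij, of "\<lambda>k. norm (c (nat k))"] c by simp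
  then have "(\<lambda>k. norm (if k \<ge> 0 then c (nat k) else 0)) summable_on (UNIV::int set)"
    by (subst summable_on_cong_neutral[of "{0..}"]) auto
  moreover have "f x = (\<Sum>\<^sub>\<infinity>k. (if k \<ge> 0 then c (nat k) else 0) * x powi k)" if "x \<in> sphere 0 1" for x
  proof -
    have "f x = (\<Sum>\<^sub>\<infinity>n. c (nat (int n)) * x powi (int n))"
      using assms that by (simp add: disc.expansion_def)
    also have "\<dots> = (\<Sum>\<^sub>\<infinity>k\<in>{0..}. c (nat k) * x powi k)"
      by (rule infsum_reindex_bij_betw[OF bij])
    also have "\<dots> = (\<Sum>\<^sub>\<infinity>k. (if k \<ge> 0 then c (nat k) else 0) * x powi k)"
      by (rule infsum_cong_neutral) auto
    finally show ?thesis .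
  qed
  ultimately show ?thesis by (auto simp: circle.expansion_def)
qed

lemma circle_wiener_of_disc: "disc.wiener f C \<Longrightarrow> circle.wiener f C"
proof -
  assume "disc.wiener f C"
  then obtain c where c: "disc.expansion c f" "(\<Sum>\<^sub>\<infinity>k. norm (c k)) \<le> C" by (auto simp: disc.wiener_def)
  have "circle.wiener f (\<Sum>\<^sub>\<infinity>k. norm (c k))"
    by (rule circle.wiener_regroup[where e = int]) (use c in \<open>auto simp: disc.expansion_def\<close>)
  then show ?thesis using c(2) circle.wiener_mono by blast
qed

lemma circle_expansion_cnj:
  assumes "circle.expansion c f"
  shows "circle.expansion (\<lambda>k. cnj (c (- k))) (\<lambda>x. cnj (f x))"
    "(\<Sum>\<^sub>\<infinity>k. norm (cnj (c (- k)))) = (\<Sum>\<^sub>\<infinity>k. norm (c k))"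
proof -
  have bij: "bij_betw (uminus :: int \<Rightarrow> int) UNIV UNIV" by (rule bij_uminus)
  have c: "(\<lambda>k. norm (c k)) summable_on UNIV" using assms by (auto simp: circle.expansion_def)
  show "(\<Sum>\<^sub>\<infinity>k. norm (cnj (c (- k)))) = (\<Sum>\<^sub>\<infinity>k. norm (c k))"
    using infsum_reindex_bij_betw[OF bij, of "\<lambda>k. norm (c k)"] by simp
  have "(\<lambda>k. norm (cnj (c (- k)))) summable_on UNIV"
    using summable_on_reindex_bij_betw[OF bij, of "\<lambda>k. norm (c k)"] c by simp
  moreover have "cnj (f x) = (\<Sum>\<^sub>\<infinity>k. cnj (c (- k)) * x powi k)" if x: "x \<in> sphere 0 1" for x
  proof -
    have cx: "cnj (x powi (- k)) = x powi k" for k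
    proof -
      have "norm (x powi (- k)) = 1" using x by (simp add: norm_power_int)
      then have "cnj (x powi (- k)) = inverse (x powi (- k))" by (rule cnj_eq_inverse)
      then show ?thesis by (simp add: power_int_minus)
    qed
    have "cnj (f x) = (\<Sum>\<^sub>\<infinity>k. cnj (c k * x powi k))"
      unfolding infsum_cnj using assms x by (simp add: circle.expansion_def)
    also have "\<dots> = (\<Sum>\<^sub>\<infinity>k. cnj (c (- k) * x powi (- k)))"
      using infsum_reindex_bij_betw[OF bij, of "\<lambda>k. cnj (c k * x powi k)"] by simp
    also have "\<dots> = (\<Sum>\<^sub>\<infinity>k. cnj (c (- k)) * x powi k)"
      by (simp only: complex_cnj_mult cx)
    finally show ?thesis .
  qed
  ultimately show "circle.expansion (\<lambda>k. cnj (c (- k))) (\<lambda>x. cnj (f x))" by (auto simp: circle.expansion_def)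
qed

lemma circle_wiener_cnj: "circle.wiener f C \<Longrightarrow> circle.wiener (\<lambda>x. cnj (f x)) C"
  using circle_expansion_cnj unfolding circle.wiener_def by metis

lemma disc_expansion_suminf:
  assumes "disc.expansion c f"
  shows "summable (\<lambda>n. norm (c n))" "x \<in> cball 0 1 \<Longrightarrow> (\<lambda>n. c n * x ^ n) sums f x"
    "(\<Sum>\<^sub>\<infinity>n. norm (c n)) = (\<Sum>n. norm (c n))"
proof -
  have c: "(\<lambda>n. norm (c n)) summable_on UNIV" using assms by (auto simp: disc.expansion_def)
  then show "summable (\<lambda>n. norm (c n))" using summable_on_UNIV_nonneg_real_iff by force
  show "(\<Sum>\<^sub>\<infinity>n. norm (c n)) = (\<Sum>n. norm (c n))"
    using c has_sum_imp_sums has_sum_infsum sums_unique by metis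
  assume x: "x \<in> cball 0 1"
  have "((\<lambda>n. c n * x ^ n) has_sum f x) UNIV"
    using assms x disc.summable_char[OF c x, of id] by (simp add: disc.expansion_def)
  then show "(\<lambda>n. c n * x ^ n) sums f x" by (rule has_sum_imp_sums)
qed

lemma disc_expansionI:
  assumes "summable (\<lambda>n. norm (c n))" "\<And>x. norm x \<le> 1 \<Longrightarrow> (\<lambda>n. c n * x ^ n) sums f x"
  shows "disc.expansion c f" "disc.wiener f (\<Sum>n. norm (c n))"
proof -
  have c: "(\<lambda>n. norm (c n)) summable_on UNIV" using assms(1) by (simp add: summable_on_UNIV_nonneg_real_iff)
  moreover have "f x = (\<Sum>\<^sub>\<infinity>n. c n * x ^ n)" if x: "x \<in> cball 0 1" for x
  proof -
    have "((\<lambda>n. c n * x ^ n) has_sum (\<Sum>\<^sub>\<infinity>n. c n * x ^ n)) UNIV"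
      using disc.summable_char[OF c x, of id] by simp
    then have "(\<lambda>n. c n * x ^ n) sums (\<Sum>\<^sub>\<infinity>n. c n * x ^ n)" by (rule has_sum_imp_sums)
    then show ?thesis using assms(2)[of x] x sums_unique2 by auto
  qed
  ultimately show e: "disc.expansion c f" by (auto simp: disc.expansion_def)
  show "disc.wiener f (\<Sum>n. norm (c n))"
    using e disc_expansion_suminf(3)[OF e] unfolding disc.wiener_def by force
qed

lemma disc_expansion_0: "disc.expansion c f \<Longrightarrow> f 0 = c 0"
  using disc_expansion_suminf(2)[of c f 0] by (simp add: sums_unique2)

lemma disc_wiener_continuous:
  assumes "disc.wiener f C"
  shows "continuous_on (cball 0 1) f" "f holomorphic_on ball 0 1"
proof -
  obtain c where c: "disc.expansion c f" using assms by (auto simp: disc.wiener_def)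
  have u: "uniform_limit (cball 0 1) (\<lambda>n x. \<Sum>i<n. c i * x ^ i) (\<lambda>x. \<Sum>i. c i * x ^ i) sequentially"
    by (rule Weierstrass_m_test[OF _ disc_expansion_suminf(1)[OF c]])
       (auto simp: norm_mult norm_power intro!: mult_left_le power_le_one)
  have "uniform_limit (cball 0 1) (\<lambda>n x. \<Sum>i<n. c i * x ^ i) f sequentially"
    by (rule uniform_limit_cong'[THEN iffD1, OF _ _ u])
       (use disc_expansion_suminf(2)[OF c] sums_unique in fastforce)+
  note lim = this
  show "continuous_on (cball 0 1) f"
    by (rule uniform_limit_theorem[OF _ lim])
       (auto intro!: always_eventually continuous_intros)
  show "f holomorphic_on ball 0 1"
  proof (rule holomorphic_uniform_sequence)
    fix x :: complex assume "x \<in> ball 0 1"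
    then obtain e where "e > 0" "cball x e \<subseteq> ball 0 1" using open_contains_cball open_ball by metis
    then show "\<exists>d>0. cball x d \<subseteq> ball 0 1 \<and>
        uniform_limit (cball x d) (\<lambda>n x. \<Sum>i<n. c i * x ^ i) f sequentially"
      using uniform_limit_on_subset[OF lim] ball_subset_cball by blast
  qed (auto intro!: holomorphic_intros)
qed

text \<open>
  Removing the value at \<open>0\<close> lowers the norm by exactly \<open>\<bar>f 0\<bar>\<close>. This gain drives the summation of the
  Schur parameters.
\<close>

lemma disc_wiener_divide:
  assumes "disc.wiener f C"
  obtains R where "disc.wiener R (C - norm (f 0))" "\<And>x. norm x \<le> 1 \<Longrightarrow> f x = f 0 + x * R x"
proof -
  obtain c where c: "disc.expansion c f" "(\<Sum>\<^sub>\<infinity>k. norm (c k)) \<le> C" using assms by (auto simp: disc.wiener_def)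
  note s = disc_expansion_suminf[OF c(1)]
  define R where "R x = (\<Sum>n. c (Suc n) * x ^ n)" for x
  have sS: "summable (\<lambda>n. norm (c (Suc n)))" using s(1) summable_Suc_iff[of "\<lambda>n. norm (c n)"] by simp
  have R: "(\<lambda>n. c (Suc n) * x ^ n) sums R x" if "norm x \<le> 1" for x
  proof -
    have "summable (\<lambda>n. norm (c (Suc n) * x ^ n))"
      by (rule summable_comparison_test'[OF sS]) (auto simp: norm_mult norm_power that intro!: mult_left_le power_le_one)
    then show ?thesis unfolding R_def by (rule summable_sums[OF summable_norm_cancel])
  qed
  have "disc.wiener R (\<Sum>n. norm (c (Suc n)))" by (rule disc_expansionI(2)[OF sS R])
  moreover have "(\<Sum>n. norm (c (Suc n))) \<le> C - norm (f 0)"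
    using suminf_split_head[OF s(1)] s(3) c(2) disc_expansion_0[OF c(1)] by simp
  moreover have "f x = f 0 + x * R x" if "norm x \<le> 1" for x
  proof -
    have "(\<lambda>n. x * (c (Suc n) * x ^ n)) sums (x * R x)" by (rule sums_mult[OF R[OF that]])
    then have "(\<lambda>n. c (Suc n) * x ^ Suc n) sums (x * R x)" by (simp add: algebra_simps)
    then have "(\<lambda>n. c n * x ^ n) sums (x * R x + c 0)" by (subst (asm) sums_Suc_iff) simp
    then show ?thesis using s(2)[of x] that disc_expansion_0[OF c(1)] sums_unique2 by (simp add: add.commute)
  qed
  ultimately show ?thesis using that disc.wiener_mono by blast
qed

text \<open>
  The projection onto nonnegative frequencies has norm \<open>1\<close>, and it annihilates \<open>cnj (x * G x)\<close>, which
  has only negative frequencies; hence the coefficients of \<open>f\<close> are among those of \<open>h\<close>.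
\<close>

lemma disc_part_bound:
  assumes f: "disc.wiener f C" and h: "circle.wiener h T" and G: "disc.wiener G D"
    and eq: "\<And>x. norm x = 1 \<Longrightarrow> f x = h x + cnj (x * G x)"
  shows "disc.wiener f T"
proof -
  obtain c where c: "disc.expansion c f" using f by (auto simp: disc.wiener_def)
  obtain d where d: "circle.expansion d h" "(\<Sum>\<^sub>\<infinity>k. norm (d k)) \<le> T" using h by (auto simp: circle.wiener_def)
  have "disc.wiener (\<lambda>x. x ^ 1 * G x) (1 * D)" by (rule disc.wiener_mult[OF disc.wiener_char G])
  then obtain p where p: "disc.expansion p (\<lambda>x. x ^ 1 * G x)" by (auto simp: disc.wiener_def)
  have p0: "p 0 = 0" using disc_expansion_0[OF p] by simp
  define e where "e k = cnj (if - k \<ge> 0 then p (nat (- k)) else 0)" for k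
  have e: "circle.expansion e (\<lambda>x. cnj (x ^ 1 * G x))"
    unfolding e_def by (rule circle_expansion_cnj(1)[OF circle_expansion_of_disc[OF p]])
  have "circle.expansion (\<lambda>k. if k \<ge> 0 then c (nat k) else 0) (\<lambda>x. h x + cnj (x ^ 1 * G x))"
    using circle_expansion_of_disc[OF c] eq by (auto simp: circle.expansion_def)
  from circle.expansion_unique[OF this circle.expansion_add(1)[OF d(1) e]]
  have ce: "(if k \<ge> 0 then c (nat k) else 0) = d k + e k" for k by meson
  have cd: "c n = d (int n)" for n
    using ce[of "int n"] p0 by (auto simp: e_def split: if_splits)
  have ds: "(\<lambda>k. norm (d k)) summable_on UNIV" using d by (auto simp: circle.expansion_def)
  have "(\<Sum>\<^sub>\<infinity>n. norm (c n)) = (\<Sum>\<^sub>\<infinity>k\<in>range int. norm (d k))"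
    by (simp add: infsum_reindex cd o_def)
  also have "\<dots> \<le> (\<Sum>\<^sub>\<infinity>k. norm (d k))"
    by (rule infsum_mono_neutral) (use ds summable_on_subset_banach[OF ds] in auto)
  finally show ?thesis using c d(2) unfolding disc.wiener_def by force
qed

section \<open>Schur functions from their parameters\<close>

text \<open>
  The inverse Schur algorithm in homogeneous coordinates: with \<open>(v, u)\<close> as state, no quotient is
  formed before the limit is taken, and the recursion is linear in the initial state.
\<close>

primrec schur_state :: "(nat \<Rightarrow> complex) \<Rightarrow> complex \<Rightarrow> complex \<times> complex \<Rightarrow> nat \<Rightarrow> complex \<times> complex" where
  "schur_state \<gamma> \<zeta> p 0 = p"
| "schur_state \<gamma> \<zeta> p (Suc n) = 
     (fst (schur_state \<gamma> \<zeta> p n) + \<gamma> n * snd (schur_state \<gamma> \<zeta> p n),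
      \<zeta> * (snd (schur_state \<gamma> \<zeta> p n) + cnj (\<gamma> n) * fst (schur_state \<gamma> \<zeta> p n)))"

text \<open>
  By linearity the states started at \<open>(1, 0)\<close> and \<open>(0, 1)\<close> determine all others. They are the Wall
  polynomials; \<open>wall_B / wall_A\<close> is the approximant that ends the continued fraction after \<open>n\<close>
  parameters, and the primed versions enter when it is continued by a further value.
\<close>

definition wall_A :: "(nat \<Rightarrow> complex) \<Rightarrow> complex \<Rightarrow> nat \<Rightarrow> complex" where
  "wall_A \<gamma> \<zeta> n = fst (schur_state \<gamma> \<zeta> (1, 0) n)"
definition wall_B :: "(nat \<Rightarrow> complex) \<Rightarrow> complex \<Rightarrow> nat \<Rightarrow> complex" where
  "wall_B \<gamma> \<zeta> n = fst (schur_state \<gamma> \<zeta> (0, 1) n)"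
definition wall_A' :: "(nat \<Rightarrow> complex) \<Rightarrow> complex \<Rightarrow> nat \<Rightarrow> complex" where
  "wall_A' \<gamma> \<zeta> n = snd (schur_state \<gamma> \<zeta> (1, 0) n)"
definition wall_B' :: "(nat \<Rightarrow> complex) \<Rightarrow> complex \<Rightarrow> nat \<Rightarrow> complex" where
  "wall_B' \<gamma> \<zeta> n = snd (schur_state \<gamma> \<zeta> (0, 1) n)"

lemma wall_0 [simp]: "wall_A \<gamma> \<zeta> 0 = 1" "wall_A' \<gamma> \<zeta> 0 = 0" "wall_B \<gamma> \<zeta> 0 = 0" "wall_B' \<gamma> \<zeta> 0 = 1"
  by (simp_all add: wall_A_def wall_A'_def wall_B_def wall_B'_def)

lemma wall_Suc:
  "wall_A \<gamma> \<zeta> (Suc n) = wall_A \<gamma> \<zeta> n + \<gamma> n * wall_A' \<gamma> \<zeta> n"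
  "wall_A' \<gamma> \<zeta> (Suc n) = \<zeta> * (wall_A' \<gamma> \<zeta> n + cnj (\<gamma> n) * wall_A \<gamma> \<zeta> n)"
  "wall_B \<gamma> \<zeta> (Suc n) = wall_B \<gamma> \<zeta> n + \<gamma> n * wall_B' \<gamma> \<zeta> n"
  "wall_B' \<gamma> \<zeta> (Suc n) = \<zeta> * (wall_B' \<gamma> \<zeta> n + cnj (\<gamma> n) * wall_B \<gamma> \<zeta> n)"
  unfolding wall_A_def wall_A'_def wall_B_def wall_B'_def schur_state.simps fst_conv snd_conv by (rule refl)+

lemma schur_state_wall:
  "schur_state \<gamma> \<zeta> (v, u) n =
     (v * wall_A \<gamma> \<zeta> n + u * wall_B \<gamma> \<zeta> n, v * wall_A' \<gamma> \<zeta> n + u * wall_B' \<gamma> \<zeta> n)"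
proof (induction n)
  case (Suc n)
  show ?case unfolding schur_state.simps Suc.IH fst_conv snd_conv wall_Suc by (simp add: algebra_simps)
qed simp

text \<open>
  The recursion appends parameters at the end, while the Schur algorithm strips them from the front.
\<close>

lemma schur_state_front:
  "schur_state \<gamma> \<zeta> (v, u) (Suc n) = schur_state (\<lambda>k. \<gamma> (Suc k)) \<zeta> (v + \<gamma> 0 * u, \<zeta> * (u + cnj (\<gamma> 0) * v)) n"
proof (induction n)
  case 0
  show ?case unfolding schur_state.simps fst_conv snd_conv by (rule refl)
next
  case (Suc n)
  show ?case
    by (rule trans[OF schur_state.simps(2)], unfold Suc.IH, rule schur_state.simps(2)[symmetric])
qed

lemma wall_front:
  "wall_A \<gamma> \<zeta> (Suc n) = wall_A (\<lambda>k. \<gamma> (Suc k)) \<zeta> n + \<zeta> * cnj (\<gamma> 0) * wall_B (\<lambda>k. \<gamma> (Suc k)) \<zeta> n"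
  "wall_B \<gamma> \<zeta> (Suc n) = \<gamma> 0 * wall_A (\<lambda>k. \<gamma> (Suc k)) \<zeta> n + \<zeta> * wall_B (\<lambda>k. \<gamma> (Suc k)) \<zeta> n"
  unfolding wall_A_def[of \<gamma>] wall_B_def[of \<gamma>] schur_state_front
  unfolding schur_state_wall by simp_all

lemma wall_det:
  "wall_A \<gamma> \<zeta> n * wall_B' \<gamma> \<zeta> n - wall_B \<gamma> \<zeta> n * wall_A' \<gamma> \<zeta> n = \<zeta> ^ n * of_real (\<Prod>k<n. 1 - (norm (\<gamma> k))\<^sup>2)"
proof (induction n)
  case (Suc n)
  have "wall_A \<gamma> \<zeta> (Suc n) * wall_B' \<gamma> \<zeta> (Suc n) - wall_B \<gamma> \<zeta> (Suc n) * wall_A' \<gamma> \<zeta> (Suc n)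
     = \<zeta> * (1 - \<gamma> n * cnj (\<gamma> n)) * (wall_A \<gamma> \<zeta> n * wall_B' \<gamma> \<zeta> n - wall_B \<gamma> \<zeta> n * wall_A' \<gamma> \<zeta> n)"
    by (simp add: wall_Suc algebra_simps)
  also have "1 - \<gamma> n * cnj (\<gamma> n) = of_real (1 - (norm (\<gamma> n))\<^sup>2)"
    by (simp add: complex_norm_square[symmetric])
  finally show ?case unfolding Suc.IH by simp
qed simp

text \<open>
  The matrix with unit diagonal and off-diagonal entries \<open>g\<close>, \<open>cnj g\<close> scales the form
  \<open>\<bar>a\<bar>\<^sup>2 - \<bar>b\<bar>\<^sup>2\<close> by its determinant. All contractivity below comes from this identity.
\<close>

lemma blaschke_identity:
  fixes a b g :: complex
  shows "(norm (a + g * b))\<^sup>2 - (norm (cnj g * a + b))\<^sup>2 = (1 - (norm g)\<^sup>2) * ((norm a)\<^sup>2 - (norm b)\<^sup>2)"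
proof -
  have "complex_of_real ((norm (a + g * b))\<^sup>2 - (norm (cnj g * a + b))\<^sup>2)
     = of_real ((1 - (norm g)\<^sup>2) * ((norm a)\<^sup>2 - (norm b)\<^sup>2))"
    by (simp only: of_real_diff of_real_mult complex_norm_square of_real_1 complex_cnj_add complex_cnj_mult complex_cnj_cnj)
       (simp add: algebra_simps)
  then show ?thesis by (simp only: of_real_eq_iff)
qed

locale schur_parameters =
  fixes \<gamma> :: "nat \<Rightarrow> complex"
  assumes norm_less_1: "norm (\<gamma> n) < 1"
begin

lemma pos_factor: "0 < 1 - (norm (\<gamma> n))\<^sup>2"
  using norm_less_1[of n] by (simp add: abs_square_less_1)

lemma wall_A'_le:
  assumes "norm \<zeta> < 1"
  shows "norm (wall_A' \<gamma> \<zeta> n) \<le> norm \<zeta> * norm (wall_A \<gamma> \<zeta> n) \<and> wall_A \<gamma> \<zeta> n \<noteq> 0"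
proof (induction n)
  case (Suc n)
  define a where "a = wall_A \<gamma> \<zeta> n"
  define b where "b = wall_A' \<gamma> \<zeta> n"
  have b: "norm b \<le> norm \<zeta> * norm a" "a \<noteq> 0" using Suc by (auto simp: a_def b_def)
  have ba: "norm b \<le> norm a" using b(1) assms mult_right_mono[of "norm \<zeta>" 1 "norm a"] by simp
  have "(norm (a + \<gamma> n * b))\<^sup>2 - (norm (cnj (\<gamma> n) * a + b))\<^sup>2 \<ge> 0"
    unfolding blaschke_identity using pos_factor[of n] ba by (simp add: power_mono)
  then have "(norm (cnj (\<gamma> n) * a + b))\<^sup>2 \<le> (norm (a + \<gamma> n * b))\<^sup>2" by linarith
  then have le: "norm (cnj (\<gamma> n) * a + b) \<le> norm (a + \<gamma> n * b)"
    by (rule power2_le_imp_le) (rule norm_ge_zero)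
  have "norm (\<gamma> n * b) < norm a"
  proof -
    have "norm (\<gamma> n * b) \<le> norm (\<gamma> n) * norm a" using ba by (simp add: norm_mult mult_left_mono)
    also have "\<dots> < norm a" using norm_less_1[of n] b(2) by simp
    finally show ?thesis .
  qed
  then have "a + \<gamma> n * b \<noteq> 0" by (metis add_eq_0_iff norm_minus_cancel less_irrefl)
  moreover have "norm (\<zeta> * (b + cnj (\<gamma> n) * a)) \<le> norm \<zeta> * norm (a + \<gamma> n * b)"
    using le by (simp add: norm_mult mult_left_mono add.commute)
  ultimately show ?case by (simp add: wall_Suc a_def b_def)
qed simp

text \<open>
  Iterating \<open>blaschke_identity\<close>, and losing only through \<open>\<bar>\<zeta>\<bar> \<le> 1\<close>. The last step of the recursion acts
  on the row vector \<open>(x, y)\<close>, which therefore varies in the induction.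
\<close>

lemma wall_form:
  assumes "norm \<zeta> \<le> 1"
  shows "(norm (x * wall_A \<gamma> \<zeta> n + y * wall_A' \<gamma> \<zeta> n))\<^sup>2 - (norm (x * wall_B \<gamma> \<zeta> n + y * wall_B' \<gamma> \<zeta> n))\<^sup>2
     \<ge> (\<Prod>k<n. 1 - (norm (\<gamma> k))\<^sup>2) * ((norm x)\<^sup>2 - (norm y)\<^sup>2)"
proof (induction n arbitrary: x y)
  case (Suc n)
  define c where "c = (\<Prod>k<n. 1 - (norm (\<gamma> k))\<^sup>2)"
  have c: "c \<ge> 0" unfolding c_def by (intro prod_nonneg less_imp_le[OF pos_factor] ballI)
  define x' where "x' = x + cnj (\<gamma> n) * (\<zeta> * y)"
  define y' where "y' = \<gamma> n * x + \<zeta> * y"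
  have "(norm (\<zeta> * y))\<^sup>2 \<le> (norm y)\<^sup>2"
    using assms by (intro power_mono) (auto simp: norm_mult intro: mult_left_le_one_le)
  then have "c * (1 - (norm (\<gamma> n))\<^sup>2) * ((norm x)\<^sup>2 - (norm y)\<^sup>2) \<le> c * (1 - (norm (\<gamma> n))\<^sup>2) * ((norm x)\<^sup>2 - (norm (\<zeta> * y))\<^sup>2)"
    using c pos_factor[of n] by (intro mult_left_mono) auto
  also have "\<dots> = c * ((norm x')\<^sup>2 - (norm y')\<^sup>2)"
    unfolding x'_def y'_def using blaschke_identity[of x "cnj (\<gamma> n)" "\<zeta> * y"] by simp
  also have "\<dots> \<le> (norm (x' * wall_A \<gamma> \<zeta> n + y' * wall_A' \<gamma> \<zeta> n))\<^sup>2 - (norm (x' * wall_B \<gamma> \<zeta> n + y' * wall_B' \<gamma> \<zeta> n))\<^sup>2"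
    unfolding c_def by (rule Suc.IH)
  also have "x' * wall_A \<gamma> \<zeta> n + y' * wall_A' \<gamma> \<zeta> n = x * wall_A \<gamma> \<zeta> (Suc n) + y * wall_A' \<gamma> \<zeta> (Suc n)"
    by (simp add: wall_Suc x'_def y'_def algebra_simps)
  also have "x' * wall_B \<gamma> \<zeta> n + y' * wall_B' \<gamma> \<zeta> n = x * wall_B \<gamma> \<zeta> (Suc n) + y * wall_B' \<gamma> \<zeta> (Suc n)"
    by (simp add: wall_Suc x'_def y'_def algebra_simps)
  finally show ?case by (simp add: c_def mult.commute)
qed simp

lemma wall_A_ge:
  assumes "norm \<zeta> \<le> 1"
  shows "(norm (wall_A \<gamma> \<zeta> n))\<^sup>2 \<ge> (\<Prod>k<n. 1 - (norm (\<gamma> k))\<^sup>2) + (norm (wall_B \<gamma> \<zeta> n))\<^sup>2"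
  using wall_form[OF assms, of n 1 0] by simp

text \<open>
  However the continued fraction is continued after \<open>n\<close> parameters, by a value \<open>\<omega>\<close> in the closed
  unit disc, its value stays within \<open>\<bar>\<zeta>\<bar>\<^sup>n / (1 - \<bar>\<zeta>\<bar>)\<close> of the \<open>n\<close>-th approximant. The difference of the
  two quotients is \<open>\<omega>\<close> times the determinant over the product of the denominators; the product
  \<open>\<Prod>(1 - \<bar>\<gamma>\<^sub>k\<bar>\<^sup>2)\<close> in the determinant is absorbed by \<open>\<bar>wall_A\<bar>\<^sup>2\<close>, so the bound does not depend
  on the parameters.
\<close>

lemma wall_ratio_diff:
  assumes z: "norm \<zeta> < 1" and w: "norm \<omega> \<le> 1"
  shows "wall_A \<gamma> \<zeta> n + \<omega> * wall_A' \<gamma> \<zeta> n \<noteq> 0"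
    "norm ((wall_B \<gamma> \<zeta> n + \<omega> * wall_B' \<gamma> \<zeta> n) / (wall_A \<gamma> \<zeta> n + \<omega> * wall_A' \<gamma> \<zeta> n)
        - wall_B \<gamma> \<zeta> n / wall_A \<gamma> \<zeta> n) \<le> norm \<zeta> ^ n / (1 - norm \<zeta>)"
proof -
  define A where "A = wall_A \<gamma> \<zeta> n"
  define A' where "A' = wall_A' \<gamma> \<zeta> n"
  define B where "B = wall_B \<gamma> \<zeta> n"
  define B' where "B' = wall_B' \<gamma> \<zeta> n"
  define c where "c = (\<Prod>k<n. 1 - (norm (\<gamma> k))\<^sup>2)"
  have c: "c > 0" unfolding c_def by (intro prod_pos pos_factor ballI)
  have A: "norm A' \<le> norm \<zeta> * norm A" "A \<noteq> 0" using wall_A'_le[OF z, of n] by (auto simp: A_def A'_def)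
  have "norm (\<omega> * A') \<le> norm \<zeta> * norm A"
    using w A(1) mult_left_le_one_le[of "norm A'" "norm \<omega>"] by (simp add: norm_mult)
  then have d: "norm (A + \<omega> * A') \<ge> norm A * (1 - norm \<zeta>)"
    using norm_diff_ineq[of A "\<omega> * A'"] by (simp add: algebra_simps)
  have A0: "norm A * (1 - norm \<zeta>) > 0" using A z by simp
  with d show ne: "wall_A \<gamma> \<zeta> n + \<omega> * wall_A' \<gamma> \<zeta> n \<noteq> 0" unfolding A_def A'_def
    by (metis norm_zero not_less)
  have "(B + \<omega> * B') / (A + \<omega> * A') - B / A = \<omega> * (A * B' - B * A') / ((A + \<omega> * A') * A)"
    using ne A(2) unfolding A_def[symmetric] A'_def[symmetric] by (simp add: divide_simps) (simp add: algebra_simps)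
  also have "A * B' - B * A' = \<zeta> ^ n * of_real c"
    using wall_det[of \<gamma> \<zeta> n] by (simp add: A_def A'_def B_def B'_def c_def)
  finally have "norm ((B + \<omega> * B') / (A + \<omega> * A') - B / A) = norm \<omega> * (norm \<zeta> ^ n * c) / (norm (A + \<omega> * A') * norm A)"
    using c by (simp add: norm_mult norm_divide norm_power)
  also have "\<dots> \<le> 1 * (norm \<zeta> ^ n * c) / (norm A * (1 - norm \<zeta>) * norm A)"
    using w c d A0 A(2) z by (intro frac_le mult_right_mono mult_pos_pos) auto
  also have "\<dots> \<le> (norm \<zeta> ^ n * c) / (c * (1 - norm \<zeta>))"
  proof -
    have "c \<le> (norm A)\<^sup>2"
      using wall_A_ge[OF less_imp_le[OF z], of n] zero_le_power2[of "norm (wall_B \<gamma> \<zeta> n)"]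
      unfolding A_def c_def by linarith
    then have "c \<le> norm A * norm A" by (simp only: power2_eq_square)
    then have "c * (1 - norm \<zeta>) \<le> norm A * (1 - norm \<zeta>) * norm A"
      using z mult_right_mono[of c "norm A * norm A" "1 - norm \<zeta>"] by (simp add: algebra_simps)
    then show ?thesis using c z by (intro frac_le) auto
  qed
  also have "\<dots> = norm \<zeta> ^ n / (1 - norm \<zeta>)" using c by simp
  finally show "norm ((wall_B \<gamma> \<zeta> n + \<omega> * wall_B' \<gamma> \<zeta> n) / (wall_A \<gamma> \<zeta> n + \<omega> * wall_A' \<gamma> \<zeta> n)
        - wall_B \<gamma> \<zeta> n / wall_A \<gamma> \<zeta> n) \<le> norm \<zeta> ^ n / (1 - norm \<zeta>)"
    unfolding A_def A'_def B_def B'_def .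
qed

definition approx :: "nat \<Rightarrow> complex \<Rightarrow> complex" where
  "approx n \<zeta> = wall_B \<gamma> \<zeta> n / wall_A \<gamma> \<zeta> n"

definition schur_fun :: "complex \<Rightarrow> complex" where
  "schur_fun \<zeta> = lim (\<lambda>n. approx n \<zeta>)"

lemma approx_step:
  assumes "norm \<zeta> < 1"
  shows "norm (approx (Suc n) \<zeta> - approx n \<zeta>) \<le> norm \<zeta> ^ n / (1 - norm \<zeta>)"
  using wall_ratio_diff(2)[OF assms, of "\<gamma> n" n] norm_less_1[of n] by (simp add: approx_def wall_Suc)

lemma approx_uniform:
  assumes "r < 1" "0 \<le> r"
  shows "uniform_limit (cball 0 r) approx schur_fun sequentially"
proof -
  define d where "d n \<zeta> = approx (Suc n) \<zeta> - approx n \<zeta>" for n and \<zeta> :: complex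
  have *: "uniform_limit (cball (0::complex) r) (\<lambda>n \<zeta>. \<Sum>k<n. d k \<zeta>) (\<lambda>\<zeta>. \<Sum>k. d k \<zeta>) sequentially"
  proof (rule Weierstrass_m_test)
    show "summable (\<lambda>n. r ^ n / (1 - r))" using assms by (intro summable_divide summable_geometric) auto
    fix n and \<zeta> :: complex assume z: "\<zeta> \<in> cball 0 r"
    then have "norm (d n \<zeta>) \<le> norm \<zeta> ^ n / (1 - norm \<zeta>)"
      unfolding d_def using assms by (intro approx_step) auto
    also have "\<dots> \<le> r ^ n / (1 - r)" using z assms by (intro frac_le power_mono) auto
    finally show "norm (d n \<zeta>) \<le> r ^ n / (1 - r)" .
  qed
  moreover have "(\<Sum>k<n. d k \<zeta>) = approx n \<zeta>" for n and \<zeta> :: complex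
    unfolding d_def by (subst sum_lessThan_telescope) (simp add: approx_def)
  ultimately have u: "uniform_limit (cball 0 r) approx (\<lambda>\<zeta>. \<Sum>k. d k \<zeta>) sequentially" by simp
  have "schur_fun \<zeta> = (\<Sum>k. d k \<zeta>)" if "\<zeta> \<in> cball 0 r" for \<zeta>
    unfolding schur_fun_def by (rule limI[OF tendsto_uniform_limitI[OF u that]])
  then show ?thesis using u by (subst uniform_limit_cong'[of _ approx approx _ "\<lambda>\<zeta>. \<Sum>k. d k \<zeta>"]) auto
qed

lemma approx_tendsto:
  assumes "norm \<zeta> < 1"
  shows "(\<lambda>n. approx n \<zeta>) \<longlonglongrightarrow> schur_fun \<zeta>"
  by (rule tendsto_uniform_limitI[OF approx_uniform[OF assms norm_ge_zero]]) simp

lemma schur_fun_holomorphic: "schur_fun holomorphic_on ball 0 1"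
proof (rule holomorphic_uniform_sequence[where f = approx])
  have "(\<lambda>\<zeta>. wall_A \<gamma> \<zeta> n) holomorphic_on S \<and> (\<lambda>\<zeta>. wall_A' \<gamma> \<zeta> n) holomorphic_on S" for n S
    by (induction n) (auto simp: wall_Suc intro!: holomorphic_intros)
  moreover have "(\<lambda>\<zeta>. wall_B \<gamma> \<zeta> n) holomorphic_on S \<and> (\<lambda>\<zeta>. wall_B' \<gamma> \<zeta> n) holomorphic_on S" for n S
    by (induction n) (auto simp: wall_Suc intro!: holomorphic_intros)
  ultimately show "approx n holomorphic_on ball 0 1" for n
    unfolding approx_def using wall_A'_le by (intro holomorphic_on_divide) auto
  fix x :: complex assume x: "x \<in> ball 0 1"
  define r where "r = (1 + norm x) / 2"
  have r: "0 \<le> r" "r < 1" "norm x < r" using x norm_ge_zero[of x] by (auto simp: r_def field_simps)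
  have sub: "cball x (r - norm x) \<subseteq> cball 0 r"
  proof
    fix y assume "y \<in> cball x (r - norm x)"
    then show "y \<in> cball 0 r" using norm_triangle_sub[of y x] by (simp add: dist_norm norm_minus_commute)
  qed
  have "cball 0 r \<subseteq> ball (0::complex) 1" using r(2) by auto
  with sub have "cball x (r - norm x) \<subseteq> ball 0 1" by (rule order_trans)
  moreover have "uniform_limit (cball x (r - norm x)) approx schur_fun sequentially"
    by (rule uniform_limit_on_subset[OF approx_uniform[OF r(2,1)] sub])
  ultimately show "\<exists>d>0. cball x d \<subseteq> ball 0 1 \<and> uniform_limit (cball x d) approx schur_fun sequentially"
    using r(3) by (intro exI[of _ "r - norm x"] conjI) simp_all
qed simp

lemma norm_schur_fun_le:
  assumes "norm \<zeta> < 1"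
  shows "norm (schur_fun \<zeta>) \<le> 1"
proof (rule tendsto_upperbound[OF tendsto_norm[OF approx_tendsto[OF assms]]])
  have "norm (approx n \<zeta>) \<le> 1" for n
  proof -
    have "(\<Prod>k<n. 1 - (norm (\<gamma> k))\<^sup>2) \<ge> 0" by (intro prod_nonneg less_imp_le[OF pos_factor] ballI)
    then have "(norm (wall_B \<gamma> \<zeta> n))\<^sup>2 \<le> (norm (wall_A \<gamma> \<zeta> n))\<^sup>2" using wall_A_ge[OF less_imp_le[OF assms], of n] by linarith
    then have "norm (wall_B \<gamma> \<zeta> n) \<le> norm (wall_A \<gamma> \<zeta> n)" by (rule power2_le_imp_le) (rule norm_ge_zero)
    then show ?thesis using wall_A'_le[OF assms, of n] by (simp add: approx_def norm_divide)
  qed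
  then show "\<forall>\<^sub>F n in sequentially. norm (approx n \<zeta>) \<le> 1" by simp
qed simp

lemma parameters_shift: "schur_parameters (\<lambda>k. \<gamma> (Suc k))"
  using norm_less_1 by unfold_locales

end

abbreviation schur_of :: "(nat \<Rightarrow> complex) \<Rightarrow> complex \<Rightarrow> complex" where
  "schur_of \<equiv> schur_parameters.schur_fun"

lemma moebius_denominator:
  fixes g w :: complex
  assumes "norm g < 1" "norm w \<le> 1"
  shows "1 + cnj g * w \<noteq> 0"
proof -
  have "norm (cnj g * w) \<le> norm g" using assms by (simp add: norm_mult mult_left_le)
  then show ?thesis using assms(1) by (metis add_eq_0_iff norm_minus_cancel norm_one not_le)
qed

context schur_parameters
begin

lemma schur_fun_step:
  assumes "norm \<zeta> < 1"
  shows "schur_fun \<zeta> = (\<gamma> 0 + \<zeta> * schur_of (\<lambda>k. \<gamma> (Suc k)) \<zeta>) / (1 + cnj (\<gamma> 0) * (\<zeta> * schur_of (\<lambda>k. \<gamma> (Suc k)) \<zeta>))"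
proof -
  interpret s: schur_parameters "\<lambda>k. \<gamma> (Suc k)" by (rule parameters_shift)
  have F: "norm (\<zeta> * s.schur_fun \<zeta>) \<le> 1"
    using s.norm_schur_fun_le[OF assms] assms by (simp add: norm_mult mult_le_one)
  have "approx (Suc n) \<zeta> = (\<gamma> 0 + \<zeta> * s.approx n \<zeta>) / (1 + cnj (\<gamma> 0) * (\<zeta> * s.approx n \<zeta>))" for n
  proof -
    have "s.approx n \<zeta> * wall_A (\<lambda>k. \<gamma> (Suc k)) \<zeta> n = wall_B (\<lambda>k. \<gamma> (Suc k)) \<zeta> n"
      using s.wall_A'_le[OF assms, of n] by (simp add: s.approx_def)
    then have "wall_B \<gamma> \<zeta> (Suc n) = wall_A (\<lambda>k. \<gamma> (Suc k)) \<zeta> n * (\<gamma> 0 + \<zeta> * s.approx n \<zeta>)"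
       "wall_A \<gamma> \<zeta> (Suc n) = wall_A (\<lambda>k. \<gamma> (Suc k)) \<zeta> n * (1 + cnj (\<gamma> 0) * (\<zeta> * s.approx n \<zeta>))"
      unfolding wall_front by (simp_all add: algebra_simps)
    then show ?thesis unfolding approx_def using s.wall_A'_le[OF assms, of n] by simp
  qed
  then have "(\<lambda>n. approx (Suc n) \<zeta>) \<longlonglongrightarrow> (\<gamma> 0 + \<zeta> * s.schur_fun \<zeta>) / (1 + cnj (\<gamma> 0) * (\<zeta> * s.schur_fun \<zeta>))"
    using moebius_denominator[OF norm_less_1 F] by (simp) (intro tendsto_intros s.approx_tendsto assms; simp)
  moreover have "(\<lambda>n. approx (Suc n) \<zeta>) \<longlonglongrightarrow> schur_fun \<zeta>"
    by (rule LIMSEQ_Suc[OF approx_tendsto[OF assms]])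
  ultimately show ?thesis by (rule LIMSEQ_unique[symmetric])
qed

lemma schur_fun_0: "schur_fun 0 = \<gamma> 0"
  using schur_fun_step[of 0] by simp

lemma norm_moebius_less:
  fixes g w :: complex
  assumes "norm g < 1" "norm w < 1"
  shows "norm ((g + w) / (1 + cnj g * w)) < 1"
proof -
  have "(norm (1 + cnj g * w))\<^sup>2 - (norm (g + w))\<^sup>2 = (1 - (norm g)\<^sup>2) * (1 - (norm w)\<^sup>2)"
    using blaschke_identity[of 1 "cnj g" w]
    by (simp only: complex_cnj_cnj mult_1_right norm_one power_one complex_mod_cnj)
  also have "\<dots> > 0" using assms by (simp add: abs_square_less_1)
  finally have "(norm (g + w))\<^sup>2 < (norm (1 + cnj g * w))\<^sup>2" by linarith
  then have "norm (g + w) < norm (1 + cnj g * w)" by (rule power2_less_imp_less) (rule norm_ge_zero)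
  moreover from this have "0 < norm (1 + cnj g * w)" using norm_ge_zero[of "g + w"] by linarith
  ultimately show ?thesis by (simp add: norm_divide)
qed

text \<open>
  The limit is only known to have modulus at most \<open>1\<close>; the front step, whose argument
  \<open>\<zeta> F\<close> is strictly smaller, makes the inequality strict.
\<close>

lemma norm_schur_fun_less:
  assumes "norm \<zeta> < 1"
  shows "norm (schur_fun \<zeta>) < 1"
proof -
  interpret s: schur_parameters "\<lambda>k. \<gamma> (Suc k)" by (rule parameters_shift)
  have "norm (\<zeta> * s.schur_fun \<zeta>) < 1"
    using mult_left_le[OF s.norm_schur_fun_le[OF assms] norm_ge_zero[of \<zeta>]] assms by (simp add: norm_mult)
  then show ?thesis unfolding schur_fun_step[OF assms] by (intro norm_moebius_less norm_less_1)
qed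

end

section \<open>Jump matrices of the Dirac system\<close>

lemma mat_2_eqI:
  fixes A B :: "complex^2^2"
  assumes "A$1$1 = B$1$1" "A$1$2 = B$1$2" "A$2$1 = B$2$1" "A$2$2 = B$2$2"
  shows "A = B"
  using assms by (simp add: vec_eq_iff forall_2)

lemma matrix_mul_2: "((A::complex^2^2) ** B) $ i $ j = A$i$1 * B$1$j + A$i$2 * B$2$j"
  by (simp add: matrix_matrix_mult_def sum_2)

lemma mat_2: "(mat a :: complex^2^2)$1$1 = a" "(mat a :: complex^2^2)$1$2 = 0"
    "(mat a :: complex^2^2)$2$1 = 0" "(mat a :: complex^2^2)$2$2 = a"
  by (auto simp: mat_def)

lemma J_2: "J$1$1 = 0" "J$1$2 = -1" "J$2$1 = 1" "J$2$2 = 0"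
  by (auto simp: J_def)

lemma transpose_2: "transpose (A::complex^2^2) $ i $ j = A $ j $ i"
  by (simp add: transpose_def)

lemmas mat2_simps = matrix_mul_2 mat_2 J_2 transpose_2

lemma bounded_linear_matrix_left: "bounded_linear (\<lambda>B. (A::complex^2^2) ** (B::complex^2^2))"
  by (intro linear_conv_bounded_linear[THEN iffD1] linearI)
     (rule mat_2_eqI; simp add: mat2_simps algebra_simps)+

lemma bounded_linear_mat_mult: "bounded_linear (\<lambda>a. mat a ** (B::complex^2^2))"
  by (intro linear_conv_bounded_linear[THEN iffD1] linearI mat_2_eqI)
     (simp_all add: mat2_simps algebra_simps scaleR_conv_of_real[where 'a = complex])

text \<open>
  This is \<open>Q J\<^sup>*\<close> at an atom of mass \<open>w\<close>. Its square is the scalar \<open>\<bar>w\<bar>\<^sup>2\<close>, so power series of it reduce to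
  scalar series.
\<close>

definition T_mat :: "complex \<Rightarrow> complex^2^2" where
  "T_mat w = vector [vector [- of_real (Re w), of_real (Im w)], vector [of_real (Im w), of_real (Re w)]]"

lemma T_mat_2: "T_mat w$1$1 = - of_real (Re w)" "T_mat w$1$2 = of_real (Im w)"
   "T_mat w$2$1 = of_real (Im w)" "T_mat w$2$2 = of_real (Re w)"
  by (auto simp: T_mat_def)

lemma Q_mass_2: "Q_mass q (real k)$1$1 = of_real (Im (q k))" "Q_mass q (real k)$1$2 = of_real (Re (q k))"
    "Q_mass q (real k)$2$1 = of_real (Re (q k))" "Q_mass q (real k)$2$2 = - of_real (Im (q k))"
  by (auto simp: Q_mass_def point_mass_def)

lemma Q_mass_J: "Q_mass q (real k) ** transpose J = T_mat (q k)" "J ** Q_mass q (real k) = T_mat (q k)"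
  by (rule mat_2_eqI; simp add: mat2_simps T_mat_2 Q_mass_2)+

lemma T_mat_square: "T_mat w ** T_mat w = mat (of_real ((norm w)\<^sup>2))"
  unfolding cmod_power2 by (intro mat_2_eqI) (simp_all add: mat2_simps T_mat_2 power2_eq_square)

definition sinhc :: "real \<Rightarrow> real" where "sinhc r = (if r = 0 then 1 else sinh r / r)"
definition coshc :: "real \<Rightarrow> real" where "coshc r = (if r = 0 then 1 / 2 else (cosh r - 1) / r\<^sup>2)"

lemma coshc_eq: "coshc r * r\<^sup>2 = cosh r - 1"
  by (simp add: coshc_def)

lemma sinhc_sums: "(\<lambda>n. if even n then 0 else r ^ (n - 1) / fact n) sums sinhc r"
proof (cases "r = 0")
  case True
  have "(\<lambda>n. if even n then 0 else r ^ (n - 1) / fact n) = (\<lambda>n. if n = 1 then 1 else 0)"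
    using True by (auto simp: fun_eq_iff elim!: oddE)
  then show ?thesis using True sums_single[of 1 "\<lambda>_. 1::real"] by (simp add: sinhc_def)
next
  case False
  have "(\<lambda>n. (if even n then 0 else r ^ n /\<^sub>R fact n) / r) sums (sinh r / r)"
    by (rule sums_divide[OF sinh_converges])
  moreover have "(if even n then 0 else r ^ n /\<^sub>R fact n) / r = (if even n then 0 else r ^ (n - 1) / fact n)" for n
    using False by (auto elim!: oddE simp: divide_simps)
  ultimately show ?thesis using False by (simp add: sinhc_def)
qed

lemma coshc_sums: "(\<lambda>n. if even n \<and> n \<ge> 2 then r ^ (n - 2) / fact n else 0) sums coshc r"
proof (cases "r = 0")
  case True
  have "(\<lambda>n. if even n \<and> n \<ge> 2 then r ^ (n - 2) / fact n else 0) = (\<lambda>n. if n = 2 then 1 / 2 else 0)"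
    using True by (auto simp: fun_eq_iff)
  then show ?thesis using True sums_single[of 2 "\<lambda>_. 1 / 2::real"] by (simp add: coshc_def)
next
  case False
  have "(\<lambda>n. ((if even n then r ^ n /\<^sub>R fact n else 0) - (if n = 0 then 1 else 0)) / r\<^sup>2) sums ((cosh r - 1) / r\<^sup>2)"
    by (intro sums_divide sums_diff cosh_converges) (use sums_single[of 0 "\<lambda>_. 1::real"] in simp)
  moreover have "((if even n then r ^ n /\<^sub>R fact n else 0) - (if n = 0 then 1 else 0)) / r\<^sup>2 = (if even n \<and> n \<ge> 2 then r ^ (n - 2) / fact n else 0)" for n
  proof (cases "even n \<and> n \<ge> 2")
    case True
    then have "r ^ n = r ^ (n - 2) * r\<^sup>2" by (metis le_add_diff_inverse2 power_add)
    with True False show ?thesis by (auto simp: divide_simps)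
  next
    case f: False
    then have "odd n \<or> n = 0" by presburger
    then show ?thesis by auto
  qed
  ultimately show ?thesis using False by (simp add: coshc_def)
qed

lemma matpow_T_mat:
  "matpow (T_mat w) n = (if even n then mat (of_real (norm w ^ n)) else mat (of_real (norm w ^ (n - 1))) ** T_mat w)"
proof (induction n)
  case (Suc n)
  show ?case
  proof (cases "even n")
    case True
    then show ?thesis by (simp add: Suc) (rule mat_2_eqI; simp add: mat2_simps)
  next
    case False
    then obtain m where m: "n = Suc (2 * m)" by (auto elim: oddE)
    have "T_mat w ** (mat (of_real (norm w ^ (2 * m))) ** T_mat w) = mat (of_real (norm w ^ (2 * m))) ** (T_mat w ** T_mat w)"
      by (rule mat_2_eqI; simp add: mat2_simps algebra_simps)
    also have "\<dots> = mat (of_real (norm w ^ (2 * m + 2)))"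
      unfolding T_mat_square by (rule mat_2_eqI; simp add: mat2_simps power2_eq_square)
    finally show ?thesis unfolding matpow.simps(2) Suc.IH using False by (simp add: m)
  qed
qed simp

text \<open>
  In the series that defines \<open>g_fun\<close> the even powers of \<open>T_mat w\<close> are scalar and sum to \<open>sinhc \<bar>w\<bar>\<close>, the
  odd powers are multiples of \<open>T_mat w\<close> and sum to \<open>coshc \<bar>w\<bar>\<close> times it.
\<close>

lemma g_fun_T_mat: "g_fun (T_mat w) = mat (of_real (sinhc (norm w))) + mat (of_real (coshc (norm w))) ** T_mat w"
proof -
  define r where "r = norm w"
  define a where "a n = (if even n then 0 else r ^ (n - 1) / fact n)" for n :: nat
  define b where "b n = (if even n \<and> n \<ge> 2 then r ^ (n - 2) / fact n else 0)" for n :: nat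
  have a0: "a n \<ge> 0" and b0: "b n \<ge> 0" for n by (auto simp: a_def b_def r_def)
  have as: "(a has_sum sinhc r) UNIV"
    using sinhc_sums[of r] a0 unfolding a_def[symmetric] by (intro sums_nonneg_imp_has_sum) auto
  have bs: "(b has_sum coshc r) UNIV"
    using coshc_sums[of r] b0 unfolding b_def[symmetric] by (intro sums_nonneg_imp_has_sum) auto
  have a2: "(a has_sum (sinhc r - 1)) {2..}"
  proof -
    have "(a has_sum (sinhc r - sum a {0, 1})) (UNIV - {0, 1})"
      by (rule has_sum_Diff[OF as has_sum_finite]) auto
    moreover have "UNIV - {0, 1} = {2::nat..}" by auto
    moreover have "sum a {0, 1} = 1" by (simp add: a_def)
    ultimately show ?thesis by simp
  qed
  have b2: "(b has_sum coshc r) {2..}"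
    using has_sum_cong_neutral[of "{2..}" UNIV b b "coshc r"] bs by (auto simp: b_def)
  define h where "h = (\<lambda>(s::real, t::real). mat (complex_of_real s) + mat (complex_of_real t) ** T_mat w)"
  have la: "bounded_linear (\<lambda>s::real. mat (complex_of_real s) ** (mat 1 :: complex^2^2))"
    using bounded_linear_compose[OF bounded_linear_mat_mult bounded_linear_of_real] .
  have lb: "bounded_linear (\<lambda>s::real. mat (complex_of_real s) ** T_mat w)"
    using bounded_linear_compose[OF bounded_linear_mat_mult bounded_linear_of_real] .
  have "((\<lambda>n. mat (complex_of_real (a n)) ** (mat 1 :: complex^2^2) + mat (complex_of_real (b n)) ** T_mat w)
     has_sum (mat (complex_of_real (sinhc r - 1)) ** mat 1 + mat (complex_of_real (coshc r)) ** T_mat w)) {2..}"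
    using has_sum_add[OF has_sum_bounded_linear[OF la a2] has_sum_bounded_linear[OF lb b2]] by (simp add: o_def)
  also have "?this \<longleftrightarrow> ((\<lambda>n. matpow (T_mat w) (n - 1) /\<^sub>R fact n)
     has_sum (mat (complex_of_real (sinhc r - 1)) ** mat 1 + mat (complex_of_real (coshc r)) ** T_mat w)) {2..}"
  proof (rule has_sum_cong)
    fix n :: nat assume n: "n \<in> {2..}"
    show "mat (complex_of_real (a n)) ** (mat 1 :: complex^2^2) + mat (complex_of_real (b n)) ** T_mat w
      = matpow (T_mat w) (n - 1) /\<^sub>R fact n"
    proof (cases "even n")
      case True
      then have "odd (n - 1)" "n - 1 - 1 = n - 2" using n by auto
      with True n show ?thesis unfolding matpow_T_mat
        by (simp add: a_def b_def r_def) (rule mat_2_eqI; simp add: mat2_simps scaleR_conv_of_real[where 'a = complex] field_simps)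
    next
      case False
      then have "even (n - 1)" using n by auto
      with False n show ?thesis unfolding matpow_T_mat
        by (simp add: a_def b_def r_def) (rule mat_2_eqI; simp add: mat2_simps scaleR_conv_of_real[where 'a = complex] field_simps)
    qed
  qed
  finally have "g_fun (T_mat w) = mat 1 + (mat (complex_of_real (sinhc r - 1)) ** mat 1 + mat (complex_of_real (coshc r)) ** T_mat w)"
    unfolding g_fun_def by (simp add: infsumI)
  also have "\<dots> = mat (of_real (sinhc r)) + mat (of_real (coshc r)) ** T_mat w"
    by (rule mat_2_eqI; simp add: mat2_simps)
  finally show ?thesis by (simp add: r_def)
qed

lemma g_fun_0: "g_fun 0 = mat 1"
proof -
  have "T_mat 0 = 0" by (rule mat_2_eqI) (simp_all add: T_mat_2)
  with g_fun_T_mat[of 0] show ?thesis by (simp add: sinhc_def)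
qed

text \<open>
  The matrix exponentials of \<open>T_mat w\<close> and of \<open>- T_mat w\<close>.
\<close>

definition jump :: "complex \<Rightarrow> complex^2^2" where
  "jump w = mat (of_real (cosh (norm w))) + mat (of_real (sinhc (norm w))) ** T_mat w"

definition jump_inv :: "complex \<Rightarrow> complex^2^2" where
  "jump_inv w = mat (of_real (cosh (norm w))) - mat (of_real (sinhc (norm w))) ** T_mat w"

lemma sinhc_sq: "(sinhc r)\<^sup>2 * r\<^sup>2 = (cosh r)\<^sup>2 - 1"
  using cosh_square_eq[of r] by (simp add: sinhc_def power_divide)

lemma jump_inverse: "jump w ** jump_inv w = mat 1" "jump_inv w ** jump w = mat 1"
proof -
  define c where "c = complex_of_real (cosh (norm w))"
  define s where "s = complex_of_real (sinhc (norm w))"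
  have e: "c\<^sup>2 - s\<^sup>2 * of_real ((Re w)\<^sup>2 + (Im w)\<^sup>2) = 1"
    using sinhc_sq[of "norm w"] by (simp add: c_def s_def cmod_power2 flip: of_real_power of_real_mult of_real_diff of_real_add)
  then have e': "c * c - s * s * (of_real (Re w) * of_real (Re w) + of_real (Im w) * of_real (Im w)) = 1"
    by (simp add: power2_eq_square)
  show "jump w ** jump_inv w = mat 1" "jump_inv w ** jump w = mat 1"
    unfolding jump_def jump_inv_def c_def[symmetric] s_def[symmetric]
    using e' by (intro mat_2_eqI; simp add: mat2_simps T_mat_2 algebra_simps)+
qed

text \<open>
  In the integral equation at \<open>x = k\<close> the atom at \<open>k\<close> acts on the right limit \<open>N k\<close> itself. With
  Persson's factor \<open>g_fun\<close> the two terms that contain \<open>N k\<close> combine to \<open>J exp (- T) N(k)\<close>, so the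
  equation says that \<open>N\<close> is multiplied by \<open>exp T\<close> when \<open>x\<close> passes \<open>k\<close>.
\<close>

lemma jump_relation:
  fixes X :: "complex^2^2"
  shows "J ** X + g_fun (Q_mass q (real k) ** transpose J) ** Q_mass q (real k) ** X = J ** (jump_inv (q k) ** X)"
proof -
  define r where "r = norm (q k)"
  define s where "s = complex_of_real (sinhc r)"
  define c where "c = complex_of_real (coshc r)"
  have ch: "complex_of_real (cosh r) = 1 + c * (of_real (Re (q k)) * of_real (Re (q k)) + of_real (Im (q k)) * of_real (Im (q k)))"
  proof -
    have "cosh r = 1 + coshc r * ((Re (q k))\<^sup>2 + (Im (q k))\<^sup>2)"
      using coshc_eq[of r] by (simp add: r_def cmod_power2)
    then show ?thesis by (simp add: c_def power2_eq_square)
  qed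
  show ?thesis
    unfolding Q_mass_J g_fun_T_mat jump_inv_def r_def[symmetric] s_def[symmetric] c_def[symmetric] ch
    by (intro mat_2_eqI) (simp_all add: mat2_simps T_mat_2 Q_mass_2 algebra_simps)
qed

section \<open>The explicit solution of the Dirac system\<close>

text \<open>
  The matrix exponential of \<open>a J\<^sup>*\<close>: the flow of the system without potential over an interval of
  length \<open>x\<close>, when \<open>a = z x\<close>.
\<close>

definition rot :: "complex \<Rightarrow> complex^2^2" where
  "rot a = mat (cos a) + mat (sin a) ** transpose J"

text \<open>
  The left limit of the solution at \<open>k\<close>.
\<close>

primrec node_value :: "(nat \<Rightarrow> complex) \<Rightarrow> complex \<Rightarrow> nat \<Rightarrow> complex^2^2" where
  "node_value q z 0 = mat 1"
| "node_value q z (Suc k) = rot z ** (jump (q k) ** node_value q z k)"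

definition solution :: "(nat \<Rightarrow> complex) \<Rightarrow> complex \<Rightarrow> real \<Rightarrow> complex^2^2" where
  "solution q z x = (if x < 0 then mat 1 else
     rot (z * of_real (x - real (nat \<lfloor>x\<rfloor>))) ** (jump (q (nat \<lfloor>x\<rfloor>)) ** node_value q z (nat \<lfloor>x\<rfloor>)))"

lemma rot_0: "rot 0 = mat 1"
  by (rule mat_2_eqI; simp add: rot_def mat2_simps)

lemma solution_on:
  assumes "real k \<le> x" "x < real k + 1"
  shows "solution q z x = rot (z * of_real (x - real k)) ** (jump (q k) ** node_value q z k)"
proof -
  have "\<lfloor>x\<rfloor> = int k" using assms by (intro floor_unique) auto
  then show ?thesis using assms by (simp add: solution_def)
qed

lemma solution_node: "solution q z (real k) = jump (q k) ** node_value q z k"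
  using solution_on[of k "real k" q z] by (simp add: rot_0 matrix_mul_lid)

lemma rot_derivative:
  fixes K :: "complex^2^2"
  shows "((\<lambda>x. rot (z * of_real (x - a)) ** K) has_vector_derivative
      transpose J ** (mat z ** (rot (z * of_real (x - a)) ** K))) (at x within S)"
proof -
  have c: "((\<lambda>x. cos (z * of_real (x - a))) has_vector_derivative (- z * sin (z * of_real (x - a)))) (at x within S)"
    by (rule has_vector_derivative_real_field[of "\<lambda>x. cos (z * (x - of_real a))", simplified of_real_diff[symmetric]])
       (auto intro!: derivative_eq_intros)
  have s: "((\<lambda>x. sin (z * of_real (x - a))) has_vector_derivative (z * cos (z * of_real (x - a)))) (at x within S)"
    by (rule has_vector_derivative_real_field[of "\<lambda>x. sin (z * (x - of_real a))", simplified of_real_diff[symmetric]])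
       (auto intro!: derivative_eq_intros)
  have "((\<lambda>x. mat (cos (z * of_real (x - a))) ** K + mat (sin (z * of_real (x - a))) ** (transpose J ** K))
     has_vector_derivative (mat (- z * sin (z * of_real (x - a))) ** K + mat (z * cos (z * of_real (x - a))) ** (transpose J ** K)))
      (at x within S)"
    by (intro has_vector_derivative_add bounded_linear.has_vector_derivative[OF bounded_linear_mat_mult] c s)
  moreover have "mat (cos (z * of_real (x - a))) ** K + mat (sin (z * of_real (x - a))) ** (transpose J ** K) = rot (z * of_real (x - a)) ** K" for x
    by (rule mat_2_eqI; simp add: rot_def mat2_simps algebra_simps)
  moreover have "mat (- z * sin (z * of_real (x - a))) ** K + mat (z * cos (z * of_real (x - a))) ** (transpose J ** K)
     = transpose J ** (mat z ** (rot (z * of_real (x - a)) ** K))"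
    by (rule mat_2_eqI; simp add: rot_def mat2_simps algebra_simps)
  ultimately show ?thesis by simp
qed

lemma rot_continuous:
  fixes K :: "complex^2^2"
  shows "continuous_on S (\<lambda>x. rot (z * of_real (x - a)) ** K)"
  by (rule continuous_on_vector_derivative[OF rot_derivative])

definition dirac_integrand :: "(nat \<Rightarrow> complex) \<Rightarrow> complex \<Rightarrow> (real \<Rightarrow> complex^2^2) \<Rightarrow> real \<Rightarrow> complex^2^2" where
  "dirac_integrand q z N t = indicat_real {0..} t *\<^sub>R (g_fun (Q_mass q t ** transpose J) ** mat z ** N t)"

lemma J_inverse: "J ** transpose J = mat 1" "transpose J ** J = mat 1"
  by (rule mat_2_eqI; simp add: mat2_simps)+

lemma dirac_integrand_off_nodes:
  assumes "t \<notin> \<nat>"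
  shows "dirac_integrand q z N t = (if t < 0 then 0 else mat z ** N t)"
proof -
  have "Q_mass q t = 0" using assms by (intro mat_2_eqI) (simp_all add: Q_mass_def point_mass_def)
  then have "Q_mass q t ** transpose J = 0" by (intro mat_2_eqI) (simp_all add: mat2_simps)
  then show ?thesis by (simp add: dirac_integrand_def g_fun_0)
qed

section \<open>Uniqueness of the solution\<close>

text \<open>
  A right-continuous function is the pointwise limit of its compositions with step functions that
  decrease to the identity from strictly above.
\<close>

lemma right_continuous_measurable:
  fixes f :: "real \<Rightarrow> 'a::metric_space"
  assumes "\<And>x. continuous (at_right x) f"
  shows "f \<in> borel_measurable borel"
proof (rule borel_measurable_LIMSEQ_metric)
  \<comment> \<open>the next multiple of \<open>1 / (n + 1)\<close> strictly to the right of \<open>x\<close>\<close>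
  define g where "g n x = (\<lfloor>real (Suc n) * x\<rfloor> + 1) / real (Suc n)" for n and x :: real
  show "(\<lambda>x. f (g n x)) \<in> borel_measurable borel" for n
  proof -
    have "(\<lambda>x. \<lfloor>real (Suc n) * x\<rfloor>) \<in> borel \<rightarrow>\<^sub>M count_space UNIV" by measurable
    moreover have "(\<lambda>k. f (real_of_int (k + 1) / real (Suc n))) \<in> count_space UNIV \<rightarrow>\<^sub>M borel" by simp
    ultimately have "(\<lambda>k. f (real_of_int (k + 1) / real (Suc n))) \<circ> (\<lambda>x. \<lfloor>real (Suc n) * x\<rfloor>) \<in> borel \<rightarrow>\<^sub>M borel"
      by (rule measurable_comp)
    then show ?thesis by (simp only: g_def o_def)
  qed
  fix x :: real
  have gx: "x < g n x" "g n x \<le> x + 1 / real (Suc n)" for n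
  proof -
    have "real (Suc n) * x < \<lfloor>real (Suc n) * x\<rfloor> + 1" "\<lfloor>real (Suc n) * x\<rfloor> + 1 \<le> real (Suc n) * x + 1" by linarith+
    then show "x < g n x" "g n x \<le> x + 1 / real (Suc n)" unfolding g_def
      by (simp_all add: field_simps del: of_nat_Suc)
  qed
  have "(\<lambda>n. x + 1 / real (Suc n)) \<longlonglongrightarrow> x + 0"
    by (intro tendsto_intros LIMSEQ_Suc[OF lim_1_over_n])
  then have ub: "(\<lambda>n. x + 1 / real (Suc n)) \<longlonglongrightarrow> x" by (simp only: add_0_right)
  have "(\<lambda>n. g n x) \<longlonglongrightarrow> x"
  proof (rule tendsto_sandwich[OF _ _ tendsto_const ub])
    show "\<forall>\<^sub>F n in sequentially. x \<le> g n x" by (intro always_eventually allI less_imp_le gx)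
    show "\<forall>\<^sub>F n in sequentially. g n x \<le> x + 1 / real (Suc n)" by (intro always_eventually allI gx)
  qed
  moreover have "\<forall>\<^sub>F n in sequentially. g n x \<in> {x<..} \<and> g n x \<noteq> x"
  proof (intro always_eventually allI conjI)
    show "g n x \<in> {x<..}" for n using gx(1)[of n] by (simp only: greaterThan_iff)
    show "g n x \<noteq> x" for n using gx(1)[of n] by (rule less_imp_neq[symmetric])
  qed
  ultimately have "filterlim (\<lambda>n. g n x) (at_right x) sequentially"
    unfolding filterlim_at by (rule conjI[rotated])
  then show "(\<lambda>n. f (g n x)) \<longlonglongrightarrow> f x"
    using assms[of x] unfolding continuous_within by (rule filterlim_compose[rotated])
qed

lemma locally_bounded_variation_bounded:
  assumes "locally_bounded_variation F"
  shows "\<exists>B. \<forall>x\<in>{a..b}. norm (F x) \<le> B"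
proof -
  obtain B where B: "\<forall>n t. t 0 = a \<and> t n = b \<and> (\<forall>i<n. t i \<le> t (Suc i)) \<longrightarrow>
      (\<Sum>i<n. norm (F (t (Suc i)) - F (t i))) \<le> B"
    using assms[unfolded locally_bounded_variation_def, THEN spec[of _ a], THEN spec[of _ b]] by (elim exE)
  have "norm (F x) \<le> B + norm (F a)" if "x \<in> {a..b}" for x
  proof -
    define t where "t i = (if i = 0 then a else if i = 1 then x else b)" for i :: nat
    have "(\<Sum>i<2. norm (F (t (Suc i)) - F (t i))) \<le> B"
    proof (intro B[rule_format] conjI allI impI)
      show "t i \<le> t (Suc i)" if "i < 2" for i
        using that \<open>x \<in> {a..b}\<close> by (cases i) (simp_all add: t_def)
    qed (simp_all add: t_def)
    then have "norm (F x - F a) + norm (F b - F x) \<le> B" by (simp add: t_def numeral_2_eq_2)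
    moreover have "norm (F x) \<le> norm (F a) + norm (F x - F a)" by (rule norm_triangle_sub)
    ultimately show ?thesis using norm_ge_zero[of "F b - F x"] by linarith
  qed
  then show ?thesis by blast
qed

text \<open>
  The factor \<open>g_fun\<close> differs from the identity only on the countable set of nodes, so over an
  interval the integral of the equation is that of \<open>z N\<close>.
\<close>

lemma dirac_integral_split:
  assumes N: "N \<in> borel_measurable borel" and B: "\<And>t. t \<in> {0..x} \<Longrightarrow> norm (N t) \<le> B"
    and y: "0 \<le> y" "y \<le> x"
  shows "(\<lambda>t. mat z ** N t) integrable_on {y..x}"
    and "(LINT t:{..x}|lborel. dirac_integrand q z N t) =
         (LINT t:{..y}|lborel. dirac_integrand q z N t) + integral {y..x} (\<lambda>t. mat z ** N t)"
proof -
  note bl = bounded_linear_matrix_left[of "mat z"]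
  have meas: "(\<lambda>t. mat z ** N t) \<in> borel_measurable borel"
    by (rule measurable_compose[OF N borel_measurable_continuous_onI[OF linear_continuous_on[OF bl]]])
  obtain K where K: "\<And>X. norm (mat z ** X :: complex^2^2) \<le> norm X * K" "0 < K"
    using bounded_linear.pos_bounded[OF bl] by blast
  have si: "set_integrable lborel {a..b} (\<lambda>t. mat z ** N t)" if "0 \<le> a" "b \<le> x" for a b
    unfolding set_integrable_def
  proof (rule integrableI_bounded_set_indicator)
    have "norm (mat z ** N t) \<le> B * K" if "t \<in> {a..b}" for t
    proof -
      have "norm (mat z ** N t) \<le> norm (N t) * K" by (rule K(1))
      also have "\<dots> \<le> B * K"
        using B[of t] that \<open>0 \<le> a\<close> \<open>b \<le> x\<close> K(2) by (intro mult_right_mono) auto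
      finally show ?thesis .
    qed
    then show "AE t in lborel. t \<in> {a..b} \<longrightarrow> norm (mat z ** N t) \<le> B * K" by simp
    show "emeasure lborel {a..b} < \<infinity>" by (rule emeasure_bounded_finite) simp
  qed (use meas in simp_all)
  show "(\<lambda>t. mat z ** N t) integrable_on {y..x}"
    by (rule set_borel_integral_eq_integral(1)[OF si[OF y(1) order_refl]])
  have I: "(LINT t:{..b}|lborel. dirac_integrand q z N t) = integral {0..b} (\<lambda>t. mat z ** N t)" if "b \<le> x" for b
  proof -
    have cn: "countable (range (of_nat :: nat \<Rightarrow> real))" by simp
    have eq: "indicat_real {..b} t *\<^sub>R dirac_integrand q z N t = indicat_real {0..b} t *\<^sub>R (mat z ** N t)"
      if "t \<notin> range of_nat" for t :: real
    proof -
      have "t \<notin> \<nat>" using that by (simp add: Nats_def)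
      note e = dirac_integrand_off_nodes[OF this, of q z N]
      show ?thesis unfolding e by (cases "t < 0"; cases "t \<le> b") simp_all
    qed
    have "(LINT t:{..b}|lborel. dirac_integrand q z N t) = (LINT t:{0..b}|lborel. mat z ** N t)"
      unfolding set_lebesgue_integral_def
      by (rule integral_discrete_difference[OF cn _ _ eq]) simp_all
    also have "\<dots> = integral {0..b} (\<lambda>t. mat z ** N t)"
      by (rule set_borel_integral_eq_integral(2)[OF si[OF order_refl that]])
    finally show ?thesis .
  qed
  have "integral {0..y} (\<lambda>t. mat z ** N t) + integral {y..x} (\<lambda>t. mat z ** N t) = integral {0..x} (\<lambda>t. mat z ** N t)"
    by (rule Henstock_Kurzweil_Integration.integral_combine[OF y set_borel_integral_eq_integral(1)[OF si[OF order_refl order_refl]]])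
  then show "(LINT t:{..x}|lborel. dirac_integrand q z N t) =
         (LINT t:{..y}|lborel. dirac_integrand q z N t) + integral {y..x} (\<lambda>t. mat z ** N t)"
    using I[OF order_refl] I[OF y(2)] by simp
qed

text \<open>
  Rearrangements of the integral equation, stated in an abelian group so that the matrix products
  remain atomic.
\<close>

lemma balance_increment:
  fixes a b s i d j :: "'a::ab_group_add"
  assumes "b + (s - i) = j"
  shows "a + (s - (i + d)) = j \<longleftrightarrow> a = b + d"
  unfolding assms[symmetric] by (auto simp: algebra_simps)

lemma balance_rearrange:
  fixes a s i d j p :: "'a::ab_group_add"
  shows "a + ((p + s) - i) = j \<longleftrightarrow> a + p = j - s + i"
    "a + ((p + s) - i) = j \<Longrightarrow> j - (s + p) + (i + d) = a + d"
  by (auto simp: algebra_simps)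

lemma nodes_up_to:
  assumes x: "real k \<le> x" "x < real k + 1"
  shows "{j. real j \<le> x} = insert k {..<k}"
proof -
  have eq: "real j \<le> x \<longleftrightarrow> j \<le> k" for j
  proof
    assume "real j \<le> x"
    then have "real j < real k + 1" using x(2) by (rule le_less_trans)
    then show "j \<le> k" by linarith
  next
    assume "j \<le> k"
    then have "real j \<le> real k" by simp
    then show "real j \<le> x" using x(1) by (rule order_trans)
  qed
  show ?thesis unfolding eq lessThan_Suc[symmetric] lessThan_Suc_atMost by (simp add: atMost_def)
qed

abbreviation jump_term :: "(nat \<Rightarrow> complex) \<Rightarrow> (real \<Rightarrow> complex^2^2) \<Rightarrow> nat \<Rightarrow> complex^2^2" where
  "jump_term q N k \<equiv> g_fun (Q_mass q (real k) ** transpose J) ** Q_mass q (real k) ** N (real k)"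

definition dirac_equation :: "(nat \<Rightarrow> complex) \<Rightarrow> complex \<Rightarrow> (real \<Rightarrow> complex^2^2) \<Rightarrow> real \<Rightarrow> bool" where
  "dirac_equation q z N x \<longleftrightarrow> J ** N x + ((\<Sum>k | real k \<le> x. jump_term q N k) - (LINT t:{..x}|lborel. dirac_integrand q z N t)) = J"

lemma persson_solution_eq:
  "persson_solution q z N \<longleftrightarrow> (\<forall>x. continuous (at_right x) N) \<and> locally_bounded_variation N \<and> (\<forall>x. dirac_equation q z N x)"
  unfolding persson_solution_def dirac_equation_def dirac_integrand_def by (rule refl)

lemma matrix_sub_ldistrib: "(A :: complex^2^2) ** (B - C) = A ** B - A ** (C :: complex^2^2)"
  by (rule linear_diff[OF bounded_linear.linear[OF bounded_linear_matrix_left]])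

lemma J_cancel: "J ** A = J ** B \<longleftrightarrow> A = (B :: complex^2^2)"
  by (metis J_inverse(2) matrix_mul_assoc matrix_mul_lid)

lemma dirac_integral_nonpos:
  assumes "x \<le> 0"
  shows "(LINT t:{..x}|lborel. dirac_integrand q z N t) = 0"
proof -
  have eq: "indicat_real {..x} t *\<^sub>R dirac_integrand q z N t = 0" if "t \<notin> {0}" for t :: real
    using assms that by (cases "t < 0") (simp_all add: dirac_integrand_def)
  have "countable {0 :: real}" by simp
  from integral_discrete_difference[OF this, of lborel, OF _ _ eq]
  have "(\<integral>t. indicat_real {..x} t *\<^sub>R dirac_integrand q z N t \<partial>lborel) = (\<integral>t. 0 \<partial>(lborel :: real measure))"
    by simp
  then show ?thesis by (simp add: set_lebesgue_integral_def)
qed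

lemma dirac_equation_negative:
  assumes "x < 0"
  shows "dirac_equation q z N x \<longleftrightarrow> N x = mat 1"
proof -
  have "{k. real k \<le> x} = {}" using assms by (auto intro: less_le_trans simp: not_le)
  then show ?thesis
    unfolding dirac_equation_def dirac_integral_nonpos[OF less_imp_le[OF assms]]
    using J_cancel[of "N x" "mat 1"] by (simp add: matrix_mul_rid)
qed

text \<open>
  The equation at \<open>k\<close> with the two terms that contain \<open>N k\<close> removed; for a solution this is \<open>J\<close> times
  the left limit at \<open>k\<close>.
\<close>

definition node_residue :: "(nat \<Rightarrow> complex) \<Rightarrow> complex \<Rightarrow> (real \<Rightarrow> complex^2^2) \<Rightarrow> nat \<Rightarrow> complex^2^2" where
  "node_residue q z N k = J - (\<Sum>j<k. jump_term q N j) + (LINT t:{..real k}|lborel. dirac_integrand q z N t)"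

lemma dirac_equation_node:
  "dirac_equation q z N (real k) \<longleftrightarrow> J ** (jump_inv (q k) ** N (real k)) = node_residue q z N k"
proof -
  have s: "{j. real j \<le> real k} = insert k {..<k}" by (rule nodes_up_to) simp_all
  have "dirac_equation q z N (real k) \<longleftrightarrow> J ** N (real k) + jump_term q N k = node_residue q z N k"
    unfolding dirac_equation_def node_residue_def s by (simp add: balance_rearrange(1))
  then show ?thesis unfolding jump_relation .
qed

lemma dirac_equation_cell:
  assumes N: "N \<in> borel_measurable borel" and B: "\<And>t. t \<in> {0..x} \<Longrightarrow> norm (N t) \<le> B"
    and x: "real k \<le> x" "x < real k + 1" and k: "dirac_equation q z N (real k)"
  shows "dirac_equation q z N x \<longleftrightarrow> J ** N x = J ** N (real k) + integral {real k..x} (\<lambda>t. mat z ** N t)"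
proof -
  have s: "{j. real j \<le> x} = insert k {..<k}" by (rule nodes_up_to[OF x])
  have s': "{j. real j \<le> real k} = insert k {..<k}" by (rule nodes_up_to) simp_all
  have sp: "(LINT t:{..x}|lborel. dirac_integrand q z N t) = (LINT t:{..real k}|lborel. dirac_integrand q z N t)
     + integral {real k..x} (\<lambda>t. mat z ** N t)"
    by (rule dirac_integral_split(2)[OF N B _ x(1)]) simp_all
  have "J ** N (real k) + ((\<Sum>k\<in>insert k {..<k}. jump_term q N k) - (LINT t:{..real k}|lborel. dirac_integrand q z N t)) = J"
    using k unfolding dirac_equation_def s' .
  from balance_increment[OF this] show ?thesis unfolding dirac_equation_def s sp by blast
qed

lemma node_residue_Suc:
  assumes N: "N \<in> borel_measurable borel" and B: "\<And>t. t \<in> {0..real k + 1} \<Longrightarrow> norm (N t) \<le> B"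
    and k: "dirac_equation q z N (real k)"
  shows "node_residue q z N (Suc k) = J ** N (real k) + integral {real k..real k + 1} (\<lambda>t. mat z ** N t)"
proof -
  have s': "{j. real j \<le> real k} = insert k {..<k}" by (rule nodes_up_to) simp_all
  have e: "real (Suc k) = real k + 1" by simp
  have "J ** N (real k) + ((jump_term q N k + (\<Sum>j<k. jump_term q N j)) - (LINT t:{..real k}|lborel. dirac_integrand q z N t)) = J"
    using k unfolding dirac_equation_def s' by simp
  note * = balance_rearrange(2)[OF this]
  have "(LINT t:{..real k + 1}|lborel. dirac_integrand q z N t) = (LINT t:{..real k}|lborel. dirac_integrand q z N t)
     + integral {real k..real k + 1} (\<lambda>t. mat z ** N t)"
    by (rule dirac_integral_split(2)[OF N B]) simp_all
  then show ?thesis unfolding node_residue_def e sum.lessThan_Suc using * by simp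
qed

text \<open>
  Gronwall's inequality by a weighted norm: the supremum \<open>S\<close> of \<open>exp (- 2Lt) \<bar>D t\<bar>\<close> satisfies
  \<open>S \<le> S / 2\<close>.
\<close>

lemma integral_inequality_zero:
  fixes D :: "real \<Rightarrow> 'a::banach"
  assumes eq: "\<And>x. a \<le> x \<Longrightarrow> x < b \<Longrightarrow> D x = integral {a..x} (\<lambda>t. h (D t))"
    and int: "\<And>x. a \<le> x \<Longrightarrow> x < b \<Longrightarrow> (\<lambda>t. h (D t)) integrable_on {a..x}"
    and h: "\<And>X. norm (h X) \<le> L * norm X" and L: "L > 0"
    and bd: "\<And>x. a \<le> x \<Longrightarrow> x < b \<Longrightarrow> norm (D x) \<le> C"
    and x: "a \<le> x" "x < b"
  shows "D x = 0"
proof -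
  \<comment> \<open>the factor \<open>2\<close> in the exponent is what produces the contraction constant \<open>1 / 2\<close>\<close>
  define S where "S = Sup ((\<lambda>t. exp (- (2 * L * t)) * norm (D t)) ` {a..<b})"
  have C0: "0 \<le> C" by (rule order_trans[OF norm_ge_zero bd[OF x]])
  have bdd: "bdd_above ((\<lambda>t. exp (- (2 * L * t)) * norm (D t)) ` {a..<b})"
  proof (rule bdd_aboveI2)
    fix t assume "t \<in> {a..<b}"
    then show "exp (- (2 * L * t)) * norm (D t) \<le> exp (- (2 * L * a)) * C"
      using bd[of t] L C0 by (intro mult_mono) simp_all
  qed
  have up: "norm (D t) \<le> S * exp (2 * L * t)" if "t \<in> {a..<b}" for t
  proof -
    have "exp (- (2 * L * t)) * norm (D t) \<le> S"
      unfolding S_def by (rule cSUP_upper[OF that bdd])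
    then have "exp (2 * L * t) * (exp (- (2 * L * t)) * norm (D t)) \<le> exp (2 * L * t) * S"
      by (intro mult_left_mono) simp_all
    moreover have "exp (2 * L * t) * exp (- (2 * L * t)) = 1" by (simp add: exp_add[symmetric])
    then have "exp (2 * L * t) * (exp (- (2 * L * t)) * norm (D t)) = norm (D t)"
      by (simp only: mult.assoc[symmetric] mult_1_left)
    ultimately show ?thesis by (simp only: mult.commute)
  qed
  have S0: "0 \<le> S"
  proof -
    have "0 \<le> norm (D x)" by simp
    also have "\<dots> \<le> S * exp (2 * L * x)" using x by (intro up) simp
    finally show ?thesis by (simp add: zero_le_mult_iff)
  qed
  have half: "exp (- (2 * L * y)) * norm (D y) \<le> S / 2" if y: "y \<in> {a..<b}" for y
  proof -
    have y': "a \<le> y" "y < b" using y by simp_all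
    have d: "((\<lambda>t. S / 2 * exp (2 * L * t)) has_vector_derivative L * (S * exp (2 * L * t))) (at t within {a..y})" for t
      unfolding has_real_derivative_iff_has_vector_derivative[symmetric]
      by (auto intro!: derivative_eq_intros)
    have hi: "((\<lambda>t. L * (S * exp (2 * L * t))) has_integral (S / 2 * exp (2 * L * y) - S / 2 * exp (2 * L * a))) {a..y}"
      by (rule fundamental_theorem_of_calculus[OF y'(1) d])
    have "norm (D y) \<le> integral {a..y} (\<lambda>t. L * (S * exp (2 * L * t)))"
      unfolding eq[OF y']
    proof (rule Henstock_Kurzweil_Integration.integral_norm_bound_integral)
      show "(\<lambda>t. h (D t)) integrable_on {a..y}" by (rule int[OF y'])
      show "(\<lambda>t. L * (S * exp (2 * L * t))) integrable_on {a..y}" using hi by (rule has_integral_integrable)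
      fix t assume t: "t \<in> {a..y}"
      have "norm (h (D t)) \<le> L * norm (D t)" by (rule h)
      also have "\<dots> \<le> L * (S * exp (2 * L * t))" using t y' L by (intro mult_left_mono up) simp_all
      finally show "norm (h (D t)) \<le> L * (S * exp (2 * L * t))" .
    qed
    also have "\<dots> = S / 2 * exp (2 * L * y) - S / 2 * exp (2 * L * a)" by (rule integral_unique[OF hi])
    also have "\<dots> \<le> S / 2 * exp (2 * L * y)" using S0 by simp
    finally have "exp (- (2 * L * y)) * norm (D y) \<le> exp (- (2 * L * y)) * (S / 2 * exp (2 * L * y))"
      by (intro mult_left_mono) simp_all
    also have "\<dots> = S / 2 * (exp (- (2 * L * y)) * exp (2 * L * y))" by (simp only: ac_simps)
    also have "exp (- (2 * L * y)) * exp (2 * L * y) = 1" by (simp add: exp_add[symmetric])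
    finally show ?thesis by simp
  qed
  have "S \<le> S / 2" unfolding S_def by (rule cSUP_least) (use x half in \<open>auto simp: S_def\<close>)
  then have "S = 0" using S0 by simp
  then show ?thesis using up[of x] x by simp
qed

text \<open>
  The solution is determined from cell to cell: the residue at \<open>k\<close> gives \<open>N k\<close> because the jump matrix
  is invertible, the equation on \<open>[k, k + 1)\<close> then gives \<open>N\<close> there by Gronwall's inequality, and
  integrating over that cell gives the residue at \<open>k + 1\<close>.
\<close>

lemma persson_solution_unique:
  assumes M: "persson_solution q z M" and N: "persson_solution q z N"
  shows "M x = N x"
proof -
  have M1: "M \<in> borel_measurable borel" and N1: "N \<in> borel_measurable borel"
    using M N unfolding persson_solution_eq by (simp_all add: right_continuous_measurable)
  have Meq: "dirac_equation q z M x" and Neq: "dirac_equation q z N x" for x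
    using M N unfolding persson_solution_eq by simp_all
  have Mv: "locally_bounded_variation M" and Nv: "locally_bounded_variation N"
    using M N unfolding persson_solution_eq by simp_all
  note Mb = locally_bounded_variation_bounded[OF Mv] and Nb = locally_bounded_variation_bounded[OF Nv]
  define h where "h X = transpose J ** (mat z ** X)" for X :: "complex^2^2"
  have bh: "bounded_linear h"
    unfolding h_def using bounded_linear_compose[OF bounded_linear_matrix_left bounded_linear_matrix_left] .
  obtain L where L: "\<And>X. norm (h X) \<le> norm X * L" "L > 0" using bounded_linear.pos_bounded[OF bh] by blast
  have cell: "\<forall>x. real k \<le> x \<longrightarrow> x < real k + 1 \<longrightarrow> M x = N x" if r: "node_residue q z M k = node_residue q z N k" for k
  proof (intro allI impI)
    fix x assume x: "real k \<le> x" "x < real k + 1"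
    have "J ** (jump_inv (q k) ** M (real k)) = J ** (jump_inv (q k) ** N (real k))"
      using Meq[of "real k"] Neq[of "real k"] r unfolding dirac_equation_node by simp
    then have "jump (q k) ** (jump_inv (q k) ** M (real k)) = jump (q k) ** (jump_inv (q k) ** N (real k))"
      unfolding J_cancel by simp
    then have node: "M (real k) = N (real k)"
      by (simp add: matrix_mul_assoc jump_inverse matrix_mul_lid)
    obtain BM BN where B: "\<And>t. t \<in> {0..real k + 1} \<Longrightarrow> norm (M t) \<le> BM" "\<And>t. t \<in> {0..real k + 1} \<Longrightarrow> norm (N t) \<le> BN"
      using Mb[of 0 "real k + 1"] Nb[of 0 "real k + 1"] by blast
    have k0: "0 \<le> real k" by simp
    have io: "(\<lambda>t. mat z ** M t) integrable_on {real k..y}" "(\<lambda>t. mat z ** N t) integrable_on {real k..y}"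
      if "real k \<le> y" "y < real k + 1" for y
    proof -
      have By: "\<And>t. t \<in> {0..y} \<Longrightarrow> norm (M t) \<le> BM" "\<And>t. t \<in> {0..y} \<Longrightarrow> norm (N t) \<le> BN"
        using B that by auto
      show "(\<lambda>t. mat z ** M t) integrable_on {real k..y}" by (rule dirac_integral_split(1)[OF M1 By(1) k0 that(1)])
      show "(\<lambda>t. mat z ** N t) integrable_on {real k..y}" by (rule dirac_integral_split(1)[OF N1 By(2) k0 that(1)])
    qed
    have hd: "h (M t - N t) = transpose J ** (mat z ** M t - mat z ** N t)" for t
      unfolding h_def by (simp add: matrix_sub_ldistrib)
    have "M x - N x = 0"
    proof (rule integral_inequality_zero[where h = h and a = "real k" and b = "real k + 1" and D = "\<lambda>t. M t - N t" and L = L and C = "BM + BN"])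
      fix y assume y: "real k \<le> y" "y < real k + 1"
      have By: "\<And>t. t \<in> {0..y} \<Longrightarrow> norm (M t) \<le> BM" "\<And>t. t \<in> {0..y} \<Longrightarrow> norm (N t) \<le> BN"
        using B y by auto
      note iM = io(1)[OF y] and iN = io(2)[OF y]
      note id = integrable_diff[OF iM iN]
      show "(\<lambda>t. h (M t - N t)) integrable_on {real k..y}"
        unfolding hd using integrable_linear[OF id bounded_linear_matrix_left[of "transpose J"]] by (simp add: o_def)
      have e: "J ** M y = J ** M (real k) + integral {real k..y} (\<lambda>t. mat z ** M t)"
        "J ** N y = J ** N (real k) + integral {real k..y} (\<lambda>t. mat z ** N t)"
        by (rule dirac_equation_cell[OF M1 By(1) y Meq, THEN iffD1, OF _ Meq], assumption,
            rule dirac_equation_cell[OF N1 By(2) y Neq, THEN iffD1, OF _ Neq], assumption)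
      have "J ** (M y - N y) = integral {real k..y} (\<lambda>t. mat z ** M t - mat z ** N t)"
        using e node by (simp add: matrix_sub_ldistrib Henstock_Kurzweil_Integration.integral_diff[OF iM iN])
      then have "transpose J ** (J ** (M y - N y)) = transpose J ** integral {real k..y} (\<lambda>t. mat z ** M t - mat z ** N t)"
        by simp
      also have "\<dots> = integral {real k..y} (\<lambda>t. h (M t - N t))"
        unfolding hd using integral_linear[OF id bounded_linear_matrix_left[of "transpose J"]] by (simp add: o_def)
      finally show "M y - N y = integral {real k..y} (\<lambda>t. h (M t - N t))"
        by (simp add: matrix_mul_assoc J_inverse matrix_mul_lid)
      show "norm (M y - N y) \<le> BM + BN"
        using norm_triangle_ineq4[of "M y" "N y"] By[of y] y k0 by simp
    qed (use L x in \<open>simp_all add: mult.commute\<close>)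
    then show "M x = N x" by simp
  qed
  have res: "node_residue q z M k = node_residue q z N k" for k
  proof (induction k)
    case 0
    show ?case unfolding node_residue_def using dirac_integral_nonpos[of 0] by simp
  next
    case (Suc k)
    note c = cell[OF Suc, rule_format]
    obtain BM BN where B: "\<And>t. t \<in> {0..real k + 1} \<Longrightarrow> norm (M t) \<le> BM" "\<And>t. t \<in> {0..real k + 1} \<Longrightarrow> norm (N t) \<le> BN"
      using Mb[of 0 "real k + 1"] Nb[of 0 "real k + 1"] by blast
    have "integral {real k..real k + 1} (\<lambda>t. mat z ** M t) = integral {real k..real k + 1} (\<lambda>t. mat z ** N t)"
      by (rule integral_spike[of "{real k + 1}"]) (use c in auto)
    then show ?case using node_residue_Suc[OF M1 B(1) Meq] node_residue_Suc[OF N1 B(2) Neq] c[of "real k"] by simp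
  qed
  show ?thesis
  proof (cases "x < 0")
    case True
    show ?thesis using Meq[of x] Neq[of x] unfolding dirac_equation_negative[OF True] by simp
  next
    case False
    then have "real (nat \<lfloor>x\<rfloor>) \<le> x" "x < real (nat \<lfloor>x\<rfloor>) + 1" by simp_all
    then show ?thesis using cell[OF res] by blast
  qed
qed

section \<open>The explicit solution satisfies the integral equation\<close>

lemma solution_right_continuous: "continuous (at_right x) (solution q z)"
proof (cases "x < 0")
  case True
  have "eventually (\<lambda>y. y \<in> {x<..<0}) (at_right x)" by (rule eventually_at_right_real[OF True])
  then have "eventually (\<lambda>y. solution q z y = mat 1) (at_right x)"
    by eventually_elim (simp add: solution_def)
  then have "(solution q z \<longlongrightarrow> mat 1) (at_right x)" by (rule tendsto_eventually)
  then show ?thesis using True by (simp add: continuous_within solution_def)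
next
  case False
  define k where "k = nat \<lfloor>x\<rfloor>"
  define K where "K = jump (q k) ** node_value q z k"
  have k: "real k \<le> x" "x < real k + 1" using False by (auto simp: k_def)
  have "eventually (\<lambda>y. y \<in> {x<..<real k + 1}) (at_right x)" by (rule eventually_at_right_real[OF k(2)])
  then have e: "eventually (\<lambda>y. rot (z * of_real (y - real k)) ** K = solution q z y) (at_right x)"
  proof (rule eventually_mono)
    fix y assume "y \<in> {x<..<real k + 1}"
    then have "real k \<le> y" "y < real k + 1" using k by auto
    from solution_on[OF this, of q z] show "rot (z * of_real (y - real k)) ** K = solution q z y"
      by (simp only: K_def)
  qed
  have "continuous (at_right x) (\<lambda>y. rot (z * of_real (y - real k)) ** K)"
    using rot_continuous[of UNIV z "real k" K] by (simp add: continuous_on_eq_continuous_at continuous_at_imp_continuous_within del: of_real_diff)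
  then have "((\<lambda>y. rot (z * of_real (y - real k)) ** K) \<longlongrightarrow> solution q z x) (at_right x)"
    using solution_on[OF k, of q z] by (simp only: continuous_within K_def)
  then have "(solution q z \<longlongrightarrow> solution q z x) (at_right x)" by (rule Lim_transform_eventually[OF _ e])
  then show ?thesis by (simp add: continuous_within)
qed

lemma solution_cell_bounded: "\<exists>B. \<forall>x. real k \<le> x \<longrightarrow> x < real k + 1 \<longrightarrow> norm (solution q z x) \<le> B"
proof -
  define K where "K = jump (q k) ** node_value q z k"
  have "bounded ((\<lambda>x. rot (z * of_real (x - real k)) ** K) ` {real k..real k + 1})"
    by (intro compact_imp_bounded compact_continuous_image rot_continuous) simp
  then obtain B where B: "\<And>x. x \<in> {real k..real k + 1} \<Longrightarrow> norm (rot (z * of_real (x - real k)) ** K) \<le> B"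
    unfolding bounded_iff by blast
  show ?thesis
  proof (intro exI allI impI)
    fix x assume x: "real k \<le> x" "x < real k + 1"
    show "norm (solution q z x) \<le> B" unfolding solution_on[OF x] K_def[symmetric] using x by (intro B) simp
  qed
qed

lemma solution_bounded: "\<exists>B. \<forall>x. x < real n \<longrightarrow> norm (solution q z x) \<le> B"
proof (induction n)
  case 0
  show ?case by (intro exI[of _ "norm (mat 1 :: complex^2^2)"]) (simp add: solution_def)
next
  case (Suc n)
  then obtain B where B: "\<And>x. x < real n \<Longrightarrow> norm (solution q z x) \<le> B" by blast
  obtain B' where B': "\<And>x. real n \<le> x \<Longrightarrow> x < real n + 1 \<Longrightarrow> norm (solution q z x) \<le> B'"
    using solution_cell_bounded by blast
  have "norm (solution q z x) \<le> max B B'" if "x < real (Suc n)" for x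
    using B[of x] B'[of x] that by (cases "x < real n") (auto simp: max_def)
  then show ?case by blast
qed

lemma solution_cell_integral:
  assumes "real k \<le> x" "x \<le> real k + 1"
  shows "((\<lambda>t. mat z ** solution q z t) has_integral
       (J ** (rot (z * of_real (x - real k)) ** (jump (q k) ** node_value q z k)) - J ** solution q z (real k))) {real k..x}"
proof -
  define R where "R t = rot (z * of_real (t - real k)) ** (jump (q k) ** node_value q z k)" for t
  have "((\<lambda>t. J ** R t) has_vector_derivative J ** (transpose J ** (mat z ** R t))) (at t within {real k..x})" for t
    unfolding R_def by (rule bounded_linear.has_vector_derivative[OF bounded_linear_matrix_left rot_derivative])
  then have d: "((\<lambda>t. J ** R t) has_vector_derivative mat z ** R t) (at t within {real k..x})" for t
    by (simp add: matrix_mul_assoc J_inverse matrix_mul_lid)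
  have "((\<lambda>t. mat z ** R t) has_integral (J ** R x - J ** R (real k))) {real k..x}"
    by (rule fundamental_theorem_of_calculus[OF assms(1) d])
  moreover have "R (real k) = solution q z (real k)" by (simp add: R_def rot_0 solution_node matrix_mul_lid)
  ultimately have i: "((\<lambda>t. mat z ** R t) has_integral (J ** R x - J ** solution q z (real k))) {real k..x}" by simp
  have "((\<lambda>t. mat z ** solution q z t) has_integral (J ** R x - J ** solution q z (real k))) {real k..x}"
  proof (rule has_integral_spike[OF _ _ i])
    show "negligible {real k + 1}" by simp
    fix t assume "t \<in> {real k..x} - {real k + 1}"
    then have "real k \<le> t" "t < real k + 1" using assms by auto
    from solution_on[OF this] show "mat z ** solution q z t = mat z ** R t" by (simp add: R_def)
  qed
  then show ?thesis by (simp add: R_def)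
qed

text \<open>
  The left limit enters through \<open>node_residue\<close>, which is why both claims are proved together.
\<close>

lemma solution_equation_node:
  "node_residue q z (solution q z) k = J ** node_value q z k \<and> dirac_equation q z (solution q z) (real k)"
proof (induction k)
  case 0
  have "node_residue q z (solution q z) 0 = J ** node_value q z 0"
    unfolding node_residue_def using dirac_integral_nonpos[of 0] by (simp add: matrix_mul_rid)
  then show ?case unfolding dirac_equation_node solution_node by (simp add: matrix_mul_assoc jump_inverse matrix_mul_lid)
next
  case (Suc k)
  have m: "solution q z \<in> borel_measurable borel" by (rule right_continuous_measurable) (rule solution_right_continuous)
  obtain B where B: "\<And>x. x < real (k + 2) \<Longrightarrow> norm (solution q z x) \<le> B" using solution_bounded by blast
  have i: "integral {real k..real k + 1} (\<lambda>t. mat z ** solution q z t) = J ** node_value q z (Suc k) - J ** solution q z (real k)"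
    using integral_unique[OF solution_cell_integral[of k "real k + 1" z q]] by simp
  have "node_residue q z (solution q z) (Suc k) = J ** solution q z (real k) + integral {real k..real k + 1} (\<lambda>t. mat z ** solution q z t)"
    by (rule node_residue_Suc[OF m, of _ B]) (use Suc B in auto)
  also have "\<dots> = J ** node_value q z (Suc k)" unfolding i by simp
  finally have r: "node_residue q z (solution q z) (Suc k) = J ** node_value q z (Suc k)" .
  have "jump_inv (q (Suc k)) ** (jump (q (Suc k)) ** node_value q z (Suc k)) = node_value q z (Suc k)"
    by (simp only: matrix_mul_assoc jump_inverse matrix_mul_lid)
  then show ?case using r unfolding dirac_equation_node solution_node by simp
qed

lemma solution_equation: "dirac_equation q z (solution q z) x"
proof (cases "x < 0")
  case True
  then show ?thesis unfolding dirac_equation_negative[OF True] by (simp add: solution_def)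
next
  case False
  define k where "k = nat \<lfloor>x\<rfloor>"
  have k: "real k \<le> x" "x < real k + 1" using False by (auto simp: k_def)
  have m: "solution q z \<in> borel_measurable borel" by (rule right_continuous_measurable) (rule solution_right_continuous)
  obtain B where B: "\<And>x. x < real (k + 1) \<Longrightarrow> norm (solution q z x) \<le> B" using solution_bounded by blast
  have B': "norm (solution q z t) \<le> B" if "t \<in> {0..x}" for t using that k by (intro B) simp
  have "J ** solution q z x = J ** solution q z (real k) + integral {real k..x} (\<lambda>t. mat z ** solution q z t)"
    using integral_unique[OF solution_cell_integral[OF k(1) less_imp_le[OF k(2)], of z q]] solution_on[OF k, of q z] by simp
  then show ?thesis using dirac_equation_cell[OF m B' k] solution_equation_node by blast
qed

lemma bounded_variation_by_monotone:
  fixes a b :: real and F :: "real \<Rightarrow> 'v::real_normed_vector"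
  assumes "\<And>x y. a \<le> y \<Longrightarrow> y \<le> x \<Longrightarrow> x \<le> b \<Longrightarrow> norm (F x - F y) \<le> \<Phi> x - (\<Phi> y :: real)"
    and t: "t 0 = a" "t n = b" "\<forall>i<n. t i \<le> t (Suc i)"
  shows "(\<Sum>i<n. norm (F (t (Suc i)) - F (t i))) \<le> \<Phi> b - \<Phi> a"
proof -
  have up: "a \<le> t i" if "i \<le> n" for i
    using that
  proof (induction i)
    case (Suc i)
    then have "a \<le> t i" "t i \<le> t (Suc i)" using t(3) by simp_all
    then show ?case by (rule order_trans)
  qed (simp add: t)
  have down: "t (n - i) \<le> b" if "i \<le> n" for i
    using that
  proof (induction i)
    case (Suc i)
    then have "t (n - Suc i) \<le> t (Suc (n - Suc i))" by (intro t(3)[rule_format]) simp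
    also have "Suc (n - Suc i) = n - i" using Suc by simp
    finally have "t (n - Suc i) \<le> t (n - i)" .
    moreover have "t (n - i) \<le> b" using Suc by simp
    ultimately show ?case by (rule order_trans)
  qed (simp add: t)
  have "(\<Sum>i<n. norm (F (t (Suc i)) - F (t i))) \<le> (\<Sum>i<n. \<Phi> (t (Suc i)) - \<Phi> (t i))"
  proof (rule sum_mono)
    fix i assume "i \<in> {..<n}"
    then show "norm (F (t (Suc i)) - F (t i)) \<le> \<Phi> (t (Suc i)) - \<Phi> (t i)"
      using up[of i] down[of "n - Suc i"] t(3) by (intro assms(1)) simp_all
  qed
  also have "\<dots> = \<Phi> b - \<Phi> a" using sum_lessThan_telescope[of "\<lambda>i. \<Phi> (t i)" n] by (simp add: t)
  finally show ?thesis .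
qed

text \<open>
  By the integral equation the increments of the solution are dominated by those of the increasing
  function \<open>\<Phi>\<close>, which adds up the norms of the jumps and a multiple of the length.
\<close>

lemma solution_bounded_variation: "locally_bounded_variation (solution q z)"
  unfolding locally_bounded_variation_def
proof (intro allI)
  fix a b :: real
  define S where "S = solution q z"
  define m where "m = nat \<lceil>b\<rceil> + 1"
  have bm: "b < real m" by (simp add: m_def) linarith
  obtain B where B: "\<And>x. x < real m \<Longrightarrow> norm (S x) \<le> B" unfolding S_def using solution_bounded by blast
  obtain K where K: "\<And>X. norm (transpose J ** (X::complex^2^2)) \<le> norm X * K" "0 < K"
    using bounded_linear.pos_bounded[OF bounded_linear_matrix_left[of "transpose J"]] by blast
  obtain L where L: "\<And>X. norm (mat z ** (X::complex^2^2)) \<le> norm X * L" "0 < L"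
    using bounded_linear.pos_bounded[OF bounded_linear_matrix_left[of "mat z"]] by blast
  have B0: "0 \<le> B" by (rule order_trans[OF norm_ge_zero B[OF bm]])
  have mS: "S \<in> borel_measurable borel" unfolding S_def by (rule right_continuous_measurable) (rule solution_right_continuous)
  define \<Phi> where "\<Phi> x = K * ((\<Sum>k | real k \<le> x. norm (jump_term q S k)) + B * L * max 0 x)" for x :: real
  have fin: "finite {k. real k \<le> x}" for x :: real
    by (rule finite_subset[of _ "{..nat \<lfloor>x\<rfloor>}"]) (auto simp: le_nat_floor)
  have \<Phi>: "norm (S x - S y) \<le> \<Phi> x - \<Phi> y" if xy: "a \<le> y" "y \<le> x" "x \<le> b" for x y
  proof -
    define D where "D = {k. real k \<le> x} - {k. real k \<le> y}"
    have sub: "{k. real k \<le> y} \<subseteq> {k. real k \<le> x}" using xy by auto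
    have sd: "(\<Sum>k\<in>D. f k) = (\<Sum>k | real k \<le> x. f k) - (\<Sum>k | real k \<le> y. f k)" for f :: "nat \<Rightarrow> 'z::ab_group_add"
      unfolding D_def by (rule sum_diff[OF fin sub])
    define I where "I w = (LINT t:{..w}|lborel. dirac_integrand q z S t)" for w
    have eq: "J ** S w + ((\<Sum>k | real k \<le> w. jump_term q S k) - I w) = J" for w
      using solution_equation[of q z w] unfolding dirac_equation_def S_def I_def .
    have dI: "norm (I x - I y) \<le> B * L * (max 0 x - max 0 y)"
    proof (cases "x \<le> 0")
      case True
      then show ?thesis using xy unfolding I_def by (simp add: dirac_integral_nonpos)
    next
      case False
      define y' where "y' = max 0 y"
      have y': "0 \<le> y'" "y' \<le> x" using False xy by (auto simp: y'_def)
      have BS: "norm (S t) \<le> B" if "t \<in> {0..x}" for t using that xy bm by (intro B) simp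
      have "I y = I y'" unfolding I_def y'_def by (cases "y \<le> 0") (simp_all add: dirac_integral_nonpos max_def)
      moreover have "I x = I y' + integral {y'..x} (\<lambda>t. mat z ** S t)"
        unfolding I_def by (rule dirac_integral_split(2)[OF mS BS y'])
      ultimately have "norm (I x - I y) = norm (integral {y'..x} (\<lambda>t. mat z ** S t))" by simp
      also have "\<dots> \<le> integral {y'..x} (\<lambda>t. B * L)"
      proof (rule Henstock_Kurzweil_Integration.integral_norm_bound_integral)
        show "(\<lambda>t. mat z ** S t) integrable_on {y'..x}" by (rule dirac_integral_split(1)[OF mS BS y'])
        show "(\<lambda>t. B * L) integrable_on {y'..x}" by (rule integrable_const_ivl)
        fix t assume t: "t \<in> {y'..x}"
        have "norm (mat z ** S t) \<le> norm (S t) * L" by (rule L(1))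
        also have "\<dots> \<le> B * L" using BS[of t] t y' L(2) by (intro mult_right_mono) simp_all
        finally show "norm (mat z ** S t) \<le> B * L" .
      qed
      also have "\<dots> = B * L * (max 0 x - max 0 y)" using y' False by (simp add: y'_def max_def)
      finally show ?thesis .
    qed
    have alg: "jx + (sx - ix) = j \<Longrightarrow> jy + (sy - iy) = j \<Longrightarrow> jx - jy = (ix - iy) - (sx - sy)"
      for jx jy sx sy ix iy j :: "complex^2^2" by (simp add: algebra_simps)
    have "J ** (S x - S y) = (I x - I y) - (\<Sum>k\<in>D. jump_term q S k)"
      unfolding matrix_sub_ldistrib sd by (rule alg[OF eq eq])
    then have "transpose J ** (J ** (S x - S y)) = transpose J ** ((I x - I y) - (\<Sum>k\<in>D. jump_term q S k))" by simp
    then have "S x - S y = transpose J ** ((I x - I y) - (\<Sum>k\<in>D. jump_term q S k))"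
      by (simp add: matrix_mul_assoc J_inverse matrix_mul_lid)
    then have "norm (S x - S y) \<le> norm ((I x - I y) - (\<Sum>k\<in>D. jump_term q S k)) * K" using K(1) by simp
    also have "\<dots> \<le> (B * L * (max 0 x - max 0 y) + (\<Sum>k\<in>D. norm (jump_term q S k))) * K"
    proof (rule mult_right_mono)
      have "norm ((I x - I y) - (\<Sum>k\<in>D. jump_term q S k)) \<le> norm (I x - I y) + norm (\<Sum>k\<in>D. jump_term q S k)"
        by (rule norm_triangle_ineq4)
      also have "\<dots> \<le> B * L * (max 0 x - max 0 y) + (\<Sum>k\<in>D. norm (jump_term q S k))"
        by (intro add_mono dI norm_sum)
      finally show "norm ((I x - I y) - (\<Sum>k\<in>D. jump_term q S k)) \<le> B * L * (max 0 x - max 0 y) + (\<Sum>k\<in>D. norm (jump_term q S k))" .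
    qed (use K(2) in simp)
    also have "\<dots> = \<Phi> x - \<Phi> y" unfolding \<Phi>_def sd by (simp add: algebra_simps)
    finally show ?thesis .
  qed
  show "\<exists>B. \<forall>n t. t 0 = a \<and> t n = b \<and> (\<forall>i<n. t i \<le> t (Suc i)) \<longrightarrow>
      (\<Sum>i<n. norm (solution q z (t (Suc i)) - solution q z (t i))) \<le> B"
  proof (intro exI allI impI)
    fix n :: nat and t :: "nat \<Rightarrow> real" assume t: "t 0 = a \<and> t n = b \<and> (\<forall>i<n. t i \<le> t (Suc i))"
    show "(\<Sum>i<n. norm (solution q z (t (Suc i)) - solution q z (t i))) \<le> \<Phi> b - \<Phi> a"
      unfolding S_def[symmetric] by (rule bounded_variation_by_monotone[OF \<Phi>]) (use t in auto)
  qed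
qed

lemma dirac_solution_eq: "dirac_solution q z = solution q z"
  unfolding dirac_solution_def
proof (rule the_equality)
  show s: "persson_solution q z (solution q z)"
    unfolding persson_solution_eq
    using solution_right_continuous solution_bounded_variation solution_equation by blast
  show "N = solution q z" if "persson_solution q z N" for N
    using persson_solution_unique[OF that s] by blast
qed

section \<open>The Schur function of a Dirac operator\<close>

text \<open>
  The conjugate is the convention that makes these the parameters of the Schur algorithm started at
  the front. The value at \<open>q k = 0\<close> is \<open>0\<close>, by division by zero.
\<close>

definition verblunsky :: "(nat \<Rightarrow> complex) \<Rightarrow> nat \<Rightarrow> complex" where
  "verblunsky q k = of_real (tanh (norm (q k)) / norm (q k)) * cnj (q k)"

lemma norm_verblunsky: "norm (verblunsky q k) = tanh (norm (q k))"
proof -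
  have "0 \<le> tanh (norm (q k))" by simp
  then show ?thesis by (cases "q k = 0") (simp_all add: verblunsky_def norm_mult norm_divide)
qed

lemma schur_parameters_verblunsky: "schur_parameters (verblunsky q)"
  by unfold_locales (simp add: norm_verblunsky tanh_real_lt_1)

lemma jump_verblunsky:
  "of_real (sinhc (norm (q k))) * cnj (q k) = of_real (cosh (norm (q k))) * verblunsky q k"
proof (cases "q k = 0")
  case False
  then show ?thesis by (simp add: sinhc_def verblunsky_def tanh_def)
qed (simp add: verblunsky_def)

text \<open>
  In these coordinates of a column the free flow is diagonal and the jump at \<open>k\<close> is a Schur step.
\<close>

definition u_part :: "complex^2^2 \<Rightarrow> 2 \<Rightarrow> complex" where "u_part N j = N$2$j + \<i> * N$1$j"
definition v_part :: "complex^2^2 \<Rightarrow> 2 \<Rightarrow> complex" where "v_part N j = N$2$j - \<i> * N$1$j"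

lemma second_row: "N$2$j = (u_part N j + v_part N j) / 2"
  by (simp add: u_part_def v_part_def)

lemma jump_parts:
  "u_part (jump (q k) ** N) j = of_real (cosh (norm (q k))) * (u_part N j + cnj (verblunsky q k) * v_part N j)"
  "v_part (jump (q k) ** N) j = of_real (cosh (norm (q k))) * (v_part N j + verblunsky q k * u_part N j)"
proof -
  define C where "C = complex_of_real (cosh (norm (q k)))"
  define S where "S = complex_of_real (sinhc (norm (q k)))"
  have v: "S * cnj (q k) = C * verblunsky q k" using jump_verblunsky by (simp add: C_def S_def)
  have "cnj (S * cnj (q k)) = cnj (C * verblunsky q k)" by (simp only: v)
  then have u: "S * q k = C * cnj (verblunsky q k)" by (simp add: C_def S_def)
  have r1: "(jump (q k) ** N)$1$j = C * N$1$j + S * (- of_real (Re (q k)) * N$1$j + of_real (Im (q k)) * N$2$j)"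
    and r2: "(jump (q k) ** N)$2$j = C * N$2$j + S * (of_real (Im (q k)) * N$1$j + of_real (Re (q k)) * N$2$j)"
    unfolding jump_def C_def[symmetric] S_def[symmetric] by (simp_all add: mat2_simps T_mat_2 algebra_simps)
  have q: "q k = of_real (Re (q k)) + \<i> * of_real (Im (q k))" "cnj (q k) = of_real (Re (q k)) - \<i> * of_real (Im (q k))"
    by (simp_all add: complex_eq_iff)
  have "u_part (jump (q k) ** N) j = C * u_part N j + S * (of_real (Re (q k)) + \<i> * of_real (Im (q k))) * v_part N j"
    unfolding u_part_def v_part_def r1 r2 by (simp add: algebra_simps)
  then have "u_part (jump (q k) ** N) j = C * u_part N j + S * q k * v_part N j" by (simp only: q(1)[symmetric])
  then show "u_part (jump (q k) ** N) j = of_real (cosh (norm (q k))) * (u_part N j + cnj (verblunsky q k) * v_part N j)"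
    unfolding u C_def by (simp add: algebra_simps)
  have "v_part (jump (q k) ** N) j = C * v_part N j + S * cnj (q k) * u_part N j"
    unfolding u_part_def v_part_def r1 r2 q(2) by (simp add: algebra_simps)
  then show "v_part (jump (q k) ** N) j = of_real (cosh (norm (q k))) * (v_part N j + verblunsky q k * u_part N j)"
    unfolding v C_def by (simp add: algebra_simps)
qed

lemma rot_parts:
  "u_part (rot a ** N) j = exp (\<i> * a) * u_part N j"
  "v_part (rot a ** N) j = exp (- (\<i> * a)) * v_part N j"
proof -
  have e: "exp (\<i> * a) = cos a + \<i> * sin a" "exp (- (\<i> * a)) = cos a - \<i> * sin a"
    using exp_Euler[of a] exp_Euler[of "- a"] by simp_all
  have r: "(rot a ** N)$1$j = cos a * N$1$j + sin a * N$2$j" "(rot a ** N)$2$j = cos a * N$2$j - sin a * N$1$j"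
    by (simp_all add: rot_def mat2_simps algebra_simps)
  show "u_part (rot a ** N) j = exp (\<i> * a) * u_part N j" "v_part (rot a ** N) j = exp (- (\<i> * a)) * v_part N j"
    unfolding u_part_def v_part_def r e by (simp_all add: algebra_simps)
qed

text \<open>
  Up to the scalar \<open>E k\<close>, which is common to both coordinates and both columns, the left limits follow
  the Schur recursion with \<open>\<zeta> = exp (2\<i>z)\<close>.
\<close>

lemma node_parts:
  fixes q z j
  defines "E \<equiv> \<lambda>k. exp (- (\<i> * z * of_nat k)) * of_real (\<Prod>i<k. cosh (norm (q i)))"
  defines "st \<equiv> schur_state (verblunsky q) (exp (2 * \<i> * z)) (v_part (mat 1) j, u_part (mat 1) j)"
  shows "v_part (node_value q z k) j = E k * fst (st k) \<and> u_part (node_value q z k) j = E k * snd (st k)"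
proof (induction k)
  case 0
  show ?case by (simp add: E_def st_def)
next
  case (Suc k)
  have ES: "E (Suc k) = exp (- (\<i> * z)) * (of_real (cosh (norm (q k))) * E k)"
    by (simp add: E_def algebra_simps flip: exp_add)
  have z: "exp (\<i> * z) = exp (- (\<i> * z)) * exp (2 * \<i> * z)" by (simp flip: exp_add)
  show ?case
    unfolding node_value.simps rot_parts jump_parts Suc[THEN conjunct1] Suc[THEN conjunct2] ES st_def schur_state.simps fst_conv snd_conv z
    by (simp add: algebra_simps)
qed

lemma mat_1_parts: "v_part (mat 1) 1 = - \<i>" "u_part (mat 1) 1 = \<i>" "v_part (mat 1) 2 = 1" "u_part (mat 1) 2 = 1"
  by (simp_all add: u_part_def v_part_def mat_2)

text \<open>
  What happens in the cell of \<open>x\<close>, namely the last jump and a free flow of length below \<open>1\<close>, only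
  affects the row \<open>(d, e)\<close> by which the second row of the solution is read off from the state. For
  \<open>Im z > 0\<close> this row satisfies \<open>\<bar>e\<bar> \<le> \<bar>d\<bar>\<close>, so the quotient is a continuation of the continued fraction by
  \<open>\<omega> = e / d\<close>.
\<close>

lemma weyl_quotient:
  fixes q :: "nat \<Rightarrow> complex"
  assumes z: "Im z > 0" and x: "x \<ge> 0"
  defines "k \<equiv> nat \<lfloor>x\<rfloor>" and "\<gamma> \<equiv> verblunsky q" and "\<zeta> \<equiv> exp (2 * \<i> * z)"
  shows "\<exists>\<omega>. norm \<omega> \<le> 1 \<and> solution q z x $ 2 $ 2 / solution q z x $ 2 $ 1 =
    \<i> * (1 + (wall_B \<gamma> \<zeta> k + \<omega> * wall_B' \<gamma> \<zeta> k) / (wall_A \<gamma> \<zeta> k + \<omega> * wall_A' \<gamma> \<zeta> k))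
      / (1 - (wall_B \<gamma> \<zeta> k + \<omega> * wall_B' \<gamma> \<zeta> k) / (wall_A \<gamma> \<zeta> k + \<omega> * wall_A' \<gamma> \<zeta> k))"
proof -
  interpret schur_parameters \<gamma> unfolding \<gamma>_def by (rule schur_parameters_verblunsky)
  have zeta: "norm \<zeta> < 1" using z by (simp add: \<zeta>_def)
  have k: "real k \<le> x" "x < real k + 1" using x by (auto simp: k_def)
  define t where "t = x - real k"
  have t: "t \<ge> 0" using k by (simp add: t_def)
  define a where "a = exp (- (\<i> * (z * of_real t)))"
  define b where "b = exp (\<i> * (z * of_real t))"
  have ab: "norm b \<le> norm a" "a \<noteq> 0" using z t by (auto simp: a_def b_def)
  define g where "g = cnj (\<gamma> k)"
  have g: "norm g < 1" using norm_less_1[of k] by (simp add: g_def)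
  define d where "d = a + g * b"
  define e where "e = cnj g * a + b"
  have "norm (g * b) < norm a"
  proof -
    have "norm (g * b) \<le> norm g * norm a" using ab(1) by (simp add: norm_mult mult_left_mono)
    also have "\<dots> < norm a" using g ab(2) by simp
    finally show ?thesis .
  qed
  then have d0: "d \<noteq> 0" unfolding d_def by (metis add_eq_0_iff norm_minus_cancel less_irrefl)
  have "(norm d)\<^sup>2 - (norm e)\<^sup>2 \<ge> 0"
    unfolding d_def e_def blaschke_identity using g ab(1)
    by (intro mult_nonneg_nonneg) (simp_all add: abs_square_le_1 power_mono)
  then have "(norm e)\<^sup>2 \<le> (norm d)\<^sup>2" by linarith
  then have ed: "norm e \<le> norm d" by (rule power2_le_imp_le) (rule norm_ge_zero)
  define \<omega> where "\<omega> = e / d"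
  have om: "norm \<omega> \<le> 1" using ed d0 by (simp add: \<omega>_def norm_divide)
  define K where "K = of_real (cosh (norm (q k))) * (exp (- (\<i> * z * of_nat k)) * of_real (\<Prod>i<k. cosh (norm (q i))))"
  have K0: "K \<noteq> 0" by (simp add: K_def prod_zero_iff)
  define A where "A = wall_A \<gamma> \<zeta> k + \<omega> * wall_A' \<gamma> \<zeta> k"
  define B where "B = wall_B \<gamma> \<zeta> k + \<omega> * wall_B' \<gamma> \<zeta> k"
  have A0: "A \<noteq> 0" unfolding A_def by (rule wall_ratio_diff(1)[OF zeta om])
  have row: "solution q z x $ 2 $ j = K * d * (v_part (mat 1) j * A + u_part (mat 1) j * B) / 2" for j
  proof -
    define v where "v = fst (schur_state \<gamma> \<zeta> (v_part (mat 1) j, u_part (mat 1) j) k)"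
    define u where "u = snd (schur_state \<gamma> \<zeta> (v_part (mat 1) j, u_part (mat 1) j) k)"
    have "2 * (solution q z x $ 2 $ j) = b * (of_real (cosh (norm (q k))) * (u_part (node_value q z k) j + g * v_part (node_value q z k) j))
       + a * (of_real (cosh (norm (q k))) * (v_part (node_value q z k) j + cnj g * u_part (node_value q z k) j))"
      unfolding second_row solution_on[OF k] rot_parts jump_parts t_def[symmetric] a_def b_def g_def \<gamma>_def by simp
    also have "\<dots> = K * (b * (u + g * v) + a * (v + cnj g * u))"
      using node_parts[of q z k j] unfolding u_def v_def K_def \<gamma>_def \<zeta>_def by (simp add: algebra_simps)
    also have "b * (u + g * v) + a * (v + cnj g * u) = d * v + e * u" by (simp add: d_def e_def algebra_simps)
    also have "d * v + e * u = d * (v + \<omega> * u)" using d0 by (simp add: \<omega>_def field_simps)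
    also have "v + \<omega> * u = v_part (mat 1) j * A + u_part (mat 1) j * B"
      unfolding v_def u_def schur_state_wall A_def B_def by (simp add: algebra_simps)
    finally show ?thesis by (simp add: field_simps)
  qed
  have r21: "solution q z x $ 2 $ 1 = K * d / 2 * (- \<i> * (A - B))"
    and r22: "solution q z x $ 2 $ 2 = K * d / 2 * (A + B)"
    unfolding row mat_1_parts by (simp_all add: algebra_simps)
  have "solution q z x $ 2 $ 2 / solution q z x $ 2 $ 1 = (A + B) / (- \<i> * (A - B))"
    unfolding r21 r22 using K0 d0 by simp
  also have "\<dots> = \<i> * (A + B) / (A - B)"
    by (cases "A = B") (simp_all add: field_simps)
  also have "\<dots> = \<i> * (1 + B / A) / (1 - B / A)"
  proof -
    have "A + B = A * (1 + B / A)" "A - B = A * (1 - B / A)" using A0 by (simp_all add: field_simps)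
    then show ?thesis using A0 by (metis mult.left_commute mult_divide_mult_cancel_left)
  qed
  finally show ?thesis using om unfolding A_def B_def by blast
qed

text \<open>
  By \<open>wall_ratio_diff\<close> the values \<open>\<omega>\<close> of \<open>weyl_quotient\<close> do not matter in the limit.
\<close>

theorem schur_function_eq:
  assumes z: "Im z > 0"
  shows "schur_function q z = schur_of (verblunsky q) (exp (2 * \<i> * z))"
proof -
  define \<gamma> where "\<gamma> = verblunsky q"
  define \<zeta> where "\<zeta> = exp (2 * \<i> * z)"
  interpret schur_parameters \<gamma> unfolding \<gamma>_def by (rule schur_parameters_verblunsky)
  have zeta: "norm \<zeta> < 1" using z by (simp add: \<zeta>_def)
  define F where "F = schur_fun \<zeta>"
  have F1: "F \<noteq> 1" using norm_schur_fun_less[OF zeta] by (auto simp: F_def)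
  have "\<forall>x. \<exists>\<rho>. x \<ge> 0 \<longrightarrow> norm (\<rho> - approx (nat \<lfloor>x\<rfloor>) \<zeta>) \<le> norm \<zeta> ^ nat \<lfloor>x\<rfloor> / (1 - norm \<zeta>) \<and>
      solution q z x $ 2 $ 2 / solution q z x $ 2 $ 1 = \<i> * (1 + \<rho>) / (1 - \<rho>)"
  proof
    fix x :: real
    show "\<exists>\<rho>. x \<ge> 0 \<longrightarrow> norm (\<rho> - approx (nat \<lfloor>x\<rfloor>) \<zeta>) \<le> norm \<zeta> ^ nat \<lfloor>x\<rfloor> / (1 - norm \<zeta>) \<and>
      solution q z x $ 2 $ 2 / solution q z x $ 2 $ 1 = \<i> * (1 + \<rho>) / (1 - \<rho>)"
    proof (cases "x \<ge> 0")
      case True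
      from weyl_quotient[OF z True, of q, folded \<gamma>_def \<zeta>_def] obtain \<omega> where w: "norm \<omega> \<le> 1"
        and eq: "solution q z x $ 2 $ 2 / solution q z x $ 2 $ 1 =
          \<i> * (1 + (wall_B \<gamma> \<zeta> (nat \<lfloor>x\<rfloor>) + \<omega> * wall_B' \<gamma> \<zeta> (nat \<lfloor>x\<rfloor>)) / (wall_A \<gamma> \<zeta> (nat \<lfloor>x\<rfloor>) + \<omega> * wall_A' \<gamma> \<zeta> (nat \<lfloor>x\<rfloor>)))
          / (1 - (wall_B \<gamma> \<zeta> (nat \<lfloor>x\<rfloor>) + \<omega> * wall_B' \<gamma> \<zeta> (nat \<lfloor>x\<rfloor>)) / (wall_A \<gamma> \<zeta> (nat \<lfloor>x\<rfloor>) + \<omega> * wall_A' \<gamma> \<zeta> (nat \<lfloor>x\<rfloor>)))"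
        by (elim exE conjE)
      show ?thesis
        by (rule exI[of _ "(wall_B \<gamma> \<zeta> (nat \<lfloor>x\<rfloor>) + \<omega> * wall_B' \<gamma> \<zeta> (nat \<lfloor>x\<rfloor>)) / (wall_A \<gamma> \<zeta> (nat \<lfloor>x\<rfloor>) + \<omega> * wall_A' \<gamma> \<zeta> (nat \<lfloor>x\<rfloor>))"])
          (intro impI conjI eq wall_ratio_diff(2)[OF zeta w, folded approx_def])
    qed simp
  qed
  then obtain \<rho> where \<rho>: "\<And>x. x \<ge> 0 \<Longrightarrow> norm (\<rho> x - approx (nat \<lfloor>x\<rfloor>) \<zeta>) \<le> norm \<zeta> ^ nat \<lfloor>x\<rfloor> / (1 - norm \<zeta>)"
     "\<And>x. x \<ge> 0 \<Longrightarrow> solution q z x $ 2 $ 2 / solution q z x $ 2 $ 1 = \<i> * (1 + \<rho> x) / (1 - \<rho> x)"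
    by metis
  have fl: "filterlim (\<lambda>x::real. nat \<lfloor>x\<rfloor>) sequentially at_top"
    by (rule filterlim_compose[OF filterlim_nat_sequentially filterlim_floor_sequentially])
  have "(\<lambda>n. norm \<zeta> ^ n) \<longlonglongrightarrow> 0" by (rule LIMSEQ_power_zero) (use zeta in simp)
  from filterlim_compose[OF this fl]
  have "((\<lambda>x::real. norm \<zeta> ^ nat \<lfloor>x\<rfloor> / (1 - norm \<zeta>)) \<longlongrightarrow> 0 / (1 - norm \<zeta>)) at_top"
    by (rule tendsto_divide[OF _ tendsto_const]) (use zeta in simp)
  note lim0 = this
  have "((\<lambda>x. \<rho> x - approx (nat \<lfloor>x\<rfloor>) \<zeta>) \<longlongrightarrow> 0) at_top"
  proof (rule Lim_null_comparison[where g = "\<lambda>x. norm \<zeta> ^ nat \<lfloor>x\<rfloor> / (1 - norm \<zeta>)"])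
    show "\<forall>\<^sub>F x in at_top. norm (\<rho> x - approx (nat \<lfloor>x\<rfloor>) \<zeta>) \<le> norm \<zeta> ^ nat \<lfloor>x\<rfloor> / (1 - norm \<zeta>)"
      by (rule eventually_mono[OF eventually_ge_at_top[of "0::real"] \<rho>(1)])
    show "((\<lambda>x::real. norm \<zeta> ^ nat \<lfloor>x\<rfloor> / (1 - norm \<zeta>)) \<longlongrightarrow> 0) at_top" using lim0 by simp
  qed
  from tendsto_add[OF this filterlim_compose[OF approx_tendsto[OF zeta] fl]]
  have "(\<rho> \<longlongrightarrow> F) at_top" by (simp add: F_def)
  then have "((\<lambda>x. \<i> * (1 + \<rho> x) / (1 - \<rho> x)) \<longlongrightarrow> \<i> * (1 + F) / (1 - F)) at_top"
    using F1 by (intro tendsto_intros) auto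
  moreover have "eventually (\<lambda>x. \<i> * (1 + \<rho> x) / (1 - \<rho> x) = solution q z x $ 2 $ 2 / solution q z x $ 2 $ 1) at_top"
    using eventually_ge_at_top[of "0::real"] by eventually_elim (simp add: \<rho>(2))
  ultimately have "((\<lambda>x. solution q z x $ 2 $ 2 / solution q z x $ 2 $ 1) \<longlongrightarrow> \<i> * (1 + F) / (1 - F)) at_top"
    by (rule Lim_transform_eventually)
  then have W: "weyl_function q z = \<i> * (1 + F) / (1 - F)"
    unfolding weyl_function_def dirac_solution_eq by (intro tendsto_Lim) simp_all
  have "schur_function q z = F"
    unfolding schur_function_def W
  proof (rule the_equality)
    show "F \<noteq> 1 \<and> \<i> * (1 + F) / (1 - F) = \<i> * (1 + F) / (1 - F)" using F1 by simp
    fix f assume f: "f \<noteq> 1 \<and> \<i> * (1 + F) / (1 - F) = \<i> * (1 + f) / (1 - f)"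
    then have "(1 + F) / (1 - F) = (1 + f) / (1 - f)" by (simp only: times_divide_eq_right[symmetric] mult_cancel_left complex_i_not_zero) simp
    then have "(1 + F) * (1 - f) = (1 + f) * (1 - F)" using f F1 by (simp add: frac_eq_eq)
    then show "f = F" by (simp add: algebra_simps)
  qed
  then show ?thesis by (simp only: F_def \<gamma>_def \<zeta>_def)
qed

section \<open>Poisson integrals of characters\<close>

definition poisson :: "complex \<Rightarrow> real \<Rightarrow> real" where
  "poisson z x = Im z / (norm (of_real x - z))\<^sup>2"

lemma poisson_eq: "poisson z x = Im z / ((x - Re z)\<^sup>2 + (Im z)\<^sup>2)"
  by (simp add: poisson_def cmod_power2)

lemma poisson_nonneg: "Im z > 0 \<Longrightarrow> poisson z x \<ge> 0"
  by (simp add: poisson_def)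

lemma poisson_continuous:
  assumes "Im z > 0"
  shows "continuous_on S (poisson z)"
proof -
  have "(x - Re z)\<^sup>2 + (Im z)\<^sup>2 \<noteq> 0" for x using assms by (simp add: sum_power2_eq_zero_iff)
  then show ?thesis unfolding poisson_eq[abs_def] by (intro continuous_intros) auto
qed

lemma poisson_measurable [measurable]: "poisson z \<in> borel_measurable borel"
  unfolding poisson_def[abs_def] by measurable

lemma arctan_derivative:
  fixes y :: real
  assumes "y > 0"
  shows "((\<lambda>x. arctan ((x - a) / y)) has_real_derivative y / ((x - a)\<^sup>2 + y\<^sup>2)) (at x)"
proof -
  have "((\<lambda>x. arctan ((x - a) / y)) has_real_derivative inverse (1 + ((x - a) / y)\<^sup>2) * (1 / y)) (at x)"
    using assms by (auto intro!: derivative_eq_intros)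
  also have "inverse (1 + ((x - a) / y)\<^sup>2) * (1 / y) = y / ((x - a)\<^sup>2 + y\<^sup>2)"
  proof -
    have "1 + ((x - a) / y)\<^sup>2 = ((x - a)\<^sup>2 + y\<^sup>2) / y\<^sup>2" using assms by (simp add: field_simps)
    then show ?thesis using assms by (simp add: power2_eq_square)
  qed
  finally show ?thesis .
qed

lemma poisson_integral:
  assumes z: "Im z > 0"
  shows "integrable lborel (poisson z)" "(\<integral>x. poisson z x \<partial>lborel) = pi"
proof -
  define F where "F x = arctan ((x - Re z) / Im z)" for x
  have top: "((F \<circ> real_of_ereal) \<longlongrightarrow> pi / 2) (at_left \<infinity>)"
    unfolding ereal_tendsto_simps F_def
    by (rule filterlim_compose[OF tendsto_arctan_at_top])
       (use z in \<open>real_asymp\<close>)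
  have bot: "((F \<circ> real_of_ereal) \<longlongrightarrow> - (pi / 2)) (at_right (- \<infinity>))"
    unfolding ereal_tendsto_simps F_def
    by (rule filterlim_compose[OF tendsto_arctan_at_bot])
       (use z in \<open>real_asymp\<close>)
  have d: "(F has_real_derivative poisson z x) (at x)" for x
    unfolding F_def poisson_eq by (rule arctan_derivative[OF z])
  have c: "isCont (poisson z) x" for x
    using poisson_continuous[OF z, of UNIV] by (simp add: continuous_on_eq_continuous_at)
  have n: "AE x in lborel. (-\<infinity>::ereal) < ereal x \<longrightarrow> ereal x < \<infinity> \<longrightarrow> 0 \<le> poisson z x"
    using poisson_nonneg[OF z] by simp
  note * = interval_integral_FTC_nonneg[of "-\<infinity>" \<infinity> F "poisson z", OF _ d c n bot top]
  have e: "einterval (-\<infinity>) \<infinity> = UNIV" by (auto simp: einterval_def)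
  show "integrable lborel (poisson z)" using *(1) by (simp add: e set_integrable_def)
  show "(\<integral>x. poisson z x \<partial>lborel) = pi"
    using *(2) by (simp add: interval_lebesgue_integral_def e set_lebesgue_integral_def)
qed

lemma integral_limit_symmetric:
  fixes h :: "real \<Rightarrow> complex"
  assumes h: "integrable lborel h"
  shows "(\<lambda>n. \<integral>x. indicat_real {- real n..real n} x *\<^sub>R h x \<partial>lborel) \<longlonglongrightarrow> (\<integral>x. h x \<partial>lborel)"
proof (rule integral_dominated_convergence[where w = "\<lambda>x. norm (h x)"])
  show "AE x in lborel. (\<lambda>n. indicat_real {- real n..real n} x *\<^sub>R h x) \<longlonglongrightarrow> h x"
  proof (rule AE_I2)
    fix x :: real
    obtain N where N: "\<bar>x\<bar> \<le> real N" using real_arch_simple by blast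
    have "eventually (\<lambda>n. indicat_real {- real n..real n} x *\<^sub>R h x = h x) sequentially"
      using eventually_ge_at_top[of N]
    proof (rule eventually_mono)
      fix n assume "N \<le> n"
      then have "x \<in> {- real n..real n}" using N by (auto simp: abs_le_iff)
      then show "indicat_real {- real n..real n} x *\<^sub>R h x = h x" by simp
    qed
    then show "(\<lambda>n. indicat_real {- real n..real n} x *\<^sub>R h x) \<longlonglongrightarrow> h x" by (rule tendsto_eventually)
  qed
qed (use h in \<open>auto simp: indicator_def\<close>)

text \<open>
  The integrand extends to a holomorphic function on a half plane containing the closed upper half
  plane, since \<open>z\<close> is a removable singularity. By Cauchy's theorem its integral over \<open>[-R, R]\<close> is minus
  that over the upper half circle, where \<open>\<bar>f\<bar> \<le> 1\<close> because \<open>s \<ge> 0\<close>.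
\<close>

lemma poisson_half_disc_bound:
  assumes z: "Im z > 0" and s: "s \<ge> 0" and R: "R > norm z"
  defines "f \<equiv> \<lambda>w. exp (\<i> * of_real s * w)"
  shows "norm (integral {-R..R} (\<lambda>x. of_real (poisson z x) * (f (of_real x) - f z))) \<le> 2 * Im z * (R * pi) / (R - norm z)\<^sup>2"
proof -
  have R0: "R > 0" using R norm_ge_zero[of z] by linarith
  \<comment> \<open>\<open>k\<close> extends the integrand: on the real line \<open>(w - z) (w - cnj z) = \<bar>w - z\<bar>\<^sup>2\<close>\<close>
  define g where "g w = (if w = z then deriv f z else (f w - f z) / (w - z))" for w
  define k where "k w = of_real (Im z) * g w / (w - cnj z)" for w
  define H where "H = {w. Im w > - Im z}"
  have H: "convex H" "open H" unfolding H_def by (rule convex_halfspace_Im_gt, rule open_halfspace_Im_gt)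
  have "f holomorphic_on H" unfolding f_def by (intro holomorphic_intros)
  then have "g holomorphic_on H"
    unfolding g_def using pole_lemma[of f H z] H(2) z by (simp add: interior_open H_def)
  moreover have "w - cnj z \<noteq> 0" if "w \<in> H" for w using that by (auto simp: H_def complex_eq_iff)
  ultimately have hk: "k holomorphic_on H" unfolding k_def by (intro holomorphic_intros) auto
  define c where "c = part_circlepath 0 R 0 pi"
  define l where "l = linepath (complex_of_real (- R)) (of_real R)"
  have cim: "norm w = R \<and> Im w \<ge> 0" if "w \<in> path_image c" for w
    using that R0 unfolding c_def path_image_part_circlepath[OF pi_ge_zero]
    by (auto simp: norm_mult Im_exp intro!: mult_nonneg_nonneg sin_ge_zero)
  have lim: "Im w = 0" if "w \<in> path_image l" for w
    using that unfolding l_def by (auto simp: path_image_linepath in_segment)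
  have pf: "pathfinish l = pathstart c" "pathfinish c = pathstart l"
    by (simp_all add: l_def c_def exp_eq_polar)
  have vp: "valid_path l" "valid_path c" by (simp_all add: l_def c_def)
  have "(k has_contour_integral 0) (l +++ c)"
  proof (rule Cauchy_theorem_convex_simple[OF hk H(1)])
    show "path_image (l +++ c) \<subseteq> H"
    proof
      fix w assume "w \<in> path_image (l +++ c)"
      then have "w \<in> path_image l \<or> w \<in> path_image c" using pf by (simp add: path_image_join)
      then have "Im w \<ge> 0" using cim[of w] lim[of w] by auto
      then show "w \<in> H" using z by (simp add: H_def)
    qed
  qed (use pf vp in auto)
  note join = this
  have ci: "k contour_integrable_on l" "k contour_integrable_on c"
    using join contour_integrable_join[OF vp] by (auto simp: contour_integrable_on_def)
  have sum0: "contour_integral l k + contour_integral c k = 0"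
    using contour_integral_join[OF ci vp] contour_integral_unique[OF join] by simp
  have kb: "norm (k w) \<le> 2 * Im z / (R - norm z)\<^sup>2" if w: "norm w = R" "Im w \<ge> 0" for w
  proof -
    have wz: "w \<noteq> z" using w R by auto
    have f1: "norm (f v) \<le> 1" if "Im v \<ge> 0" for v using that s by (simp add: f_def)
    have d: "R - norm z \<le> norm (w - z)" "R - norm z \<le> norm (w - cnj z)"
      using norm_triangle_ineq2[of w z] norm_triangle_ineq2[of w "cnj z"] w by simp_all
    have p: "R - norm z > 0" using R by simp
    have "norm (k w) = Im z * norm (f w - f z) / (norm (w - z) * norm (w - cnj z))"
      using wz z by (simp add: k_def g_def norm_mult norm_divide)
    also have "\<dots> \<le> Im z * 2 / ((R - norm z) * (R - norm z))"
    proof (intro frac_le mult_left_mono mult_mono)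
      show "norm (f w - f z) \<le> 2"
        using norm_triangle_ineq4[of "f w" "f z"] f1[OF w(2)] f1[of z] z by simp
    qed (use z p d in auto)
    finally show ?thesis by (simp add: power2_eq_square mult.commute)
  qed
  have "norm (contour_integral c k) \<le> 2 * Im z / (R - norm z)\<^sup>2 * R * \<bar>pi - 0\<bar>"
    unfolding c_def
  proof (rule contour_integral_bound_part_circlepath)
    show "k contour_integrable_on part_circlepath 0 R 0 pi" using ci(2) by (simp add: c_def)
    show "0 \<le> 2 * Im z / (R - norm z)\<^sup>2" using z by simp
    show "0 \<le> R" using R0 by simp
    show "norm (k x) \<le> 2 * Im z / (R - norm z)\<^sup>2" if "x \<in> path_image (part_circlepath 0 R 0 pi)" for x
      using cim[of x] that kb unfolding c_def by blast
  qed
  then have nl: "norm (contour_integral l k) \<le> 2 * Im z * (R * pi) / (R - norm z)\<^sup>2"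
    using sum0 by (simp add: add_eq_0_iff algebra_simps)
  have "(k has_contour_integral contour_integral l k) l" using ci(1) by (rule has_contour_integral_integral)
  then have "((\<lambda>x. k (of_real x)) has_integral contour_integral l k) {-R..R}"
    unfolding l_def using R0 by (subst (asm) has_contour_integral_linepath_Reals_iff) auto
  moreover have "k (of_real x) = of_real (poisson z x) * (f (of_real x) - f z)" for x
  proof -
    have ne: "of_real x \<noteq> z" using z by auto
    have "(of_real x - z) * (of_real x - cnj z) = complex_of_real ((norm (of_real x - z))\<^sup>2)"
      unfolding complex_norm_square by simp
    then show ?thesis using ne unfolding k_def g_def poisson_def by (simp add: field_simps)
  qed
  ultimately have "((\<lambda>x. of_real (poisson z x) * (f (of_real x) - f z)) has_integral contour_integral l k) {-R..R}"
    by simp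
  then show ?thesis using nl by (simp add: integral_unique)
qed

text \<open>
  The Poisson integral reproduces bounded holomorphic functions; only the characters of
  nonnegative frequency are needed.
\<close>

lemma poisson_character:
  assumes z: "Im z > 0" and s: "s \<ge> 0"
  shows "integrable lborel (\<lambda>x. of_real (poisson z x) * exp (\<i> * of_real s * of_real x))"
    "(\<integral>x. of_real (poisson z x) * exp (\<i> * of_real s * of_real x) \<partial>lborel) = of_real pi * exp (\<i> * of_real s * z)"
proof -
  define f where "f w = exp (\<i> * of_real s * w)" for w
  have fn: "norm (f (of_real x)) = 1" for x by (simp add: f_def)
  have fm: "(\<lambda>x. f (of_real x)) \<in> borel_measurable borel"
    unfolding f_def by (intro borel_measurable_continuous_onI continuous_intros)
  have ip: "integrable lborel (\<lambda>x. complex_of_real (poisson z x))"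
    using poisson_integral(1)[OF z] by (rule integrable_of_real)
  show i: "integrable lborel (\<lambda>x. of_real (poisson z x) * exp (\<i> * of_real s * of_real x))"
    unfolding f_def[symmetric]
    by (rule Bochner_Integration.integrable_bound[OF ip]) (use fm fn in \<open>auto simp: norm_mult\<close>)
  define h where "h x = of_real (poisson z x) * (f (of_real x) - f z)" for x
  have ih: "integrable lborel h"
    unfolding h_def right_diff_distrib f_def using i ip by (intro Bochner_Integration.integrable_diff integrable_mult_left) auto
  have "(\<lambda>n. \<integral>x. indicat_real {- real n..real n} x *\<^sub>R h x \<partial>lborel) \<longlonglongrightarrow> 0"
  proof (rule Lim_null_comparison)
    show "\<forall>\<^sub>F n in sequentially. norm (\<integral>x. indicat_real {- real n..real n} x *\<^sub>R h x \<partial>lborel) \<le> 2 * Im z * (real n * pi) / (real n - norm z)\<^sup>2"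
      using filterlim_real_sequentially[unfolded filterlim_at_top_dense, rule_format, of "norm z"]
    proof (rule eventually_mono)
      fix n assume n: "norm z < real n"
      have "set_integrable lborel {- real n..real n} h"
        unfolding set_integrable_def using ih by (intro integrable_mult_indicator) auto
      from set_borel_integral_eq_integral(2)[OF this]
      have "(\<integral>x. indicat_real {- real n..real n} x *\<^sub>R h x \<partial>lborel) = integral {- real n..real n} h"
        by (simp add: set_lebesgue_integral_def)
      then show "norm (\<integral>x. indicat_real {- real n..real n} x *\<^sub>R h x \<partial>lborel) \<le> 2 * Im z * (real n * pi) / (real n - norm z)\<^sup>2"
        using poisson_half_disc_bound[OF z s n] by (simp add: h_def[abs_def] f_def)
    qed
    show "(\<lambda>n. 2 * Im z * (real n * pi) / (real n - norm z)\<^sup>2) \<longlonglongrightarrow> 0" by real_asymp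
  qed
  with integral_limit_symmetric[OF ih] have h0: "(\<integral>x. h x \<partial>lborel) = 0" by (rule LIMSEQ_unique)
  have "(\<integral>x. of_real (poisson z x) * f (of_real x) \<partial>lborel) = (\<integral>x. h x + of_real (poisson z x) * f z \<partial>lborel)"
    by (simp add: h_def algebra_simps)
  also have "\<dots> = (\<integral>x. h x \<partial>lborel) + (\<integral>x. of_real (poisson z x) * f z \<partial>lborel)"
    using ih ip by (intro Bochner_Integration.integral_add) auto
  also have "\<dots> = of_real pi * f z"
    using h0 poisson_integral(2)[OF z] by simp
  finally show "(\<integral>x. of_real (poisson z x) * exp (\<i> * of_real s * of_real x) \<partial>lborel) = of_real pi * exp (\<i> * of_real s * z)"
    by (simp only: f_def)
qed

lemma poisson_power_series:
  fixes c :: "nat \<Rightarrow> complex"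
  assumes z: "Im z > 0" and c: "summable (\<lambda>n. norm (c n))"
    and G: "\<And>\<zeta>. norm \<zeta> \<le> 1 \<Longrightarrow> (\<lambda>n. c n * \<zeta> ^ n) sums G \<zeta>"
  shows "integrable lborel (\<lambda>x. of_real (poisson z x) * G (exp (2 * \<i> * of_real x)))"
    "(\<integral>x. of_real (poisson z x) * G (exp (2 * \<i> * of_real x)) \<partial>lborel) = of_real pi * G (exp (2 * \<i> * z))"
proof -
  define t where "t n x = c n * (of_real (poisson z x) * exp (\<i> * of_real (2 * real n) * of_real x))" for n x
  have e: "exp (2 * \<i> * w) ^ n = exp (\<i> * of_real (2 * real n) * w)" for n w
    by (simp add: exp_of_nat_mult[symmetric] algebra_simps)
  have ti: "integrable lborel (t n)" for n
    unfolding t_def using poisson_character(1)[OF z, of "2 * real n"] by (intro integrable_mult_right) simp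
  have tn: "norm (t n x) = norm (c n) * poisson z x" for n x
    using poisson_nonneg[OF z, of x] by (simp add: t_def norm_mult)
  have s1: "AE x in lborel. summable (\<lambda>n. norm (t n x))"
    unfolding tn using c by (intro AE_I2 summable_mult2)
  have s2: "summable (\<lambda>n. \<integral>x. norm (t n x) \<partial>lborel)"
    unfolding tn using poisson_integral[OF z] c by (simp add: summable_mult2)
  have Gs: "(\<Sum>n. t n x) = of_real (poisson z x) * G (exp (2 * \<i> * of_real x))" for x
  proof -
    have "(\<lambda>n. of_real (poisson z x) * (c n * exp (2 * \<i> * of_real x) ^ n)) sums (of_real (poisson z x) * G (exp (2 * \<i> * of_real x)))"
      by (rule sums_mult[OF G]) simp
    then have "(\<lambda>n. t n x) sums (of_real (poisson z x) * G (exp (2 * \<i> * of_real x)))"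
      unfolding e t_def by (simp only: mult.left_commute)
    then show ?thesis by (rule sums_unique[symmetric])
  qed
  show "integrable lborel (\<lambda>x. of_real (poisson z x) * G (exp (2 * \<i> * of_real x)))"
    using integrable_suminf[OF ti s1 s2] unfolding Gs .
  have "(\<lambda>n. \<integral>x. t n x \<partial>lborel) sums (\<integral>x. (\<Sum>n. t n x) \<partial>lborel)" by (rule sums_integral[OF ti s1 s2])
  moreover have "(\<integral>x. t n x \<partial>lborel) = of_real pi * (c n * exp (2 * \<i> * z) ^ n)" for n
    unfolding t_def e using poisson_character[OF z, of "2 * real n"] by simp
  moreover have "(\<lambda>n. of_real pi * (c n * exp (2 * \<i> * z) ^ n)) sums (of_real pi * G (exp (2 * \<i> * z)))"
    by (rule sums_mult[OF G]) (use z in simp)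
  ultimately have "(\<lambda>n. of_real pi * (c n * exp (2 * \<i> * z) ^ n)) sums (\<integral>x. (\<Sum>n. t n x) \<partial>lborel)"
    and *: "(\<lambda>n. of_real pi * (c n * exp (2 * \<i> * z) ^ n)) sums (of_real pi * G (exp (2 * \<i> * z)))" by simp_all
  from sums_unique2[OF this] show "(\<integral>x. of_real (poisson z x) * G (exp (2 * \<i> * of_real x)) \<partial>lborel) = of_real pi * G (exp (2 * \<i> * z))"
    unfolding Gs .
qed

section \<open>Measures are determined by their Poisson integrals\<close>

lemma poisson_arctan:
  assumes "y > 0" "a \<le> b"
  shows "(\<integral>\<^sup>+x. ennreal (poisson (Complex x y) t) * indicator {a..b} x \<partial>lborel)
     = ennreal (arctan ((b - t) / y) - arctan ((a - t) / y))"
proof -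
  have p: "poisson (Complex x y) t = y / ((x - t)\<^sup>2 + y\<^sup>2)" for x
    by (simp add: poisson_eq power2_commute)
  show ?thesis unfolding p
  proof (rule nn_integral_FTC_Icc[OF _ _ _ assms(2)])
    show "(\<lambda>x. y / ((x - t)\<^sup>2 + y\<^sup>2)) \<in> borel_measurable borel" by measurable
    show "((\<lambda>x. arctan ((x - t) / y)) has_real_derivative y / ((x - t)\<^sup>2 + y\<^sup>2)) (at x)" for x
      by (rule arctan_derivative[OF assms(1)])
    show "0 \<le> y / ((x - t)\<^sup>2 + y\<^sup>2)" for x using assms by simp
  qed
qed

text \<open>
  An integrable majorant, uniform in the height \<open>y\<close>: near \<open>[-m, m]\<close> the left side is at most \<open>\<pi>\<close>, and far
  away the mean value theorem shows that it decays like \<open>1 / t\<^sup>2\<close>.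
\<close>

lemma arctan_difference_bound:
  fixes m t y :: real
  assumes m: "m > 0" and y: "0 < y" "y \<le> 1"
  shows "arctan ((m - t) / y) - arctan ((- m - t) / y) \<le> (pi * (1 + (2 * m + 1)\<^sup>2) + 16 * m) * poisson \<i> t"
proof -
  have p: "poisson \<i> t = 1 / (1 + t\<^sup>2)" by (simp add: poisson_eq add.commute)
  have t1: "1 + t\<^sup>2 > 0" by (simp add: add_pos_nonneg)
  show ?thesis
  proof (cases "\<bar>t\<bar> \<le> 2 * m + 1")
    case True
    have "t\<^sup>2 \<le> (2 * m + 1)\<^sup>2" using True m by (simp add: abs_le_square_iff[symmetric])
    then have "pi * (1 + t\<^sup>2) \<le> pi * (1 + (2 * m + 1)\<^sup>2) + 16 * m" using m by (simp add: add_increasing2)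
    then have "pi \<le> (pi * (1 + (2 * m + 1)\<^sup>2) + 16 * m) * poisson \<i> t"
      using t1 by (simp add: p pos_le_divide_eq)
    moreover have "arctan ((m - t) / y) - arctan ((- m - t) / y) \<le> pi"
      using arctan_bounded[of "(m - t) / y"] arctan_bounded[of "(- m - t) / y"] by linarith
    ultimately show ?thesis by linarith
  next
    case False
    have "\<exists>\<xi>. \<xi> > - m \<and> \<xi> < m \<and> arctan ((m - t) / y) - arctan ((- m - t) / y) = (m - - m) * (y / ((\<xi> - t)\<^sup>2 + y\<^sup>2))"
      by (rule MVT2) (use m arctan_derivative[OF y(1)] in auto)
    then obtain \<xi> where xi: "\<xi> > - m" "\<xi> < m" and
      eq: "arctan ((m - t) / y) - arctan ((- m - t) / y) = 2 * m * (y / ((\<xi> - t)\<^sup>2 + y\<^sup>2))" by auto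
    \<comment> \<open>\<open>\<bar>\<xi>\<bar> < m < \<bar>t\<bar> / 2\<close>\<close>
    have d: "\<bar>t\<bar> / 2 \<le> \<bar>\<xi> - t\<bar>" using False xi by (auto simp: abs_if split: if_splits)
    have tpos: "\<bar>t\<bar> > 1" using False m by simp
    have t2: "1 \<le> t\<^sup>2" using power_mono[of 1 "\<bar>t\<bar>" 2] tpos by simp
    have "(\<bar>t\<bar> / 2)\<^sup>2 \<le> \<bar>\<xi> - t\<bar>\<^sup>2" using d by (intro power_mono) auto
    then have d2: "t\<^sup>2 / 4 \<le> (\<xi> - t)\<^sup>2" by (simp add: power_divide)
    have "y / ((\<xi> - t)\<^sup>2 + y\<^sup>2) \<le> 1 / ((1 + t\<^sup>2) / 8)"
    proof (rule frac_le)
      show "(1 + t\<^sup>2) / 8 \<le> (\<xi> - t)\<^sup>2 + y\<^sup>2"       proof -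
        have "(1 + t\<^sup>2) / 8 \<le> t\<^sup>2 / 4" using t2 by simp
        also have "\<dots> \<le> (\<xi> - t)\<^sup>2 + y\<^sup>2" using d2 by (intro add_increasing2) simp_all
        finally show ?thesis .
      qed
    qed (use y t1 in auto)
    then have "2 * m * (y / ((\<xi> - t)\<^sup>2 + y\<^sup>2)) \<le> 2 * m * (1 / ((1 + t\<^sup>2) / 8))"
      using m by (intro mult_left_mono) auto
    also have "\<dots> = 16 * m * poisson \<i> t" by (simp add: p)
    also have "\<dots> \<le> (pi * (1 + (2 * m + 1)\<^sup>2) + 16 * m) * poisson \<i> t"
      using t1 by (intro mult_right_mono) (auto simp: p)
    finally show ?thesis unfolding eq .
  qed
qed

text \<open>
  The interval is widened by \<open>1 / n\<close> while the height shrinks like \<open>1 / n\<^sup>2\<close>. The widening dominates, so the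
  end points count fully and the limit is \<open>\<pi>\<close> times the indicator of the closed interval.
\<close>

lemma arctan_box_limit:
  fixes a b t :: real
  shows "(\<lambda>n. arctan ((b + 1 / real (Suc n) - t) / (1 / (real (Suc n))\<^sup>2)) - arctan ((a - 1 / real (Suc n) - t) / (1 / (real (Suc n))\<^sup>2)))
     \<longlonglongrightarrow> (if t \<le> b then pi / 2 else - (pi / 2)) - (if a \<le> t then - (pi / 2) else pi / 2)"
proof (rule tendsto_diff)
  have 1: "(b + 1 / real (Suc n) - t) / (1 / (real (Suc n))\<^sup>2) = (b - t) * (real (Suc n))\<^sup>2 + real (Suc n)"
    and 2: "(a - 1 / real (Suc n) - t) / (1 / (real (Suc n))\<^sup>2) = (a - t) * (real (Suc n))\<^sup>2 - real (Suc n)" for n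
    by (simp_all add: field_simps power2_eq_square del: of_nat_Suc)
  have up: "filterlim (\<lambda>n. c * (real (Suc n))\<^sup>2 + real (Suc n)) at_top sequentially" if "c \<ge> 0" for c :: real
  proof (rule filterlim_at_top_mono)
    show "filterlim (\<lambda>n. real (Suc n)) at_top sequentially" by real_asymp
  qed (use that in simp)
  have dn: "filterlim (\<lambda>n. c * (real (Suc n))\<^sup>2 + real (Suc n)) at_bot sequentially" if "c < 0" for c :: real
    using that by real_asymp
  show "(\<lambda>n. arctan ((b + 1 / real (Suc n) - t) / (1 / (real (Suc n))\<^sup>2))) \<longlonglongrightarrow> (if t \<le> b then pi / 2 else - (pi / 2))"
    unfolding 1 using filterlim_compose[OF tendsto_arctan_at_top up[of "b - t"]] filterlim_compose[OF tendsto_arctan_at_bot dn[of "b - t"]]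
    by auto
  have m: "(a - t) * (real (Suc n))\<^sup>2 - real (Suc n) = - ((t - a) * (real (Suc n))\<^sup>2 + real (Suc n))" for n
    by (simp add: algebra_simps)
  show "(\<lambda>n. arctan ((a - 1 / real (Suc n) - t) / (1 / (real (Suc n))\<^sup>2))) \<longlonglongrightarrow> (if a \<le> t then - (pi / 2) else pi / 2)"
    unfolding 2 m arctan_minus
    using tendsto_minus[OF filterlim_compose[OF tendsto_arctan_at_top up[of "t - a"]]]
       tendsto_minus[OF filterlim_compose[OF tendsto_arctan_at_bot dn[of "t - a"]]]
    by auto
qed

locale poisson_integrable =
  fixes \<mu> :: "real measure"
  assumes sets_eq: "sets \<mu> = sets borel"
    and integrable_poisson: "Im z > 0 \<Longrightarrow> integrable \<mu> (poisson z)"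
begin

lemma space_eq: "space \<mu> = UNIV"
  using sets_eq_imp_space_eq[OF sets_eq] by simp

lemma measurable_borel: "f \<in> borel_measurable borel \<Longrightarrow> f \<in> borel_measurable \<mu>"
  using measurable_cong_sets[OF sets_eq refl] by blast

lemma finite_poisson: "(\<integral>\<^sup>+t. ennreal (C * poisson \<i> t) \<partial>\<mu>) < \<infinity>"
proof -
  have "integrable \<mu> (\<lambda>t. C * poisson \<i> t)" using integrable_poisson[of \<i>] by simp
  then have "(\<integral>\<^sup>+t. ennreal (norm (C * poisson \<i> t)) \<partial>\<mu>) < \<infinity>" unfolding integrable_iff_bounded by blast
  moreover have "(\<integral>\<^sup>+t. ennreal (C * poisson \<i> t) \<partial>\<mu>) \<le> (\<integral>\<^sup>+t. ennreal (norm (C * poisson \<i> t)) \<partial>\<mu>)"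
    by (intro nn_integral_mono ennreal_leI) simp
  ultimately show ?thesis by (rule le_less_trans[rotated])
qed

lemma emeasure_finite: "emeasure \<mu> {- real n..real n} \<noteq> \<infinity>"
proof -
  have "emeasure \<mu> {- real n..real n} = (\<integral>\<^sup>+t. indicator {- real n..real n} t \<partial>\<mu>)"
    by (rule nn_integral_indicator[symmetric]) (simp add: sets_eq)
  also have "\<dots> \<le> (\<integral>\<^sup>+t. ennreal ((1 + (real n)\<^sup>2) * poisson \<i> t) \<partial>\<mu>)"
  proof (rule nn_integral_mono)
    fix t :: real
    show "indicator {- real n..real n} t \<le> ennreal ((1 + (real n)\<^sup>2) * poisson \<i> t)"
    proof (cases "t \<in> {- real n..real n}")
      case True
      have "1 + t\<^sup>2 > 0" by (simp add: add_pos_nonneg)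
      moreover have "t\<^sup>2 \<le> (real n)\<^sup>2" using True by (simp add: abs_le_square_iff[symmetric] abs_le_iff)
      ultimately have "1 \<le> (1 + (real n)\<^sup>2) * poisson \<i> t" by (simp add: poisson_eq add.commute pos_le_divide_eq)
      then show ?thesis using True by (simp add: ennreal_1[symmetric] del: ennreal_1)
    qed simp
  qed
  also have "\<dots> < \<infinity>" by (rule finite_poisson)
  finally show ?thesis by simp
qed

lemma sigma_finite: "sigma_finite_measure \<mu>"
proof
  show "\<exists>A. countable A \<and> A \<subseteq> sets \<mu> \<and> \<Union>A = space \<mu> \<and> (\<forall>a\<in>A. emeasure \<mu> a \<noteq> \<infinity>)"
  proof (intro exI conjI)
    show "countable (range (\<lambda>n. {- real n..real n}))" by simp
    show "range (\<lambda>n. {- real n..real n}) \<subseteq> sets \<mu>" by (auto simp: sets_eq)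
    show "\<Union>(range (\<lambda>n. {- real n..real n})) = space \<mu>"
    proof -
      have "\<exists>n. x \<in> {- real n..real n}" for x
      proof -
        obtain n where "\<bar>x\<bar> \<le> real n" using real_arch_simple by blast
        then have "x \<in> {- real n..real n}" by auto
        then show ?thesis by blast
      qed
      then show ?thesis by (auto simp: space_eq)
    qed
    show "\<forall>a\<in>range (\<lambda>n. {- real n..real n}). emeasure \<mu> a \<noteq> \<infinity>" using emeasure_finite by blast
  qed
qed

text \<open>
  Integrating the Poisson kernel in the other variable gives a difference of arctangents.
\<close>

lemma poisson_fubini:
  assumes "y > 0" "a \<le> b"
  shows "(\<integral>\<^sup>+x. ennreal (\<integral>t. poisson (Complex x y) t \<partial>\<mu>) * indicator {a..b} x \<partial>lborel)
     = (\<integral>\<^sup>+t. ennreal (arctan ((b - t) / y) - arctan ((a - t) / y)) \<partial>\<mu>)"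
proof -
  interpret sf: sigma_finite_measure \<mu> by (rule sigma_finite)
  interpret pair_sigma_finite lborel \<mu> ..
  have m: "(\<lambda>(x, t). ennreal (poisson (Complex x y) t) * indicator {a..b} x) \<in> borel_measurable (lborel \<Otimes>\<^sub>M \<mu>)"
  proof -
    have "(\<lambda>p :: real \<times> real. ennreal (y / ((snd p - fst p)\<^sup>2 + y\<^sup>2)) * indicator {a..b} (fst p)) \<in> borel_measurable (borel \<Otimes>\<^sub>M borel)"
      by measurable
    also have "borel_measurable (borel \<Otimes>\<^sub>M borel) = borel_measurable (lborel \<Otimes>\<^sub>M \<mu>)"
      by (intro measurable_cong_sets sets_pair_measure_cong) (simp_all add: sets_eq)
    finally show ?thesis by (simp add: poisson_eq case_prod_unfold)
  qed
  have i: "ennreal (\<integral>t. poisson (Complex x y) t \<partial>\<mu>) = (\<integral>\<^sup>+t. ennreal (poisson (Complex x y) t) \<partial>\<mu>)" for x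
    using assms integrable_poisson[of "Complex x y"] poisson_nonneg[of "Complex x y"] by (intro nn_integral_eq_integral[symmetric]) auto
  have pm: "(\<lambda>t. ennreal (poisson (Complex x y) t)) \<in> borel_measurable \<mu>" for x
    by (rule measurable_borel) measurable
  have "(\<integral>\<^sup>+x. ennreal (\<integral>t. poisson (Complex x y) t \<partial>\<mu>) * indicator {a..b} x \<partial>lborel)
     = (\<integral>\<^sup>+x. (\<integral>\<^sup>+t. ennreal (poisson (Complex x y) t) * indicator {a..b} x \<partial>\<mu>) \<partial>lborel)"
    unfolding i by (intro nn_integral_cong nn_integral_multc[symmetric] pm)
  also have "\<dots> = (\<integral>\<^sup>+t. (\<integral>\<^sup>+x. ennreal (poisson (Complex x y) t) * indicator {a..b} x \<partial>lborel) \<partial>\<mu>)"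
    using Fubini'[OF m] by simp
  also have "\<dots> = (\<integral>\<^sup>+t. ennreal (arctan ((b - t) / y) - arctan ((a - t) / y)) \<partial>\<mu>)"
    by (simp only: poisson_arctan[OF assms])
  finally show ?thesis .
qed

text \<open>
  Dominated convergence for the arctangents of \<open>arctan_box_limit\<close>.
\<close>

lemma stieltjes_inversion:
  assumes "a \<le> b"
  shows "(\<lambda>n. \<integral>\<^sup>+x. ennreal (\<integral>t. poisson (Complex x (1 / (real (Suc n))\<^sup>2)) t \<partial>\<mu>) * indicator {a - 1 / real (Suc n)..b + 1 / real (Suc n)} x \<partial>lborel)
     \<longlonglongrightarrow> ennreal pi * emeasure \<mu> {a..b}"
proof -
  define N where "N n = real (Suc n)" for n
  have N: "N n \<ge> 1" for n by (simp add: N_def)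
  define K where "K n t = arctan ((b + 1 / N n - t) / (1 / (N n)\<^sup>2)) - arctan ((a - 1 / N n - t) / (1 / (N n)\<^sup>2))" for n t
  define m where "m = \<bar>a\<bar> + \<bar>b\<bar> + 1"
  define C where "C = pi * (1 + (2 * m + 1)\<^sup>2) + 16 * m"
  have m0: "m > 0" by (simp add: m_def add_nonneg_pos)
  have y: "0 < 1 / (N n)\<^sup>2" "1 / (N n)\<^sup>2 \<le> 1" for n using N[of n] by (simp_all add: power2_eq_square mult_ge1_I divide_le_eq_1)
  have Kb: "K n t \<le> C * poisson \<i> t" for n t
  proof -
    have n1: "1 / N n \<le> 1" using N[of n] by simp
    have "K n t \<le> arctan ((m - t) / (1 / (N n)\<^sup>2)) - arctan ((- m - t) / (1 / (N n)\<^sup>2))"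
      unfolding K_def using n1 y[of n]
      by (intro diff_mono arctan_monotone' divide_right_mono) (auto simp: m_def)
    also have "\<dots> \<le> C * poisson \<i> t" unfolding C_def by (rule arctan_difference_bound[OF m0 y])
    finally show ?thesis .
  qed
  have "(\<lambda>n. \<integral>\<^sup>+t. ennreal (K n t) \<partial>\<mu>) \<longlonglongrightarrow> (\<integral>\<^sup>+t. ennreal pi * indicator {a..b} t \<partial>\<mu>)"
  proof (rule nn_integral_dominated_convergence[where w = "\<lambda>t. ennreal (C * poisson \<i> t)"])
    show "(\<lambda>t. ennreal (K n t)) \<in> borel_measurable \<mu>" for n unfolding K_def by (rule measurable_borel) measurable
    show "(\<lambda>t. ennreal pi * indicator {a..b} t) \<in> borel_measurable \<mu>" by (rule measurable_borel) measurable
    show "(\<lambda>t. ennreal (C * poisson \<i> t)) \<in> borel_measurable \<mu>" by (rule measurable_borel) measurable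
    show "AE t in \<mu>. ennreal (K n t) \<le> ennreal (C * poisson \<i> t)" for n by (intro AE_I2 ennreal_leI Kb)
    show "(\<integral>\<^sup>+t. ennreal (C * poisson \<i> t) \<partial>\<mu>) < \<infinity>" by (rule finite_poisson)
    show "AE t in \<mu>. (\<lambda>n. ennreal (K n t)) \<longlonglongrightarrow> ennreal pi * indicator {a..b} t"
    proof (rule AE_I2)
      fix t
      have "(\<lambda>n. ennreal (K n t)) \<longlonglongrightarrow> ennreal ((if t \<le> b then pi / 2 else - (pi / 2)) - (if a \<le> t then - (pi / 2) else pi / 2))"
        unfolding K_def N_def by (rule tendsto_ennrealI[OF arctan_box_limit])
      also have "ennreal ((if t \<le> b then pi / 2 else - (pi / 2)) - (if a \<le> t then - (pi / 2) else pi / 2)) = ennreal pi * indicator {a..b} t"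
        using assms by (auto simp: indicator_def)
      finally show "(\<lambda>n. ennreal (K n t)) \<longlonglongrightarrow> ennreal pi * indicator {a..b} t" .
    qed
  qed
  also have "(\<integral>\<^sup>+t. ennreal pi * indicator {a..b} t \<partial>\<mu>) = ennreal pi * emeasure \<mu> {a..b}"
    by (rule nn_integral_cmult_indicator) (simp add: sets_eq)
  also have "(\<lambda>n. \<integral>\<^sup>+t. ennreal (K n t) \<partial>\<mu>) = (\<lambda>n. \<integral>\<^sup>+x. ennreal (\<integral>t. poisson (Complex x (1 / (N n)\<^sup>2)) t \<partial>\<mu>) * indicator {a - 1 / N n..b + 1 / N n} x \<partial>lborel)"
  proof
    fix n
    have "0 \<le> 1 / N n" using N[of n] by simp
    then have "a - 1 / N n \<le> b + 1 / N n" using assms by linarith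
    from poisson_fubini[OF y(1) this, of n] show "(\<integral>\<^sup>+t. ennreal (K n t) \<partial>\<mu>) = (\<integral>\<^sup>+x. ennreal (\<integral>t. poisson (Complex x (1 / (N n)\<^sup>2)) t \<partial>\<mu>) * indicator {a - 1 / N n..b + 1 / N n} x \<partial>lborel)"
      unfolding K_def by (rule sym)
  qed
  finally show ?thesis unfolding N_def .
qed

end

text \<open>
  Closed intervals form a generator that is stable under intersections, and Stieltjes inversion
  recovers the measure of each of them.
\<close>

theorem poisson_unique:
  assumes \<mu>: "poisson_integrable \<mu>" and \<nu>: "poisson_integrable \<nu>"
    and eq: "\<And>z. Im z > 0 \<Longrightarrow> (\<integral>t. poisson z t \<partial>\<mu>) = (\<integral>t. poisson z t \<partial>\<nu>)"
  shows "\<mu> = \<nu>"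
proof -
  interpret m: poisson_integrable \<mu> by (rule \<mu>)
  interpret n: poisson_integrable \<nu> by (rule \<nu>)
  have box: "emeasure \<mu> {a..b} = emeasure \<nu> {a..b}" for a b
  proof (cases "a \<le> b")
    case True
    have e: "(\<integral>t. poisson (Complex x (1 / (real (Suc n))\<^sup>2)) t \<partial>\<mu>) = (\<integral>t. poisson (Complex x (1 / (real (Suc n))\<^sup>2)) t \<partial>\<nu>)" for x n
      by (rule eq) (simp del: of_nat_Suc)
    have "ennreal pi * emeasure \<mu> {a..b} = ennreal pi * emeasure \<nu> {a..b}"
      by (rule LIMSEQ_unique[OF m.stieltjes_inversion[OF True, unfolded e] n.stieltjes_inversion[OF True]])
    then show ?thesis by (simp add: ennreal_mult_cancel_left)
  qed simp
  show ?thesis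
  proof (rule measure_eqI_generator_eq[where E = "range (\<lambda>(a, b). {a..b :: real})" and \<Omega> = UNIV and A = "\<lambda>n. {- real n..real n}"])
    have "{a..b} \<inter> {c..d} = {max a c..min b d}" for a b c d :: real by auto
    then have inter: "(\<lambda>(a, b). {a..b :: real}) p \<inter> (\<lambda>(a, b). {a..b :: real}) q \<in> range (\<lambda>(a, b). {a..b :: real})" for p q
      by (intro image_eqI[of _ _ "(max (fst p) (fst q), min (snd p) (snd q))"]) (simp_all add: case_prod_unfold)
    show "Int_stable (range (\<lambda>(a, b). {a..b :: real}))"
    proof (rule Int_stableI)
      fix A B assume "A \<in> range (\<lambda>(a, b). {a..b :: real})" "B \<in> range (\<lambda>(a, b). {a..b :: real})"
      then obtain p q where "A = (\<lambda>(a, b). {a..b}) p" "B = (\<lambda>(a, b). {a..b}) q" by (elim rangeE)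
      then show "A \<inter> B \<in> range (\<lambda>(a, b). {a..b :: real})" using inter[of p q] by (simp only:)
    qed
    show "sets \<mu> = sigma_sets UNIV (range (\<lambda>(a, b). {a..b :: real}))" "sets \<nu> = sigma_sets UNIV (range (\<lambda>(a, b). {a..b :: real}))"
      unfolding m.sets_eq n.sets_eq by (subst borel_eq_atLeastAtMost, simp)+
    show "emeasure \<mu> X = emeasure \<nu> X" if "X \<in> range (\<lambda>(a, b). {a..b})" for X using that by (elim rangeE) (simp add: box case_prod_unfold)
    show "emeasure \<mu> {- real i..real i} \<noteq> \<infinity>" for i by (rule m.emeasure_finite)
    show "(\<Union>i. {- real i..real i}) = UNIV"
    proof -
      have "\<exists>n. x \<in> {- real n..real n}" for x
      proof -
        obtain n where "\<bar>x\<bar> \<le> real n" using real_arch_simple by blast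
        then have "x \<in> {- real n..real n}" by auto
        then show ?thesis by blast
      qed
      then show ?thesis by auto
    qed
  qed auto
qed

section \<open>Summable parameters give strict Schur functions\<close>

text \<open>
  The Schur function is only specified in the open disc, hence the agreement with a function whose
  series converges on the closed disc.
\<close>

definition schur_wiener :: "(nat \<Rightarrow> complex) \<Rightarrow> real \<Rightarrow> bool" where
  "schur_wiener \<gamma> C \<longleftrightarrow> (\<exists>f. disc.wiener f C \<and> (\<forall>\<zeta>\<in>ball 0 1. f \<zeta> = schur_of \<gamma> \<zeta>))"

text \<open>
  Each step multiplies the norms by at most \<open>1 + \<bar>\<gamma>\<^sub>n\<bar> \<le> exp \<bar>\<gamma>\<^sub>n\<bar>\<close>.
\<close>

lemma schur_state_wiener:
  assumes "norm x0 \<le> 1" "norm y0 \<le> 1"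
  shows "disc.wiener (\<lambda>\<zeta>. fst (schur_state \<gamma> \<zeta> (x0, y0) n)) (exp (\<Sum>k<n. norm (\<gamma> k))) \<and>
      disc.wiener (\<lambda>\<zeta>. snd (schur_state \<gamma> \<zeta> (x0, y0) n)) (exp (\<Sum>k<n. norm (\<gamma> k)))"
proof (induction n)
  case 0
  then show ?case using disc.wiener_mono[OF disc.wiener_const assms(1)] disc.wiener_mono[OF disc.wiener_const assms(2)] by simp
next
  case (Suc n)
  define E where "E = exp (\<Sum>k<n. norm (\<gamma> k))"
  have E: "E * (1 + norm (\<gamma> n)) \<le> exp (\<Sum>k<Suc n. norm (\<gamma> k))"
    unfolding E_def sum.lessThan_Suc exp_add by (intro mult_left_mono exp_ge_add_one_self) simp
  have v: "disc.wiener (\<lambda>\<zeta>. fst (schur_state \<gamma> \<zeta> (x0, y0) n)) E"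
    and u: "disc.wiener (\<lambda>\<zeta>. snd (schur_state \<gamma> \<zeta> (x0, y0) n)) E"
    using Suc by (simp_all add: E_def)
  have 1: "disc.wiener (\<lambda>\<zeta>. fst (schur_state \<gamma> \<zeta> (x0, y0) n) + \<gamma> n * snd (schur_state \<gamma> \<zeta> (x0, y0) n)) (E + norm (\<gamma> n) * E)"
    by (intro disc.wiener_add disc.wiener_scale v u)
  have "disc.wiener (\<lambda>\<zeta>. snd (schur_state \<gamma> \<zeta> (x0, y0) n) + cnj (\<gamma> n) * fst (schur_state \<gamma> \<zeta> (x0, y0) n)) (E + norm (cnj (\<gamma> n)) * E)"
    by (intro disc.wiener_add disc.wiener_scale v u)
  from disc.wiener_mult[OF disc.wiener_char[of 1] this]
  have 2: "disc.wiener (\<lambda>\<zeta>. \<zeta> * (snd (schur_state \<gamma> \<zeta> (x0, y0) n) + cnj (\<gamma> n) * fst (schur_state \<gamma> \<zeta> (x0, y0) n))) (E + norm (\<gamma> n) * E)"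
    by simp
  have e: "E + norm (\<gamma> n) * E = E * (1 + norm (\<gamma> n))" by (simp add: algebra_simps)
  show ?case unfolding schur_state.simps fst_conv snd_conv
    using disc.wiener_mono[OF 1[unfolded e] E] disc.wiener_mono[OF 2[unfolded e] E] by blast
qed

text \<open>
  By \<open>schur_state_wiener\<close> all states have norm at most \<open>2\<close>, so the increments of the first component sum
  to at most \<open>2 / 8\<close>.
\<close>

lemma schur_state_limit:
  assumes s: "summable (\<lambda>k. norm (\<gamma> k))" and S: "(\<Sum>k. norm (\<gamma> k)) \<le> 1 / 8"
    and "norm x0 \<le> 1" "norm y0 \<le> 1"
  shows "\<exists>D. disc.wiener D (1 / 4) \<and> (\<forall>\<zeta>\<in>cball 0 1. (\<lambda>n. fst (schur_state \<gamma> \<zeta> (x0, y0) n)) \<longlonglongrightarrow> x0 + D \<zeta>)"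
proof -
  define t where "t n \<zeta> = \<gamma> n * snd (schur_state \<gamma> \<zeta> (x0, y0) n)" for n \<zeta>
  define D where "D \<zeta> = (\<Sum>n. t n \<zeta>)" for \<zeta>
  have "exp (\<Sum>k<n. norm (\<gamma> k)) \<le> 2" for n
  proof -
    have "(\<Sum>k<n. norm (\<gamma> k)) \<le> 1 / 8" using sum_le_suminf[OF s, of "{..<n}"] S by simp
    then have "exp (\<Sum>k<n. norm (\<gamma> k)) \<le> exp (1 / 2)" by simp
    also have "\<dots> \<le> 2" using exp_half_le2 by simp
    finally show ?thesis .
  qed
  then have "disc.wiener (\<lambda>\<zeta>. snd (schur_state \<gamma> \<zeta> (x0, y0) n)) 2" for n
    using schur_state_wiener[OF assms(3,4), of \<gamma> n] disc.wiener_mono by blast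
  then have t: "disc.wiener (t n) (norm (\<gamma> n) * 2)" for n unfolding t_def by (rule disc.wiener_scale)
  have s2: "summable (\<lambda>n. norm (\<gamma> n) * 2)" using s by (rule summable_mult2)
  have "disc.wiener D (\<Sum>n. norm (\<gamma> n) * 2)" by (rule disc.wiener_suminf[OF t s2]) (simp add: D_def)
  moreover have "(\<Sum>n. norm (\<gamma> n) * 2) \<le> 1 / 4" using suminf_mult2[OF s, of 2] S by simp
  ultimately have D: "disc.wiener D (1 / 4)" by (rule disc.wiener_mono)
  have "(\<lambda>n. fst (schur_state \<gamma> \<zeta> (x0, y0) n)) \<longlonglongrightarrow> x0 + D \<zeta>" if z: "\<zeta> \<in> cball 0 1" for \<zeta>
  proof -
    have "summable (\<lambda>n. norm (t n \<zeta>))"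
      using disc.wiener_norm_le[OF t z] by (intro summable_comparison_test'[OF s2]) simp
    then have "(\<lambda>n. t n \<zeta>) sums D \<zeta>" unfolding D_def by (rule summable_sums[OF summable_norm_cancel])
    then have "(\<lambda>n. x0 + (\<Sum>k<n. t k \<zeta>)) \<longlonglongrightarrow> x0 + D \<zeta>" unfolding sums_def by (intro tendsto_intros)
    moreover have "x0 + (\<Sum>k<n. t k \<zeta>) = fst (schur_state \<gamma> \<zeta> (x0, y0) n)" for n
      by (induction n) (simp_all add: t_def add.assoc[symmetric])
    ultimately show ?thesis by simp
  qed
  with D show ?thesis by blast
qed

definition strict_schur_wiener :: "(nat \<Rightarrow> complex) \<Rightarrow> bool" where
  "strict_schur_wiener \<gamma> \<longleftrightarrow> (\<exists>f C r. disc.wiener f C \<and> r < 1 \<and> (\<forall>\<zeta>\<in>cball 0 1. norm (f \<zeta>) \<le> r) \<and>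
      (\<forall>\<zeta>\<in>ball 0 1. f \<zeta> = schur_of \<gamma> \<zeta>))"

text \<open>
  For small parameters the limit of the denominators \<open>wall_A\<close> differs from \<open>1\<close> by at most \<open>1 / 4\<close> in norm
  and is inverted by a Neumann series; the quotient has norm at most \<open>(1 / 4) / (3 / 4)\<close>.
\<close>

lemma small_tail_strict:
  assumes \<gamma>: "schur_parameters \<gamma>" and s: "summable (\<lambda>k. norm (\<gamma> k))" and S: "(\<Sum>k. norm (\<gamma> k)) \<le> 1 / 8"
  shows "strict_schur_wiener \<gamma>"
proof -
  interpret schur_parameters \<gamma> by (rule \<gamma>)
  obtain D where D: "disc.wiener D (1 / 4)" "\<And>\<zeta>. \<zeta> \<in> cball 0 1 \<Longrightarrow> (\<lambda>n. wall_A \<gamma> \<zeta> n) \<longlonglongrightarrow> 1 + D \<zeta>"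
    using schur_state_limit[OF s S, of 1 0] unfolding wall_A_def by auto
  obtain B where B: "disc.wiener B (1 / 4)" "\<And>\<zeta>. \<zeta> \<in> cball 0 1 \<Longrightarrow> (\<lambda>n. wall_B \<gamma> \<zeta> n) \<longlonglongrightarrow> B \<zeta>"
    using schur_state_limit[OF s S, of 0 1] unfolding wall_B_def by auto
  have inv: "disc.wiener (\<lambda>\<zeta>. 1 / (1 - - D \<zeta>)) (1 / (1 - 1 / 4))"
    by (rule disc.wiener_geometric[OF disc.wiener_minus[OF D(1)]]) simp
  define f where "f \<zeta> = B \<zeta> * (1 / (1 - - D \<zeta>))" for \<zeta>
  have f: "disc.wiener f (1 / 4 * (1 / (1 - 1 / 4)))" unfolding f_def by (rule disc.wiener_mult[OF B(1) inv])
  have "f \<zeta> = schur_of \<gamma> \<zeta>" if z: "\<zeta> \<in> ball 0 1" for \<zeta>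
  proof -
    have zc: "\<zeta> \<in> cball 0 1" "norm \<zeta> < 1" using z by simp_all
    have "norm (D \<zeta>) \<le> 1 / 4" by (rule disc.wiener_norm_le[OF D(1) zc(1)])
    then have "1 + D \<zeta> \<noteq> 0" by (auto simp: add_eq_0_iff)
    then have "(\<lambda>n. approx n \<zeta>) \<longlonglongrightarrow> B \<zeta> / (1 + D \<zeta>)"
      unfolding approx_def by (intro tendsto_divide D B zc)
    from LIMSEQ_unique[OF this approx_tendsto[OF zc(2)]] show ?thesis by (simp add: f_def)
  qed
  then show ?thesis unfolding strict_schur_wiener_def
    using f disc.wiener_norm_le[OF f] by (intro exI[of _ f] exI[of _ "1 / 4 * (1 / (1 - 1 / 4))"]) auto
qed

text \<open>
  The quantitative form of \<open>norm_moebius_less\<close>: the denominator has modulus at most \<open>2\<close>.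
\<close>

lemma strict_moebius_bound:
  fixes g w :: complex
  assumes g: "norm g < 1" and w: "norm w \<le> r" "r < 1"
  shows "norm ((g + w) / (1 + cnj g * w)) \<le> sqrt (1 - (1 - (norm g)\<^sup>2) * (1 - r\<^sup>2) / 4)"
proof -
  have r0: "0 \<le> r" using w norm_ge_zero order_trans by blast
  define d where "d = (norm (1 + cnj g * w))\<^sup>2"
  have ne: "1 + cnj g * w \<noteq> 0" by (rule moebius_denominator[OF g]) (use w in simp)
  have d0: "d > 0" using ne by (simp add: d_def)
  have "norm (1 + cnj g * w) \<le> 1 + norm (cnj g * w)" using norm_triangle_ineq[of 1 "cnj g * w"] by simp
  also have "\<dots> \<le> 2" using g w by (simp add: norm_mult mult_le_one)
  finally have "d \<le> 2\<^sup>2" unfolding d_def by (intro power_mono) simp_all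
  then have d4: "d \<le> 4" by simp
  have g2: "0 < 1 - (norm g)\<^sup>2" using g by (simp add: abs_square_less_1)
  have r2: "0 < 1 - r\<^sup>2" using w r0 by (simp add: abs_square_less_1)
  have "(norm w)\<^sup>2 \<le> r\<^sup>2" using w by (intro power_mono) simp_all
  then have p: "(1 - (norm g)\<^sup>2) * (1 - r\<^sup>2) \<le> (1 - (norm g)\<^sup>2) * (1 - (norm w)\<^sup>2)"
    using g2 by (intro mult_left_mono) simp_all
  have "d - (norm (g + w))\<^sup>2 = (1 - (norm g)\<^sup>2) * (1 - (norm w)\<^sup>2)"
    unfolding d_def using blaschke_identity[of 1 "cnj g" w] by (simp only: complex_cnj_cnj mult_1_right norm_one power_one complex_mod_cnj)
  then have "(norm (g + w))\<^sup>2 \<le> d - (1 - (norm g)\<^sup>2) * (1 - r\<^sup>2)" using p by linarith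
  then have "(norm (g + w))\<^sup>2 / d \<le> (d - (1 - (norm g)\<^sup>2) * (1 - r\<^sup>2)) / d" using d0 by (intro divide_right_mono) simp_all
  also have "\<dots> = 1 - (1 - (norm g)\<^sup>2) * (1 - r\<^sup>2) / d" using d0 by (simp add: diff_divide_distrib)
  also have "\<dots> \<le> 1 - (1 - (norm g)\<^sup>2) * (1 - r\<^sup>2) / 4"
    using d4 d0 g2 r2 by (intro diff_left_mono divide_left_mono) simp_all
  finally have "(norm ((g + w) / (1 + cnj g * w)))\<^sup>2 \<le> 1 - (1 - (norm g)\<^sup>2) * (1 - r\<^sup>2) / 4"
    by (simp add: norm_divide power_divide d_def)
  then show ?thesis by (rule real_le_rsqrt)
qed

lemma strict_schur_wiener_step:
  assumes \<gamma>: "schur_parameters \<gamma>" and st: "strict_schur_wiener (\<lambda>k. \<gamma> (Suc k))"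
  shows "strict_schur_wiener \<gamma>"
proof -
  interpret schur_parameters \<gamma> by (rule \<gamma>)
  obtain h C r where h: "disc.wiener h C" "r < 1" "\<And>\<zeta>. \<zeta> \<in> cball 0 1 \<Longrightarrow> norm (h \<zeta>) \<le> r"
    "\<And>\<zeta>. \<zeta> \<in> ball 0 1 \<Longrightarrow> h \<zeta> = schur_of (\<lambda>k. \<gamma> (Suc k)) \<zeta>" using st unfolding strict_schur_wiener_def by blast
  define g where "g = \<gamma> 0"
  have g: "norm g < 1" using norm_less_1 by (simp add: g_def)
  have r0: "0 \<le> r" by (rule order_trans[OF norm_ge_zero h(3)[of 0]]) simp
  define w where "w \<zeta> = \<zeta> * h \<zeta>" for \<zeta>
  have ww: "disc.wiener w C" using disc.wiener_mult[OF disc.wiener_char[of 1] h(1)] by (simp add: w_def[abs_def])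
  have wb: "norm (w \<zeta>) \<le> r" if "\<zeta> \<in> cball 0 1" for \<zeta>
    using that h(3)[OF that] mult_mono[of "norm \<zeta>" 1 "norm (h \<zeta>)" r] by (simp add: w_def norm_mult)
  have "norm (- cnj g * w \<zeta>) \<le> norm g" if "\<zeta> \<in> cball 0 1" for \<zeta>
    using wb[OF that] h(2) by (simp add: norm_mult mult_left_le)
  from disc.wiener_inverse_one_minus[OF disc.wiener_scale[OF ww] this g]
  obtain D where D: "disc.wiener (\<lambda>\<zeta>. 1 / (1 - - cnj g * w \<zeta>)) D" by auto
  define f where "f \<zeta> = (g + w \<zeta>) * (1 / (1 - - cnj g * w \<zeta>))" for \<zeta>
  have f: "disc.wiener f ((norm g + C) * D)"
    unfolding f_def by (intro disc.wiener_mult disc.wiener_add disc.wiener_const ww D)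
  have feq: "f \<zeta> = (g + w \<zeta>) / (1 + cnj g * w \<zeta>)" for \<zeta> by (simp add: f_def)
  define \<rho> where "\<rho> = sqrt (1 - (1 - (norm g)\<^sup>2) * (1 - r\<^sup>2) / 4)"
  have "0 < (1 - (norm g)\<^sup>2) * (1 - r\<^sup>2)" using g h(2) r0 by (intro mult_pos_pos) (simp_all add: abs_square_less_1)
  then have "\<rho> < sqrt 1" unfolding \<rho>_def by (intro real_sqrt_less_mono) simp
  then have "\<rho> < 1" by simp
  moreover have "norm (f \<zeta>) \<le> \<rho>" if "\<zeta> \<in> cball 0 1" for \<zeta>
    unfolding feq \<rho>_def by (rule strict_moebius_bound[OF g wb[OF that] h(2)])
  moreover have "f \<zeta> = schur_of \<gamma> \<zeta>" if "\<zeta> \<in> ball 0 1" for \<zeta>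
    using that schur_fun_step[of \<zeta>] h(4)[OF that] by (simp add: feq w_def g_def)
  ultimately show ?thesis using f unfolding strict_schur_wiener_def by blast
qed

text \<open>
  Drop finitely many parameters to make the remaining sum small, then put them back one at a time.
\<close>

theorem summable_imp_strict_schur_wiener:
  assumes \<gamma>: "schur_parameters \<gamma>" and s: "summable (\<lambda>k. norm (\<gamma> k))"
  shows "strict_schur_wiener \<gamma>"
proof -
  have sh: "schur_parameters (\<lambda>k. \<gamma> (k + n))" for n using \<gamma> by (simp add: schur_parameters_def)
  have "(\<lambda>n. \<Sum>k. norm (\<gamma> (k + n))) \<longlonglongrightarrow> 0" by (rule suminf_exist_split2[OF s])
  then have "eventually (\<lambda>n. (\<Sum>k. norm (\<gamma> (k + n))) < 1 / 8) sequentially" by (rule order_tendstoD) simp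
  then obtain N where N: "(\<Sum>k. norm (\<gamma> (k + N))) < 1 / 8" by (auto simp: eventually_sequentially)
  have "summable (\<lambda>k. norm (\<gamma> (k + N)))" using s by (subst summable_iff_shift)
  then have base: "strict_schur_wiener (\<lambda>k. \<gamma> (k + N))" using N by (intro small_tail_strict sh) simp_all
  have "strict_schur_wiener (\<lambda>k. \<gamma> (k + (N - m)))" if "m \<le> N" for m
    using that
  proof (induction m)
    case 0
    then show ?case using base by simp
  next
    case (Suc m)
    have e: "(\<lambda>k. \<gamma> (Suc k + (N - Suc m))) = (\<lambda>k. \<gamma> (k + (N - m)))" using Suc.prems by (intro ext arg_cong[where f = \<gamma>]) simp
    have "strict_schur_wiener (\<lambda>k. \<gamma> (Suc k + (N - Suc m)))" unfolding e using Suc by simp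
    then show ?case by (rule strict_schur_wiener_step[OF sh])
  qed
  from this[of N] show ?thesis by simp
qed

section \<open>Strict Schur functions have summable parameters\<close>

text \<open>
  Reflecting the negative frequencies: \<open>cnj u\<^sub>2\<close> and \<open>u\<^sub>2\<close> have the same real part.
\<close>

lemma real_part_of_disc:
  assumes "circle.wiener g D"
  shows "\<exists>u C. disc.wiener u C \<and> (\<forall>x. norm x = 1 \<longrightarrow> Re (u x) = Re (g x))"
proof -
  obtain d where d: "(\<lambda>k. norm (d k)) summable_on UNIV" "\<And>x. norm x = 1 \<Longrightarrow> g x = (\<Sum>\<^sub>\<infinity>k. d k * x powi k)"
    using assms by (auto simp: circle.wiener_def circle.expansion_def)
  have bij1: "bij_betw int UNIV {0..}" by (rule bij_betwI[where g = nat]) auto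
  have bij2: "bij_betw (\<lambda>n. - int (Suc n)) UNIV {..<0}" by (rule bij_betwI[where g = "\<lambda>k. nat (- k - 1)"]) auto
  define u1 where "u1 x = (\<Sum>\<^sub>\<infinity>n. d (int n) * x ^ n)" for x
  define u2 where "u2 x = (\<Sum>\<^sub>\<infinity>n. cnj (d (- int (Suc n))) * x ^ Suc n)" for x
  have s1: "(\<lambda>n. norm (d (int n))) summable_on UNIV"
    using summable_on_reindex_bij_betw[OF bij1, of "\<lambda>k. norm (d k)"] summable_on_subset_banach[OF d(1)] by auto
  have s2: "(\<lambda>n. norm (cnj (d (- int (Suc n))))) summable_on UNIV"
    using summable_on_reindex_bij_betw[OF bij2, of "\<lambda>k. norm (d k)"] summable_on_subset_banach[OF d(1)] by auto
  have w1: "disc.wiener u1 (\<Sum>\<^sub>\<infinity>n. norm (d (int n)))"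
    by (rule disc.wiener_regroup[OF s1, where e = "\<lambda>n. n"]) (simp add: u1_def)
  have w2: "disc.wiener u2 (\<Sum>\<^sub>\<infinity>n. norm (cnj (d (- int (Suc n)))))"
    by (rule disc.wiener_regroup[OF s2, where e = Suc]) (simp add: u2_def)
  have "g x = u1 x + cnj (u2 x)" if x: "norm x = 1" for x
  proof -
    have xs: "x \<in> sphere 0 1" using x by simp
    have cx: "cnj (x powi k) = x powi (- k)" for k
    proof -
      have "norm (x powi k) = 1" using x by (simp add: norm_power_int)
      then show ?thesis using cnj_eq_inverse[of "x powi k"] by (simp add: power_int_minus)
    qed
    note sx = circle.summable_char[OF d(1) xs, of id, simplified]
    have "g x = (\<Sum>\<^sub>\<infinity>k\<in>{0..} \<union> {..<0}. d k * x powi k)"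
      unfolding d(2)[OF x] by (rule infsum_cong_neutral) auto
    also have "\<dots> = (\<Sum>\<^sub>\<infinity>k\<in>{0..}. d k * x powi k) + (\<Sum>\<^sub>\<infinity>k\<in>{..<0}. d k * x powi k)"
      by (rule infsum_Un_disjoint) (auto intro: summable_on_subset_banach[OF sx])
    also have "(\<Sum>\<^sub>\<infinity>k\<in>{0..}. d k * x powi k) = u1 x"
      using infsum_reindex_bij_betw[OF bij1, of "\<lambda>k. d k * x powi k"] by (simp add: u1_def)
    also have "(\<Sum>\<^sub>\<infinity>k\<in>{..<0}. d k * x powi k) = (\<Sum>\<^sub>\<infinity>n. d (- int (Suc n)) * x powi (- int (Suc n)))"
      using infsum_reindex_bij_betw[OF bij2, of "\<lambda>k. d k * x powi k"] by simp
    also have "\<dots> = (\<Sum>\<^sub>\<infinity>n. cnj (cnj (d (- int (Suc n))) * x ^ Suc n))"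
    proof (rule infsum_cong)
      fix n
      have "cnj (x ^ Suc n) = x powi (- int (Suc n))" using cx[of "int (Suc n)"] by (simp only: power_int_of_nat)
      then show "d (- int (Suc n)) * x powi (- int (Suc n)) = cnj (cnj (d (- int (Suc n))) * x ^ Suc n)"
        by (simp only: complex_cnj_mult complex_cnj_cnj)
    qed
    also have "\<dots> = cnj (u2 x)" unfolding u2_def by (rule infsum_cnj)
    finally show ?thesis .
  qed
  then have "Re (u1 x + u2 x) = Re (g x)" if "norm x = 1" for x using that by simp
  note re = this
  show ?thesis
  proof (rule exI[of _ "\<lambda>x. u1 x + u2 x"], rule exI, rule conjI)
    show "disc.wiener (\<lambda>x. u1 x + u2 x) ((\<Sum>\<^sub>\<infinity>n. norm (d (int n))) + (\<Sum>\<^sub>\<infinity>n. norm (cnj (d (- int (Suc n))))))"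
      by (rule disc.wiener_add[OF w1 w2])
    show "\<forall>x. norm x = 1 \<longrightarrow> Re (u1 x + u2 x) = Re (g x)" using re by blast
  qed
qed

text \<open>
  On the circle \<open>\<bar>f\<bar>\<^sup>2\<close> has sup norm below \<open>1\<close>, so \<open>ln (1 - \<bar>f\<bar>\<^sup>2)\<close> lies in the Wiener algebra. It is the real
  part of an analytic \<open>u\<close>, and \<open>exp (u / 2)\<close>, \<open>exp (- u / 2)\<close> are the factor and its inverse.
\<close>

lemma spectral_factor:
  assumes f: "disc.wiener f C" and "r < 1" "\<forall>x. norm x \<le> 1 \<longrightarrow> norm (f x) \<le> r"
  shows "\<exists>a b Ca Cb. disc.wiener a Ca \<and> disc.wiener b Cb \<and> (\<forall>x. a x * b x = 1) \<and>
    (\<forall>x. norm x = 1 \<longrightarrow> a x * cnj (a x) = 1 - f x * cnj (f x))"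
proof -
  have r: "r < 1" "\<And>x. norm x \<le> 1 \<Longrightarrow> norm (f x) \<le> r" using assms by simp_all
  have r0: "0 \<le> r" by (rule order_trans[OF norm_ge_zero r(2)[of 0]]) simp
  define e where "e x = f x * cnj (f x)" for x
  have fc: "circle.wiener f C" by (rule circle_wiener_of_disc[OF f])
  have we: "circle.wiener e (C * C)" unfolding e_def by (intro circle.wiener_mult circle_wiener_cnj fc)
  have er: "e x = of_real ((norm (f x))\<^sup>2)" for x by (simp only: e_def complex_norm_square)
  have r2: "r * r < 1" using r r0 mult_strict_mono[of r 1 r 1] by (cases "r = 0") auto
  have eb: "norm (e x) \<le> r * r" if "norm x \<le> 1" for x
    using r(2)[OF that] r0 by (simp add: e_def norm_mult mult_mono)
  have fb: "0 < 1 - (norm (f x))\<^sup>2" if "norm x \<le> 1" for x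
    using r(2)[OF that] r0 mult_mono[of "norm (f x)" r "norm (f x)" r] r2 by (simp add: power2_eq_square)
  \<comment> \<open>the logarithmic series; its coefficient at \<open>n = 0\<close> is \<open>0\<close> because \<open>1 / 0 = 0\<close>\<close>
  have "\<exists>D. circle.wiener (\<lambda>x. \<Sum>n. (- (1 / of_nat n)) * e x ^ n) D"
  proof (rule circle.wiener_power_series[OF we _ r2])
    show "norm (e x) \<le> r * r" if "x \<in> sphere 0 1" for x using eb that by simp
    show "norm (- (1 / of_nat n) :: complex) \<le> 1" for n by (cases n) (simp_all add: norm_divide del: of_nat_Suc)
  qed simp
  then obtain D where D: "circle.wiener (\<lambda>x. \<Sum>n. (- (1 / of_nat n)) * e x ^ n) D" ..
  have L: "(\<Sum>n. (- (1 / of_nat n)) * e x ^ n) = of_real (ln (1 - (norm (f x))\<^sup>2))" if x: "norm x \<le> 1" for x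
  proof -
    have n1: "norm (- e x) < 1" using eb[OF x] r2 by simp
    note p = fb[OF x]
    have "(- (1 / of_nat n)) * e x ^ n = (- 1) ^ Suc n / of_nat n * (- e x) ^ n" for n
    proof -
      have "(- 1) ^ Suc n * (- e x) ^ n = - (e x ^ n)" using power_mult_distrib[of "- 1" "- e x" n] by simp
      then show ?thesis by (simp only: times_divide_eq_left) simp
    qed
    then have eqf: "(\<lambda>n. (- (1 / of_nat n)) * e x ^ n) = (\<lambda>n. (- 1) ^ Suc n / of_nat n * (- e x) ^ n)" by (rule ext)
    have arg: "1 + - e x = of_real (1 - (norm (f x))\<^sup>2)" by (simp add: er)
    have "(\<lambda>n. (- (1 / of_nat n)) * e x ^ n) sums ln (1 + - e x)" unfolding eqf by (rule Ln_series[OF n1])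
    then have "(\<lambda>n. (- (1 / of_nat n)) * e x ^ n) sums of_real (ln (1 - (norm (f x))\<^sup>2))"
      unfolding arg using Ln_of_real[OF p] by (simp only:)
    then show ?thesis by (rule sums_unique[symmetric])
  qed
  obtain u Cu where u: "disc.wiener u Cu" and u2: "\<forall>x. norm x = 1 \<longrightarrow> Re (u x) = Re (\<Sum>n. (- (1 / of_nat n)) * e x ^ n)"
    using real_part_of_disc[OF D] by (elim exE conjE)
  define a where "a x = exp ((1 / 2) * u x)" for x
  define b where "b x = exp (- (1 / 2) * u x)" for x
  show ?thesis
  proof (rule exI[of _ a], rule exI[of _ b], rule exI, rule exI, intro conjI allI impI)
    show "disc.wiener a (exp (norm (1 / 2 :: complex) * Cu))" unfolding a_def by (rule disc.wiener_exp[OF disc.wiener_scale[OF u]])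
    show "disc.wiener b (exp (norm (- (1 / 2) :: complex) * Cu))" unfolding b_def by (rule disc.wiener_exp[OF disc.wiener_scale[OF u]])
    show "a x * b x = 1" for x by (simp add: a_def b_def exp_minus_inverse flip: exp_add)
    fix x :: complex assume x: "norm x = 1"
    have p: "0 < 1 - (norm (f x))\<^sup>2" using fb[of x] x by simp
    have "(norm (a x))\<^sup>2 = exp (Re (u x))" by (simp add: a_def power2_eq_square flip: exp_add)
    also have "\<dots> = 1 - (norm (f x))\<^sup>2" using u2[rule_format, OF x] L[of x] x p by simp
    finally have "complex_of_real ((norm (a x))\<^sup>2) = of_real (1 - (norm (f x))\<^sup>2)" by simp
    then show "a x * cnj (a x) = 1 - f x * cnj (f x)" by (simp only: complex_norm_square of_real_diff of_real_1)
  qed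
qed

lemma continuous_eq_off_0:
  fixes F G :: "complex \<Rightarrow> complex"
  assumes "continuous_on (ball 0 1) F" "continuous_on (ball 0 1) G"
    and eq: "\<And>x. norm x < 1 \<Longrightarrow> x \<noteq> 0 \<Longrightarrow> F x = G x" and x: "norm x < 1"
  shows "F x = G x"
proof (cases "x = 0")
  case True
  have F: "(F \<longlongrightarrow> F 0) (at 0)" and G: "(G \<longlongrightarrow> G 0) (at 0)"
    using assms(1,2) by (simp_all add: continuous_on_eq_continuous_at isCont_def)
  have "eventually (\<lambda>y. y \<in> ball 0 1 - {0}) (at (0::complex))"
    by (intro eventually_at_in_open) auto
  then have "eventually (\<lambda>y. F y = G y) (at 0)" by eventually_elim (use eq in auto)
  then have "(G \<longlongrightarrow> F 0) (at 0)" using F by (rule Lim_transform_eventually[rotated])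
  from LIM_unique[OF this G] show ?thesis using True by simp
qed (use eq x in blast)

context schur_parameters
begin

lemma schur_fun_continuous: "continuous_on (ball 0 1) schur_fun"
  by (rule holomorphic_on_imp_continuous_on[OF schur_fun_holomorphic])

lemma schur_inverse_step:
  assumes "norm \<zeta> < 1"
  shows "\<zeta> * schur_of (\<lambda>k. \<gamma> (Suc k)) \<zeta> * (1 - cnj (\<gamma> 0) * schur_fun \<zeta>) = schur_fun \<zeta> - \<gamma> 0"
proof -
  interpret s: schur_parameters "\<lambda>k. \<gamma> (Suc k)" by (rule parameters_shift)
  define w where "w = \<zeta> * s.schur_fun \<zeta>"
  have "norm w \<le> 1" unfolding w_def using s.norm_schur_fun_le[OF assms] assms by (simp add: norm_mult mult_le_one)
  then have ne: "1 + cnj (\<gamma> 0) * w \<noteq> 0" by (rule moebius_denominator[OF norm_less_1])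
  have F: "schur_fun \<zeta> = (\<gamma> 0 + w) / (1 + cnj (\<gamma> 0) * w)" using schur_fun_step[OF assms] by (simp only: w_def)
  have "w * (1 - cnj (\<gamma> 0) * schur_fun \<zeta>) = schur_fun \<zeta> - \<gamma> 0"
    unfolding F using ne by (simp add: divide_simps) (simp add: algebra_simps)
  then show ?thesis by (simp only: w_def)
qed

end

lemma schur_parameters_shift: "schur_parameters \<gamma> \<Longrightarrow> schur_parameters (\<lambda>k. \<gamma> (k + n))"
  by (simp add: schur_parameters_def)

text \<open>
  Running the Schur algorithm on the pair \<open>(1, f)\<close> without dividing by the first component gives
  \<open>(X, Y)\<close>, and \<open>Y / X\<close> is the Schur function left after \<open>n\<close> steps. On the circle the division by \<open>\<zeta>\<close> in
  each step becomes a multiplication by \<open>cnj \<zeta>\<close>, and both components are combinations of \<open>1\<close> and \<open>f\<close> whose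
  coefficients are given by two analytic functions \<open>P\<close>, \<open>S\<close> and their conjugates.
\<close>

lemma stripped_pair:
  assumes \<gamma>: "schur_parameters \<gamma>" and f: "disc.wiener f C" "\<forall>\<zeta>. norm \<zeta> < 1 \<longrightarrow> f \<zeta> = schur_of \<gamma> \<zeta>"
  shows "\<exists>X Y P S. (\<exists>C. disc.wiener X C) \<and> (\<exists>C. disc.wiener Y C) \<and> (\<exists>C. disc.wiener P C) \<and> (\<exists>C. disc.wiener S C) \<and>
     X 0 \<noteq> 0 \<and> (\<forall>\<zeta>. norm \<zeta> < 1 \<longrightarrow> Y \<zeta> = schur_of (\<lambda>k. \<gamma> (k + n)) \<zeta> * X \<zeta>) \<and>
     (\<forall>\<zeta>. norm \<zeta> = 1 \<longrightarrow> X \<zeta> = cnj (P \<zeta>) - cnj \<zeta> ^ n * (\<zeta> * S \<zeta>) * f \<zeta> \<and>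
         \<zeta> ^ n * Y \<zeta> = P \<zeta> * f \<zeta> - \<zeta> ^ n * cnj (\<zeta> * S \<zeta>))"
proof (induction n)
  case 0
  show ?case
    by (rule exI[of _ "\<lambda>_. 1"], rule exI[of _ f], rule exI[of _ "\<lambda>_. 1"], rule exI[of _ "\<lambda>_. 0"])
       (use f disc.wiener_const in auto)
next
  case (Suc n)
  obtain X Y P S CX CY CP CS where w: "disc.wiener X CX" "disc.wiener Y CY" "disc.wiener P CP" "disc.wiener S CS"
    and X0: "X 0 \<noteq> 0" and YX: "\<And>\<zeta>. norm \<zeta> < 1 \<Longrightarrow> Y \<zeta> = schur_of (\<lambda>k. \<gamma> (k + n)) \<zeta> * X \<zeta>"
    and E1: "\<And>\<zeta>. norm \<zeta> = 1 \<Longrightarrow> X \<zeta> = cnj (P \<zeta>) - cnj \<zeta> ^ n * (\<zeta> * S \<zeta>) * f \<zeta>"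
    and E2: "\<And>\<zeta>. norm \<zeta> = 1 \<Longrightarrow> \<zeta> ^ n * Y \<zeta> = P \<zeta> * f \<zeta> - \<zeta> ^ n * cnj (\<zeta> * S \<zeta>)"
    using Suc by blast
  interpret s: schur_parameters "\<lambda>k. \<gamma> (k + n)" by (rule schur_parameters_shift[OF \<gamma>])
  interpret s': schur_parameters "\<lambda>k. \<gamma> (k + Suc n)" by (rule schur_parameters_shift[OF \<gamma>])
  define g where "g = \<gamma> n"
  define X' where "X' \<zeta> = X \<zeta> - cnj g * Y \<zeta>" for \<zeta>
  have wX': "disc.wiener X' (CX + norm (cnj g) * CY)" unfolding X'_def by (intro disc.wiener_diff disc.wiener_scale w)
  define Z where "Z \<zeta> = Y \<zeta> - g * X \<zeta>" for \<zeta>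
  have wZ: "disc.wiener Z (CY + norm g * CX)" unfolding Z_def by (intro disc.wiener_diff disc.wiener_scale w)
  have Y0: "Y 0 = g * X 0" using YX[of 0] s.schur_fun_0 by (simp add: g_def)
  have Z0: "Z 0 = 0" using Y0 by (simp add: Z_def)
  obtain Y' where Y': "disc.wiener Y' (CY + norm g * CX - norm (Z 0))" "\<And>\<zeta>. norm \<zeta> \<le> 1 \<Longrightarrow> Z \<zeta> = Z 0 + \<zeta> * Y' \<zeta>"
    using disc_wiener_divide[OF wZ] by blast
  have ZY: "Z \<zeta> = \<zeta> * Y' \<zeta>" if "norm \<zeta> \<le> 1" for \<zeta> using Y'(2)[OF that] Z0 by simp
  define P' where "P' \<zeta> = P \<zeta> + g * (\<zeta> ^ 1 * S \<zeta>)" for \<zeta>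
  define S' where "S' \<zeta> = \<zeta> ^ 1 * S \<zeta> + cnj g * P \<zeta>" for \<zeta>
  have wP': "disc.wiener P' (CP + norm g * (1 * CS))"
    unfolding P'_def by (intro disc.wiener_add disc.wiener_scale disc.wiener_mult disc.wiener_char w)
  have wS': "disc.wiener S' (1 * CS + norm (cnj g) * CP)"
    unfolding S'_def by (intro disc.wiener_add disc.wiener_scale disc.wiener_mult disc.wiener_char w)
  have ng: "complex_of_real (1 - (norm g)\<^sup>2) = 1 - g * cnj g"
    by (simp only: of_real_diff of_real_1 complex_norm_square)
  have "X' 0 = complex_of_real (1 - (norm g)\<^sup>2) * X 0"
    unfolding ng X'_def Y0 by (simp add: algebra_simps)
  moreover have "1 - (norm g)\<^sup>2 \<noteq> 0" using s.pos_factor[of 0] by (simp add: g_def)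
  then have "complex_of_real (1 - (norm g)\<^sup>2) \<noteq> 0" by (simp only: of_real_eq_0_iff not_False_eq_True)
  ultimately have X'0: "X' 0 \<noteq> 0" using X0 by (simp only: mult_eq_0_iff) blast
  have YX': "Y' \<zeta> = s'.schur_fun \<zeta> * X' \<zeta>" if z: "norm \<zeta> < 1" for \<zeta>
  proof (rule continuous_eq_off_0[OF _ _ _ z])
    show "continuous_on (ball 0 1) Y'" using disc_wiener_continuous(1)[OF Y'(1)] by (rule continuous_on_subset) auto
    have "continuous_on (ball 0 1) X'" using disc_wiener_continuous(1)[OF wX'] by (rule continuous_on_subset) auto
    then show "continuous_on (ball 0 1) (\<lambda>\<zeta>. s'.schur_fun \<zeta> * X' \<zeta>)" by (intro continuous_on_mult s'.schur_fun_continuous)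
    fix \<zeta> :: complex assume z: "norm \<zeta> < 1" "\<zeta> \<noteq> 0"
    have "\<zeta> * s'.schur_fun \<zeta> * (1 - cnj g * s.schur_fun \<zeta>) = s.schur_fun \<zeta> - g"
      using s.schur_inverse_step[OF z(1)] by (simp add: g_def)
    then have "\<zeta> * s'.schur_fun \<zeta> * (1 - cnj g * s.schur_fun \<zeta>) * X \<zeta> = (s.schur_fun \<zeta> - g) * X \<zeta>" by simp
    then have "\<zeta> * (s'.schur_fun \<zeta> * X' \<zeta>) = Z \<zeta>" unfolding X'_def Z_def YX[OF z(1)] by (simp add: algebra_simps)
    also have "\<dots> = \<zeta> * Y' \<zeta>" using z by (intro ZY) simp
    finally show "Y' \<zeta> = s'.schur_fun \<zeta> * X' \<zeta>" using z(2) by simp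
  qed
  have E: "X' \<zeta> = cnj (P' \<zeta>) - cnj \<zeta> ^ Suc n * (\<zeta> * S' \<zeta>) * f \<zeta> \<and>
         \<zeta> ^ Suc n * Y' \<zeta> = P' \<zeta> * f \<zeta> - \<zeta> ^ Suc n * cnj (\<zeta> * S' \<zeta>)" if z: "norm \<zeta> = 1" for \<zeta>
  proof
    have z1: "cnj \<zeta> * \<zeta> = 1" using complex_norm_square[of \<zeta>] z by (simp add: mult.commute)
    then have zn: "cnj \<zeta> ^ n * \<zeta> ^ n = 1" by (simp flip: power_mult_distrib)
    define s where "s = \<zeta> * S \<zeta>"
    define p where "p = P \<zeta>"
    define k where "k = cnj \<zeta> ^ n"
    define l where "l = \<zeta> ^ n"
    have kl: "k * l = 1" using zn by (simp add: k_def l_def)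
    have e1: "X \<zeta> = cnj p - k * s * f \<zeta>" using E1[OF z] by (simp add: s_def p_def k_def mult.assoc)
    have e2: "l * Y \<zeta> = p * f \<zeta> - l * cnj s" using E2[OF z] by (simp add: s_def p_def l_def)
    have "(k * l) * Y \<zeta> = k * (l * Y \<zeta>)" by (simp only: mult.assoc)
    also have "\<dots> = k * p * f \<zeta> - (k * l) * cnj s" unfolding e2 by (simp add: algebra_simps)
    finally have y: "Y \<zeta> = k * p * f \<zeta> - cnj s" by (simp add: kl)
    have P'': "P' \<zeta> = p + g * s" and S'': "S' \<zeta> = s + cnj g * p" by (simp_all add: P'_def S'_def s_def p_def)
    have zz: "cnj \<zeta> ^ Suc n * (\<zeta> * t) = k * t" for t
    proof -
      have "cnj \<zeta> ^ Suc n * (\<zeta> * t) = (cnj \<zeta> * \<zeta>) * (k * t)" by (simp add: k_def algebra_simps)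
      then show ?thesis by (simp add: z1)
    qed
    show "X' \<zeta> = cnj (P' \<zeta>) - cnj \<zeta> ^ Suc n * (\<zeta> * S' \<zeta>) * f \<zeta>"
      unfolding zz X'_def e1 y P'' S'' by (simp add: algebra_simps)
    have zz2: "\<zeta> ^ Suc n * cnj (\<zeta> * t) = l * cnj t" for t
    proof -
      have "\<zeta> ^ Suc n * cnj (\<zeta> * t) = (cnj \<zeta> * \<zeta>) * (l * cnj t)" by (simp add: l_def algebra_simps)
      then show ?thesis by (simp add: z1)
    qed
    have "\<zeta> ^ Suc n * Y' \<zeta> = l * Z \<zeta>" using ZY[of \<zeta>] z by (simp add: l_def)
    also have "\<dots> = l * Y \<zeta> - g * (l * cnj p - (k * l) * s * f \<zeta>)" unfolding Z_def e1 by (simp add: algebra_simps)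
    also have "\<dots> = P' \<zeta> * f \<zeta> - l * cnj (S' \<zeta>)" unfolding e2 kl P'' S'' by (simp add: algebra_simps)
    finally show "\<zeta> ^ Suc n * Y' \<zeta> = P' \<zeta> * f \<zeta> - \<zeta> ^ Suc n * cnj (\<zeta> * S' \<zeta>)" unfolding zz2 .
  qed
  show ?case using wX' Y'(1) wP' wS' X'0 YX' E by blast
qed

text \<open>
  Multiplication by \<open>x\<^sup>N\<close> makes all but a small tail of the series of \<open>k\<close> analytic and zero at the origin.
\<close>

lemma circle_tail_split:
  assumes "circle.wiener k C" "\<epsilon> > 0"
  shows "\<exists>N h G D. circle.wiener h \<epsilon> \<and> disc.wiener G D \<and>
    (\<forall>x. norm x = 1 \<longrightarrow> x ^ N * k x = x ^ N * h x + x * G x)"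
proof -
  obtain d t where t: "circle.polynomial_deg d t" "circle.wiener (\<lambda>x. k x - t x) \<epsilon>"
    using circle.wiener_split[OF assms] by (elim exE conjE)
  obtain c where c: "\<And>x. norm x = 1 \<Longrightarrow> t x = (\<Sum>l | nat \<bar>l\<bar> \<le> d. c l * x powi l)"
    using t(1) by (auto simp: circle.polynomial_deg_def)
  define G where "G x = (\<Sum>l | nat \<bar>l\<bar> \<le> d. c l * x ^ nat (l + int d))" for x
  have "disc.wiener G (\<Sum>l | nat \<bar>l\<bar> \<le> d. norm (c l))"
    unfolding G_def by (intro disc.wiener_sum disc.wiener_monomial circle.finite_len)
  moreover have "x ^ Suc d * k x = x ^ Suc d * (k x - t x) + x * G x" if x: "norm x = 1" for x
  proof -
    have x0: "x \<noteq> 0" using x by auto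
    have "x ^ d * t x = G x"
      unfolding c[OF x] G_def sum_distrib_left
    proof (rule sum.cong[OF refl])
      fix l assume "l \<in> {l. nat \<bar>l\<bar> \<le> d}"
      then have l: "0 \<le> l + int d" by auto
      have "x ^ nat (l + int d) = x powi (l + int d)" using l by (metis int_nat_eq power_int_of_nat)
      also have "\<dots> = x powi l * x ^ d" using x0 by (simp add: power_int_add)
      finally show "x ^ d * (c l * x powi l) = c l * x ^ nat (l + int d)" by (simp only: ac_simps)
    qed
    then show ?thesis by (simp add: algebra_simps)
  qed
  ultimately show ?thesis using t(2)
    by (intro exI[of _ "Suc d"] exI[of _ "\<lambda>x. k x - t x"] exI[of _ G] exI[of _ "\<Sum>l | nat \<bar>l\<bar> \<le> d. norm (c l)"]) simp
qed

text \<open>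
  The least bound is attained, by the unique coefficients. The next proof needs it because it derives
  inequalities of the norms of two functions against each other.
\<close>

lemma disc_exact_norm:
  assumes "disc.wiener f C"
  shows "\<exists>T. disc.wiener f T \<and> (\<forall>D. disc.wiener f D \<longrightarrow> T \<le> D)"
proof -
  obtain c where c: "disc.expansion c f" using assms by (auto simp: disc.wiener_def)
  show ?thesis
    by (rule exI[of _ "\<Sum>\<^sub>\<infinity>k. norm (c k)"]) (use c disc.expansion_norm_le[OF c] in \<open>auto simp: disc.wiener_def\<close>)
qed

text \<open>
  Dividing the stripped pair by the spectral factor, \<open>x = X / a\<close> and \<open>y = Y / a\<close>, turns the relations on
  the circle into
  \<open>cnj x = P a + \<zeta>\<^sup>N k y\<close> and \<open>y = cnj (\<zeta>\<^sup>N k x) - cnj (\<zeta> S a)\<close> with \<open>k = cnj f a / cnj a\<close>.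
  When \<open>x\<close> and \<open>y\<close> are projected to nonnegative frequencies, the terms with \<open>P\<close> and \<open>S\<close> contribute no
  more than a constant \<open>\<kappa>\<close>, and only the nonpositive frequencies of \<open>\<zeta>\<^sup>N k\<close> matter; for large \<open>N\<close> they have norm
  at most \<open>1 / 4\<close>. Hence
  \<open>\<bar>x - \<kappa>\<bar> \<le> \<bar>y\<bar> / 4\<close> and \<open>\<bar>y\<bar> \<le> (\<bar>\<kappa>\<bar> + \<bar>x - \<kappa>\<bar>) / 4\<close> in Wiener norm, which bounds the norm of \<open>y / x\<close> by
  \<open>(4 / 15) / (14 / 15)\<close>.
\<close>

lemma schur_wiener_tail:
  assumes \<gamma>: "schur_parameters \<gamma>" and st: "strict_schur_wiener \<gamma>"
  shows "\<exists>N. schur_wiener (\<lambda>k. \<gamma> (k + N)) (2 / 7)"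
proof -
  obtain f C r where f: "disc.wiener f C" "r < 1" "\<forall>\<zeta>. norm \<zeta> \<le> 1 \<longrightarrow> norm (f \<zeta>) \<le> r"
    "\<forall>\<zeta>. norm \<zeta> < 1 \<longrightarrow> f \<zeta> = schur_of \<gamma> \<zeta>"
    using st by (auto simp: strict_schur_wiener_def)
  obtain a b Ca Cb where a: "disc.wiener a Ca" and b: "disc.wiener b Cb" and ab0: "\<forall>x. a x * b x = 1"
    and aa0: "\<forall>x. norm x = 1 \<longrightarrow> a x * cnj (a x) = 1 - f x * cnj (f x)"
    using spectral_factor[OF f(1,2,3)] by (elim exE conjE)
  note ab = ab0[rule_format] and aa = aa0[rule_format]
  define k where "k x = cnj (f x) * a x * cnj (b x)" for x
  have "circle.wiener k (C * Ca * Cb)"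
    unfolding k_def by (intro circle.wiener_mult circle_wiener_cnj circle_wiener_of_disc f a b)
  then obtain N h G D where h: "circle.wiener h (1 / 4)" and G: "disc.wiener G D"
    and kh0: "\<forall>x. norm x = 1 \<longrightarrow> x ^ N * k x = x ^ N * h x + x * G x"
    using circle_tail_split[of k "C * Ca * Cb" "1 / 4"] by auto
  note kh = kh0[rule_format]
  obtain X Y P S CX CY CP CS where w: "disc.wiener X CX" "disc.wiener Y CY" "disc.wiener P CP" "disc.wiener S CS"
    and X0: "X 0 \<noteq> 0" and YX: "\<And>\<zeta>. norm \<zeta> < 1 \<Longrightarrow> Y \<zeta> = schur_of (\<lambda>k. \<gamma> (k + N)) \<zeta> * X \<zeta>"
    and E1: "\<And>\<zeta>. norm \<zeta> = 1 \<Longrightarrow> X \<zeta> = cnj (P \<zeta>) - cnj \<zeta> ^ N * (\<zeta> * S \<zeta>) * f \<zeta>"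
    and E2: "\<And>\<zeta>. norm \<zeta> = 1 \<Longrightarrow> \<zeta> ^ N * Y \<zeta> = P \<zeta> * f \<zeta> - \<zeta> ^ N * cnj (\<zeta> * S \<zeta>)"
    using stripped_pair[OF \<gamma> f(1,4), of N] by blast
  \<comment> \<open>division by the spectral factor, whose inverse is \<open>b\<close>\<close>
  define x where "x \<zeta> = X \<zeta> * b \<zeta>" for \<zeta>
  define y where "y \<zeta> = Y \<zeta> * b \<zeta>" for \<zeta>
  have wx: "disc.wiener x (CX * Cb)" and wy: "disc.wiener y (CY * Cb)"
    unfolding x_def y_def by (intro disc.wiener_mult w b)+
  have R1: "cnj (x \<zeta>) = P \<zeta> * a \<zeta> + \<zeta> ^ N * k \<zeta> * y \<zeta>"
    and R2: "y \<zeta> = cnj (\<zeta> ^ N * k \<zeta> * x \<zeta>) - cnj (\<zeta> * (S \<zeta> * a \<zeta>))" if z: "norm \<zeta> = 1" for \<zeta>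
  proof -
    have "cnj \<zeta> * \<zeta> = 1" using complex_norm_square[of \<zeta>] z by (simp add: mult.commute)
    then have zn: "cnj \<zeta> ^ N * \<zeta> ^ N = 1" by (simp flip: power_mult_distrib)
    define l where "l = \<zeta> ^ N"
    have l: "cnj l * l = 1" using zn by (simp add: l_def)
    define s where "s = \<zeta> * S \<zeta>"
    define p where "p = P \<zeta>"
    define F where "F = f \<zeta>"
    define A where "A = a \<zeta>"
    define B where "B = b \<zeta>"
    have AB: "A * B = 1" "cnj A * cnj B = 1" using ab[of \<zeta>] by (simp_all add: A_def B_def flip: complex_cnj_mult)
    have AA: "A * cnj A = 1 - F * cnj F" using aa[OF z] by (simp add: A_def F_def)
    have e1: "X \<zeta> = cnj p - cnj l * s * F" using E1[OF z] by (simp add: s_def p_def l_def F_def mult.assoc)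
    have e2: "l * Y \<zeta> = p * F - l * cnj s" using E2[OF z] by (simp add: s_def p_def l_def F_def)
    have e2': "Y \<zeta> = cnj l * p * F - cnj s"
    proof -
      have "(cnj l * l) * Y \<zeta> = cnj l * (l * Y \<zeta>)" by (simp only: mult.assoc)
      also have "\<dots> = cnj l * p * F - (cnj l * l) * cnj s" unfolding e2 by (simp add: algebra_simps)
      finally show ?thesis by (simp add: l)
    qed
    have "p * A + l * (cnj F * A * cnj B) * (Y \<zeta> * B) = p * A + cnj F * cnj B * (l * Y \<zeta>) * (A * B)" by (simp only: ac_simps)
    also have "\<dots> = p * A * (cnj A * cnj B) + cnj F * cnj B * (p * F - l * cnj s)" unfolding e2 AB by simp
    also have "\<dots> = cnj B * (p * (A * cnj A) + cnj F * p * F - cnj F * l * cnj s)" by (simp add: algebra_simps)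
    also have "\<dots> = cnj B * (p - cnj F * l * cnj s)" unfolding AA by (simp add: algebra_simps)
    also have "\<dots> = cnj (X \<zeta> * B)" unfolding e1 by (simp add: algebra_simps)
    finally show "cnj (x \<zeta>) = P \<zeta> * a \<zeta> + \<zeta> ^ N * k \<zeta> * y \<zeta>"
      by (simp add: x_def y_def k_def p_def A_def B_def F_def l_def)
    have "cnj (l * (cnj F * A * cnj B) * (X \<zeta> * B)) - cnj (s * A)
       = cnj l * F * B * cnj (X \<zeta>) * (cnj A * cnj B) - cnj s * cnj A" by (simp add: ac_simps)
    also have "\<dots> = cnj l * F * B * (p - l * cnj s * cnj F) - cnj s * cnj A * (A * B)" unfolding AB e1 by simp
    also have "\<dots> = B * (cnj l * F * p - (cnj l * l) * cnj s * F * cnj F - cnj s * (A * cnj A))" by (simp add: algebra_simps)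
    also have "\<dots> = B * (cnj l * F * p - cnj s)" unfolding AA l by (simp add: algebra_simps)
    also have "\<dots> = Y \<zeta> * B" unfolding e2' by (simp add: algebra_simps)
    finally show "y \<zeta> = cnj (\<zeta> ^ N * k \<zeta> * x \<zeta>) - cnj (\<zeta> * (S \<zeta> * a \<zeta>))"
      by (simp add: x_def y_def k_def s_def A_def B_def F_def l_def mult.assoc)
  qed
  \<comment> \<open>\<open>cnj x\<close> up to the tail with \<open>h\<close>; since \<open>Q\<close> is analytic, only its value at \<open>0\<close> survives in
      the projection of \<open>x\<close> to nonnegative frequencies\<close>
  define Q where "Q \<zeta> = P \<zeta> * a \<zeta> + \<zeta> ^ 1 * (G \<zeta> * y \<zeta>)" for \<zeta>
  have wQ: "disc.wiener Q (CP * Ca + 1 * (D * (CY * Cb)))"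
    unfolding Q_def by (intro disc.wiener_add disc.wiener_mult disc.wiener_char w a G wy)
  obtain Q1 where Q1: "disc.wiener Q1 (CP * Ca + 1 * (D * (CY * Cb)) - norm (Q 0))" "\<And>\<zeta>. norm \<zeta> \<le> 1 \<Longrightarrow> Q \<zeta> = Q 0 + \<zeta> * Q1 \<zeta>"
    using disc_wiener_divide[OF wQ] by blast
  define \<kappa> where "\<kappa> = cnj (Q 0)"
  define E where "E \<zeta> = x \<zeta> - \<kappa>" for \<zeta>
  have wE0: "disc.wiener E (CX * Cb + norm \<kappa>)" unfolding E_def by (intro disc.wiener_diff disc.wiener_const wx)
  obtain TY where TY: "disc.wiener y TY" "\<And>D. disc.wiener y D \<Longrightarrow> TY \<le> D" using disc_exact_norm[OF wy] by blast
  obtain TE where TE: "disc.wiener E TE" "\<And>D. disc.wiener E D \<Longrightarrow> TE \<le> D" using disc_exact_norm[OF wE0] by blast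
  have zc: "circle.wiener (\<lambda>\<zeta>. \<zeta> ^ N) 1" using circle_wiener_of_disc[OF disc.wiener_char] .
  have "disc.wiener E (1 * (1 / 4) * TY)"
  proof (rule disc_part_bound[OF wE0 _ Q1(1)])
    show "circle.wiener (\<lambda>\<zeta>. cnj (\<zeta> ^ N * h \<zeta> * y \<zeta>)) (1 * (1 / 4) * TY)"
      by (intro circle_wiener_cnj circle.wiener_mult zc h circle_wiener_of_disc TY)
    fix \<zeta> :: complex assume z: "norm \<zeta> = 1"
    have "cnj (x \<zeta>) = Q \<zeta> + \<zeta> ^ N * h \<zeta> * y \<zeta>"
      unfolding R1[OF z] kh[OF z] Q_def by (simp add: algebra_simps)
    also have "Q \<zeta> = Q 0 + \<zeta> * Q1 \<zeta>" using z by (intro Q1(2)) simp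
    finally have "cnj (x \<zeta>) = Q 0 + \<zeta> * Q1 \<zeta> + \<zeta> ^ N * h \<zeta> * y \<zeta>" .
    then have "cnj (cnj (x \<zeta>)) = cnj (Q 0 + \<zeta> * Q1 \<zeta> + \<zeta> ^ N * h \<zeta> * y \<zeta>)" by (simp only:)
    then show "E \<zeta> = cnj (\<zeta> ^ N * h \<zeta> * y \<zeta>) + cnj (\<zeta> * Q1 \<zeta>)" by (simp add: E_def \<kappa>_def algebra_simps)
  qed
  then have i1: "TE \<le> TY / 4" using TE(2) by fastforce
  have wx': "disc.wiener x (norm \<kappa> + TE)"
    by (rule disc.wiener_cong[OF disc.wiener_add[OF disc.wiener_const TE(1)]]) (simp add: E_def)
  have wV: "disc.wiener (\<lambda>\<zeta>. G \<zeta> * x \<zeta> - S \<zeta> * a \<zeta>) (D * (CX * Cb) + CS * Ca)"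
    by (intro disc.wiener_diff disc.wiener_mult G wx w a)
  have "disc.wiener y (1 * (1 / 4) * (norm \<kappa> + TE))"
  proof (rule disc_part_bound[OF wy _ wV])
    show "circle.wiener (\<lambda>\<zeta>. cnj (\<zeta> ^ N * h \<zeta> * x \<zeta>)) (1 * (1 / 4) * (norm \<kappa> + TE))"
      by (intro circle_wiener_cnj circle.wiener_mult zc h circle_wiener_of_disc wx')
    fix \<zeta> :: complex assume z: "norm \<zeta> = 1"
    show "y \<zeta> = cnj (\<zeta> ^ N * h \<zeta> * x \<zeta>) + cnj (\<zeta> * (G \<zeta> * x \<zeta> - S \<zeta> * a \<zeta>))"
      unfolding R2[OF z] kh[OF z] by (simp add: algebra_simps)
  qed
  then have i2: "TY \<le> (norm \<kappa> + TE) / 4" using TY(2) by fastforce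
  have b1: "TY \<le> 4 / 15 * norm \<kappa>" using i1 i2 by (simp add: field_simps)
  have b2: "TE \<le> norm \<kappa> / 15" using i1 b1 by (simp add: field_simps)
  have \<kappa>0: "\<kappa> \<noteq> 0"
  proof
    assume k0: "\<kappa> = 0"
    have "disc.wiener x 0" using wx' b2 k0 disc.wiener_mono by auto
    then have "x 0 = 0" using disc.wiener_norm_le[of x 0 0] by simp
    then show False using X0 ab[of 0] by (auto simp: x_def)
  qed
  have n15: "norm (- (1 / \<kappa>)) * TE \<le> 1 / 15" using b2 \<kappa>0 by (simp add: norm_divide field_simps)
  have wI: "disc.wiener (\<lambda>\<zeta>. 1 / (1 - (- (1 / \<kappa>) * E \<zeta>))) (1 / (1 - 1 / 15))"
    by (rule disc.wiener_geometric[OF disc.wiener_mono[OF disc.wiener_scale[OF TE(1)] n15]]) simp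
  have wYk: "disc.wiener (\<lambda>\<zeta>. 1 / \<kappa> * y \<zeta>) (4 / 15)"
    by (rule disc.wiener_mono[OF disc.wiener_scale[OF TY(1)]]) (use b1 \<kappa>0 in \<open>simp add: norm_divide field_simps\<close>)
  have "disc.wiener (\<lambda>\<zeta>. (1 / \<kappa> * y \<zeta>) * (1 / (1 - (- (1 / \<kappa>) * E \<zeta>)))) (4 / 15 * (1 / (1 - 1 / 15)))"
    by (rule disc.wiener_mult[OF wYk wI])
  then have W: "disc.wiener (\<lambda>\<zeta>. (1 / \<kappa> * y \<zeta>) * (1 / (1 - (- (1 / \<kappa>) * E \<zeta>)))) (2 / 7)" by simp
  have "(1 / \<kappa> * y \<zeta>) * (1 / (1 - (- (1 / \<kappa>) * E \<zeta>))) = schur_of (\<lambda>k. \<gamma> (k + N)) \<zeta>" if z: "norm \<zeta> < 1" for \<zeta>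
  proof -
    have "norm (- (1 / \<kappa>) * E \<zeta>) \<le> 1 / 15"
      by (rule disc.wiener_norm_le[OF disc.wiener_mono[OF disc.wiener_scale[OF TE(1)] n15]]) (use z in simp)
    moreover have "v \<noteq> 1" if "norm v \<le> 1 / 15" for v :: complex using that by auto
    ultimately have "- (1 / \<kappa>) * E \<zeta> \<noteq> 1" by blast
    then have "1 - (- (1 / \<kappa>) * E \<zeta>) \<noteq> 0" by (metis right_minus_eq)
    moreover have xe: "x \<zeta> = \<kappa> * (1 - (- (1 / \<kappa>) * E \<zeta>))" using \<kappa>0 by (simp add: E_def field_simps)
    ultimately have xn: "x \<zeta> \<noteq> 0" using \<kappa>0 by simp
    have "(1 / \<kappa> * y \<zeta>) * (1 / (1 - (- (1 / \<kappa>) * E \<zeta>))) = y \<zeta> / x \<zeta>" unfolding xe by simp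
    also have "\<dots> = schur_of (\<lambda>k. \<gamma> (k + N)) \<zeta>" using xn YX[OF z] by (simp add: x_def y_def)
    finally show ?thesis .
  qed
  then show ?thesis using W unfolding schur_wiener_def by fastforce
qed

text \<open>
  The stripped function is \<open>(f - \<gamma>\<^sub>0) / \<zeta>\<close> divided by \<open>1 - cnj \<gamma>\<^sub>0 f\<close>: removing the value at \<open>0\<close> gains \<open>\<bar>\<gamma>\<^sub>0\<bar>\<close>,
  and the Neumann series of the denominator costs \<open>1 / (1 - \<bar>\<gamma>\<^sub>0\<bar> T)\<close>.
\<close>

lemma schur_wiener_step:
  assumes \<gamma>: "schur_parameters \<gamma>" and T: "schur_wiener \<gamma> T" "T < 1"
  shows "norm (\<gamma> 0) \<le> T" "schur_wiener (\<lambda>k. \<gamma> (Suc k)) ((T - norm (\<gamma> 0)) / (1 - norm (\<gamma> 0) * T))"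
proof -
  interpret schur_parameters \<gamma> by (rule \<gamma>)
  interpret s: schur_parameters "\<lambda>k. \<gamma> (Suc k)" by (rule parameters_shift)
  obtain f where f: "disc.wiener f T" "\<And>\<zeta>. norm \<zeta> < 1 \<Longrightarrow> f \<zeta> = schur_fun \<zeta>" using T by (auto simp: schur_wiener_def)
  have f0: "f 0 = \<gamma> 0" using f(2)[of 0] schur_fun_0 by simp
  show g: "norm (\<gamma> 0) \<le> T" using disc.wiener_norm_le[OF f(1), of 0] f0 by simp
  have T0: "0 \<le> T" by (rule disc.wiener_nonneg[OF f(1)])
  have gT: "norm (cnj (\<gamma> 0)) * T < 1"
    using mult_left_le[of T "norm (\<gamma> 0)"] T(2) norm_less_1[of 0] by simp
  obtain R where R: "disc.wiener R (T - norm (\<gamma> 0))" "\<And>\<zeta>. norm \<zeta> \<le> 1 \<Longrightarrow> f \<zeta> = \<gamma> 0 + \<zeta> * R \<zeta>"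
    using disc_wiener_divide[OF f(1)] unfolding f0 by blast
  define F where "F \<zeta> = R \<zeta> * (1 / (1 - cnj (\<gamma> 0) * f \<zeta>))" for \<zeta>
  have F: "disc.wiener F ((T - norm (\<gamma> 0)) * (1 / (1 - norm (cnj (\<gamma> 0)) * T)))"
    unfolding F_def by (intro disc.wiener_mult R disc.wiener_geometric disc.wiener_scale f gT)
  have "F \<zeta> = s.schur_fun \<zeta>" if z: "norm \<zeta> < 1" for \<zeta>
  proof (rule continuous_eq_off_0[OF _ s.schur_fun_continuous _ z])
    show "continuous_on (ball 0 1) F" using disc_wiener_continuous(1)[OF F] by (rule continuous_on_subset) auto
    fix \<zeta> :: complex assume z: "norm \<zeta> < 1" "\<zeta> \<noteq> 0"
    have "norm (cnj (\<gamma> 0) * f \<zeta>) < 1"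
      using disc.wiener_norm_le[OF disc.wiener_scale[OF f(1)], of \<zeta> "cnj (\<gamma> 0)"] gT z by simp
    then have ne: "1 - cnj (\<gamma> 0) * f \<zeta> \<noteq> 0" by auto
    have "f \<zeta> = \<gamma> 0 + \<zeta> * R \<zeta>" using z by (intro R(2)) simp
    then have "schur_fun \<zeta> - \<gamma> 0 = \<zeta> * R \<zeta>" unfolding f(2)[OF z(1)] by simp
    then have "\<zeta> * s.schur_fun \<zeta> * (1 - cnj (\<gamma> 0) * f \<zeta>) = \<zeta> * R \<zeta>"
      unfolding f(2)[OF z(1)] schur_inverse_step[OF z(1)] .
    then have "s.schur_fun \<zeta> * (1 - cnj (\<gamma> 0) * f \<zeta>) = R \<zeta>" using z(2) by simp
    then show "F \<zeta> = s.schur_fun \<zeta>" using ne by (simp add: F_def field_simps)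
  qed
  then show "schur_wiener (\<lambda>k. \<gamma> (Suc k)) ((T - norm (\<gamma> 0)) / (1 - norm (\<gamma> 0) * T))"
    using F unfolding schur_wiener_def by auto
qed

text \<open>
  Since \<open>(S - g) / (1 - gS) \<le> S - g (1 - S\<^sup>2)\<close>, each stripped parameter lowers the norm by a fixed multiple
  \<open>\<delta>\<close> of its modulus, and the norm cannot fall below \<open>0\<close>.
\<close>

lemma small_schur_wiener_summable:
  assumes \<gamma>: "schur_parameters \<gamma>" and T: "schur_wiener \<gamma> T0" "T0 < 1"
  shows "summable (\<lambda>k. norm (\<gamma> k))"
proof -
  have T00: "0 \<le> T0" using T(1) disc.wiener_nonneg by (auto simp: schur_wiener_def)
  define \<delta> where "\<delta> = 1 - T0\<^sup>2"
  have \<delta>: "\<delta> > 0" using T(2) T00 by (simp add: \<delta>_def abs_square_less_1)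
  have "\<exists>T. schur_wiener (\<lambda>k. \<gamma> (k + n)) T \<and> T + \<delta> * (\<Sum>k<n. norm (\<gamma> k)) \<le> T0" for n
  proof (induction n)
    case 0
    then show ?case using T(1) by auto
  next
    case (Suc n)
    then obtain S where S: "schur_wiener (\<lambda>k. \<gamma> (k + n)) S" "S + \<delta> * (\<Sum>k<n. norm (\<gamma> k)) \<le> T0" by blast
    have S0: "0 \<le> S" using S(1) disc.wiener_nonneg by (auto simp: schur_wiener_def)
    have "0 \<le> \<delta> * (\<Sum>k<n. norm (\<gamma> k))" using \<delta> by (simp add: sum_nonneg)
    then have ST: "S \<le> T0" using S(2) by linarith
    define g where "g = norm (\<gamma> n)"
    have st: "g \<le> S" "schur_wiener (\<lambda>k. \<gamma> (k + Suc n)) ((S - g) / (1 - g * S))"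
      using schur_wiener_step[OF schur_parameters_shift[OF \<gamma>, of n] S(1)] ST T(2) by (simp_all add: g_def)
    have g0: "0 \<le> g" by (simp add: g_def)
    have S1: "S < 1" using ST T(2) by linarith
    have gS: "g * S < 1" using mult_left_le[of S g] st(1) S1 g0 by linarith
    have S2: "S\<^sup>2 \<le> T0\<^sup>2" using ST S0 by (intro power_mono)
    have "0 \<le> g * g * S * (1 - S\<^sup>2)" using g0 S0 S1 by (intro mult_nonneg_nonneg) (simp_all add: abs_square_le_1)
    then have "S - g \<le> (S - g * (1 - S\<^sup>2)) * (1 - g * S)" by (simp add: algebra_simps power2_eq_square)
    then have "(S - g) / (1 - g * S) \<le> S - g * (1 - S\<^sup>2)" using gS by (simp add: pos_divide_le_eq)
    also have "\<dots> \<le> S - g * \<delta>" using S2 g0 unfolding \<delta>_def by (intro diff_left_mono mult_left_mono) simp_all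
    finally have "(S - g) / (1 - g * S) + \<delta> * (\<Sum>k<Suc n. norm (\<gamma> k)) \<le> T0" using S(2) by (simp add: g_def algebra_simps)
    then show ?case using st(2) by blast
  qed
  then have "(\<Sum>k<n. norm (\<gamma> k)) \<le> T0 / \<delta>" for n
  proof -
    obtain S where S: "schur_wiener (\<lambda>k. \<gamma> (k + n)) S" "S + \<delta> * (\<Sum>k<n. norm (\<gamma> k)) \<le> T0"
      using \<open>\<And>n. \<exists>T. schur_wiener (\<lambda>k. \<gamma> (k + n)) T \<and> T + \<delta> * (\<Sum>k<n. norm (\<gamma> k)) \<le> T0\<close> by blast
    have S0: "0 \<le> S" using S(1) disc.wiener_nonneg by (auto simp: schur_wiener_def)
    then show ?thesis using S(2) \<delta> by (simp add: pos_le_divide_eq mult.commute)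
  qed
  then show ?thesis by (intro summableI_nonneg_bounded) simp_all
qed

theorem strict_schur_wiener_imp_summable:
  assumes \<gamma>: "schur_parameters \<gamma>" and st: "strict_schur_wiener \<gamma>"
  shows "summable (\<lambda>k. norm (\<gamma> k))"
proof -
  obtain N where N: "schur_wiener (\<lambda>k. \<gamma> (k + N)) (2 / 7)" using schur_wiener_tail[OF assms] by blast
  have "summable (\<lambda>k. norm (\<gamma> (k + N)))" by (rule small_schur_wiener_summable[OF schur_parameters_shift[OF \<gamma>] N]) simp
  then show ?thesis by (subst (asm) summable_iff_shift)
qed

section \<open>Summability of masses and of parameters\<close>

lemma tanh_le_double:
  fixes r :: real
  assumes "r \<ge> 0"
  shows "tanh r \<le> 2 * r"
proof -
  define t where "t = tanh r"
  have t: "0 \<le> t" "t < 1" using assms tanh_real_lt_1[of r] by (simp_all add: t_def)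
  have "r = - (ln ((1 - t) / (1 + t))) / 2"
  proof -
    have "r = artanh t" by (simp add: t_def artanh_tanh_real)
    also have "\<dots> = - (ln ((1 - t) / (1 + t))) / 2" unfolding artanh_def using t by (simp add: ln_div)
    finally show ?thesis .
  qed
  moreover have "ln ((1 - t) / (1 + t)) \<le> (1 - t) / (1 + t) - 1" using t by (intro ln_le_minus_one) simp
  moreover have "(1 - t) / (1 + t) - 1 \<le> - t" using t mult_left_mono[of t 1 t] by (simp add: field_simps)
  ultimately show ?thesis by (simp add: t_def)
qed

lemma le_double_tanh:
  fixes r :: real
  assumes "r \<ge> 0" "tanh r < 1 / 2"
  shows "r \<le> 2 * tanh r"
proof -
  define t where "t = tanh r"
  have t: "0 \<le> t" "t < 1 / 2" using assms by (simp_all add: t_def)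
  have "r = ln ((1 + t) / (1 - t)) / 2" by (simp add: t_def artanh_tanh_real flip: artanh_def)
  moreover have "ln ((1 + t) / (1 - t)) \<le> (1 + t) / (1 - t) - 1" using t by (intro ln_le_minus_one) simp
  moreover have "(1 + t) / (1 - t) - 1 \<le> 4 * t"
  proof -
    have "(1 + t) \<le> (1 + 4 * t) * (1 - t)" using t mult_left_mono[of "2 * t" 1 "2 * t"] by (simp add: algebra_simps)
    then have "(1 + t) / (1 - t) \<le> 1 + 4 * t" using t by (simp add: pos_divide_le_eq)
    then show ?thesis by simp
  qed
  ultimately show ?thesis by (simp add: t_def)
qed

lemma summable_verblunsky_iff: "summable (\<lambda>k. norm (verblunsky q k)) \<longleftrightarrow> summable (\<lambda>k. norm (q k))"
proof
  assume s: "summable (\<lambda>k. norm (q k))"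
  show "summable (\<lambda>k. norm (verblunsky q k))"
    by (rule summable_comparison_test'[OF summable_mult[OF s, of 2]]) (simp add: norm_verblunsky tanh_le_double)
next
  assume s: "summable (\<lambda>k. norm (verblunsky q k))"
  have "(\<lambda>k. norm (verblunsky q k)) \<longlonglongrightarrow> 0" by (rule summable_LIMSEQ_zero[OF s])
  then have "eventually (\<lambda>k. norm (verblunsky q k) < 1 / 2) sequentially" by (rule order_tendstoD) simp
  then obtain N :: nat where N: "\<And>k. k \<ge> N \<Longrightarrow> tanh (norm (q k)) < 1 / 2"
    by (auto simp: eventually_sequentially norm_verblunsky)
  show "summable (\<lambda>k. norm (q k))"
  proof (rule summable_comparison_test'[OF summable_mult[OF s, of 2]])
    fix k assume k: "k \<ge> N"
    define r where "r = norm (q k)"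
    have r: "0 \<le> r" "tanh r < 1 / 2" using N[OF k] by (simp_all add: r_def)
    have "r \<le> 2 * tanh r" by (rule le_double_tanh) (use r in simp_all)
    then show "norm (norm (q k)) \<le> 2 * norm (verblunsky q k)" by (simp add: r_def norm_verblunsky)
  qed
qed

section \<open>Singular parts of a density\<close>

text \<open>
  Each singular part is carried by a Lebesgue null set and is dominated by the density, which gives
  that set measure zero.
\<close>

lemma density_singular_parts_null:
  assumes w: "w \<in> borel_measurable borel"
    and d: "lebesgue_decomposition (density lborel (\<lambda>x. ennreal (w x))) \<mu>ac \<mu>pp \<mu>sc"
  shows "\<mu>pp = null_measure borel" "\<mu>sc = null_measure borel"
proof -
  define \<mu> where "\<mu> = density lborel (\<lambda>x. ennreal (w x))"
  have null: "emeasure \<mu> A = 0" if "A \<in> null_sets lborel" for A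
  proof -
    have "absolutely_continuous lborel \<mu>" unfolding \<mu>_def by (rule absolutely_continuousI_density) (use w in simp)
    then have "A \<in> null_sets \<mu>" using that by (auto simp: absolutely_continuous_def)
    then show ?thesis by auto
  qed
  have sum: "emeasure \<mu> A = emeasure \<mu>ac A + emeasure \<mu>pp A + emeasure \<mu>sc A" if "A \<in> sets borel" for A
    using d that unfolding lebesgue_decomposition_def \<mu>_def by blast
  have null_eq: "\<nu> = null_measure borel"
    if s: "sets \<nu> = sets borel" and C: "C \<in> null_sets lborel" "emeasure \<nu> (- C) = 0"
      and le: "\<And>A. A \<in> sets borel \<Longrightarrow> emeasure \<nu> A \<le> emeasure \<mu> A" for \<nu> C
  proof (rule measure_eqI)
    show "sets \<nu> = sets (null_measure borel)" using s by simp
    fix A assume A: "A \<in> sets \<nu>"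
    have Cb: "C \<in> sets borel" "- C \<in> sets borel" using C(1) by auto
    have "emeasure \<nu> A \<le> emeasure \<nu> (C \<union> - C)" by (rule emeasure_mono) (use s Cb in auto)
    also have "\<dots> \<le> emeasure \<nu> C + emeasure \<nu> (- C)" by (rule emeasure_subadditive) (use s Cb in auto)
    also have "\<dots> \<le> emeasure \<mu> C + 0" using le[OF Cb(1)] C(2) by simp
    also have "\<dots> = 0" using null[OF C(1)] by simp
    finally show "emeasure \<nu> A = emeasure (null_measure borel) A" by simp
  qed
  obtain C where C: "sets \<mu>pp = sets borel" "countable C" "emeasure \<mu>pp (- C) = 0"
    using d unfolding lebesgue_decomposition_def pure_point_def by blast
  show "\<mu>pp = null_measure borel"
  proof (rule null_eq[OF C(1) countable_imp_null_set_lborel[OF C(2)] C(3)])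
    fix A :: "real set" assume "A \<in> sets borel"
    from sum[OF this] show "emeasure \<mu>pp A \<le> emeasure \<mu> A" by (simp add: add.assoc add.left_commute)
  qed
  obtain S where S: "sets \<mu>sc = sets borel" "S \<in> null_sets lborel" "emeasure \<mu>sc (- S) = 0"
    using d unfolding lebesgue_decomposition_def singular_continuous_def by blast
  show "\<mu>sc = null_measure borel"
  proof (rule null_eq[OF S])
    fix A :: "real set" assume "A \<in> sets borel"
    from sum[OF this] show "emeasure \<mu>sc A \<le> emeasure \<mu> A" by simp
  qed
qed

lemma sigma_density_empty:
  assumes w: "w \<in> borel_measurable borel"
  shows "sigma_p (density lborel (\<lambda>x. ennreal (w x))) = {}" "sigma_sc (density lborel (\<lambda>x. ennreal (w x))) = {}"
proof -
  define \<mu> where "\<mu> = density lborel (\<lambda>x. ennreal (w x))"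
  have ac: "absolutely_continuous lborel \<mu>" unfolding \<mu>_def by (rule absolutely_continuousI_density) (use w in simp)
  have "lebesgue_decomposition \<mu> \<mu> (null_measure borel) (null_measure borel)"
    unfolding lebesgue_decomposition_def pure_point_def singular_continuous_def
  proof (intro conjI ballI)
    show "sets \<mu> = sets borel" by (simp add: \<mu>_def)
    show "\<exists>C :: real set. countable C \<and> emeasure (null_measure borel) (- C) = 0" by (intro exI[of _ "{}"]) simp
    show "\<exists>S\<in>null_sets lborel. emeasure (null_measure borel) (- S :: real set) = 0" by (intro bexI[of _ "{}"]) simp_all
  qed (use ac in simp_all)
  note dec = this
  have "pp_part \<mu> = null_measure borel" unfolding pp_part_def
    by (rule the_equality) (use dec density_singular_parts_null(1)[OF w, folded \<mu>_def] in blast)+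
  moreover have "sc_part \<mu> = null_measure borel" unfolding sc_part_def
    by (rule the_equality) (use dec density_singular_parts_null(2)[OF w, folded \<mu>_def] in blast)+
  moreover have "measure_support (null_measure borel) = {}" unfolding measure_support_def by auto
  ultimately show "sigma_p (density lborel (\<lambda>x. ennreal (w x))) = {}" "sigma_sc (density lborel (\<lambda>x. ennreal (w x))) = {}"
    unfolding sigma_p_def sigma_sc_def \<mu>_def by simp_all
qed

section \<open>Spectral densities\<close>

lemma caratheodory_real_part:
  fixes f :: complex
  assumes "f \<noteq> 1"
  shows "(1 - (norm f)\<^sup>2) / (norm (1 - f))\<^sup>2 = Re ((1 + f) / (1 - f))"
proof -
  have "(1 + f) / (1 - f) = (1 + f) * cnj (1 - f) / of_real ((norm (1 - f))\<^sup>2)"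
    by (rule complex_div_cnj)
  then have "Re ((1 + f) / (1 - f)) = Re ((1 + f) * cnj (1 - f)) / (norm (1 - f))\<^sup>2"
    by (simp only: Re_divide_of_real)
  also have "Re ((1 + f) * cnj (1 - f)) = 1 - (norm f)\<^sup>2"
    unfolding cmod_power2 by (simp add: power2_eq_square algebra_simps)
  finally show ?thesis by simp
qed

text \<open>
  Transfers identities from the upper half plane to the punctured disc; the origin is then covered by
  continuity.
\<close>

lemma disc_parametrisation:
  assumes "norm \<zeta> < 1" "\<zeta> \<noteq> 0"
  shows "\<exists>z. Im z > 0 \<and> exp (2 * \<i> * z) = \<zeta>"
proof (rule exI[of _ "Ln \<zeta> / (2 * \<i>)"], rule conjI)
  have "Im (Ln \<zeta> / (2 * \<i>)) = - Re (Ln \<zeta>) / 2" by (simp add: Im_divide power2_eq_square)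
  also have "\<dots> > 0" using assms by (simp add: Re_Ln)
  finally show "Im (Ln \<zeta> / (2 * \<i>)) > 0" .
  show "exp (2 * \<i> * (Ln \<zeta> / (2 * \<i>))) = \<zeta>" using assms(2) by simp
qed

text \<open>
  The derivative \<open>d\<close> satisfies \<open>Re (d h) = 0\<close> for all \<open>h\<close>, hence vanishes.
\<close>

lemma holomorphic_zero_real_part:
  assumes H: "H holomorphic_on ball 0 1" and R: "\<And>x. norm x < 1 \<Longrightarrow> Re (H x) = 0" and x: "norm x < 1"
  shows "H x = H 0"
proof -
  have "(H has_field_derivative 0) (at y within ball 0 1)" if y: "y \<in> ball 0 1" for y
  proof -
    obtain d where d: "(H has_field_derivative d) (at y)"
      using holomorphic_on_imp_differentiable_at[OF H open_ball y] by (auto simp: field_differentiable_def)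
    then have "(H has_derivative (\<lambda>h. d * h)) (at y)" by (simp add: has_field_derivative_def)
    then have "((\<lambda>v. Re (H v)) has_derivative (\<lambda>h. Re (d * h))) (at y)" by (rule has_derivative_Re)
    moreover have "((\<lambda>v. Re (H v)) has_derivative (\<lambda>h. 0)) (at y)"
      by (rule has_derivative_transform_within_open[OF has_derivative_const open_ball y]) (use R in simp)
    ultimately have "(\<lambda>h. Re (d * h)) = (\<lambda>h. 0)" by (rule has_derivative_unique)
    from fun_cong[OF this, of 1] fun_cong[OF this, of \<i>] have "d = 0" by (simp add: complex_eq_iff)
    then show ?thesis using has_field_derivative_at_within[OF d] by simp
  qed
  then have "\<exists>c. \<forall>y\<in>ball 0 1. H y = c" by (intro has_field_derivative_zero_constant) simp_all
  then show ?thesis using x by auto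
qed

lemma periodic_attains_min:
  fixes w :: "real \<Rightarrow> real"
  assumes c: "continuous_on UNIV w" and p: "\<And>x n. w (x + of_int n * pi) = w x"
  shows "\<exists>x0. \<forall>x. w x0 \<le> w x"
proof -
  obtain x0 where x0: "x0 \<in> {0..pi}" "\<And>y. y \<in> {0..pi} \<Longrightarrow> w x0 \<le> w y"
    using continuous_attains_inf[of "{0..pi}" w] continuous_on_subset[OF c] by auto
  have "w x0 \<le> w x" for x
  proof -
    define n where "n = \<lfloor>x / pi\<rfloor>"
    have "of_int n \<le> x / pi" "x / pi < of_int n + 1" unfolding n_def by linarith+
    then have "of_int n * pi \<le> x" "x < (of_int n + 1) * pi" by (simp_all add: field_simps)
    then have "x + of_int (- n) * pi \<in> {0..pi}" by (simp add: algebra_simps)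
    from x0(2)[OF this] show ?thesis unfolding p .
  qed
  then show ?thesis by blast
qed

lemma exp_circle_power: "exp (2 * \<i> * of_real x) powi k = exp (2 * \<i> * of_int k * of_real x)"
  by (simp add: exp_power_int algebra_simps)

locale dirac_measure =
  fixes q :: "nat \<Rightarrow> complex" and \<mu> :: "real measure"
  assumes main: "main_spectral_measure q \<mu>"
begin

sublocale schur_parameters "verblunsky q" by (rule schur_parameters_verblunsky)

lemma poisson_integrable: "poisson_integrable \<mu>"
  using main unfolding main_spectral_measure_def poisson_integrable_def poisson_def[abs_def] by blast

lemma poisson_eq_caratheodory:
  assumes z: "Im z > 0"
  shows "(\<integral>x. poisson z x \<partial>\<mu>) = pi * Re ((1 + schur_fun (exp (2 * \<i> * z))) / (1 - schur_fun (exp (2 * \<i> * z))))"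
proof -
  define F where "F = schur_fun (exp (2 * \<i> * z))"
  have "norm (exp (2 * \<i> * z)) < 1" using z by simp
  then have "norm F < 1" unfolding F_def by (rule norm_schur_fun_less)
  then have "F \<noteq> 1" by auto
  then have "(1 - (norm F)\<^sup>2) / (norm (1 - F))\<^sup>2 = Re ((1 + F) / (1 - F))" by (rule caratheodory_real_part)
  moreover have "(1 - (norm F)\<^sup>2) / (norm (1 - F))\<^sup>2 = 1 / pi * (\<integral>x. poisson z x \<partial>\<mu>)"
    unfolding poisson_def F_def schur_function_eq[OF z, symmetric]
    by (rule main[unfolded main_spectral_measure_def, THEN conjunct2, rule_format, OF z, THEN conjunct2])
  ultimately have "Re ((1 + F) / (1 - F)) = 1 / pi * (\<integral>x. poisson z x \<partial>\<mu>)" by (rule trans[OF sym])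
  then have "(\<integral>x. poisson z x \<partial>\<mu>) = pi * Re ((1 + F) / (1 - F))" by simp
  then show ?thesis unfolding F_def .
qed

text \<open>
  The candidate density is the boundary value of the real part of \<open>W = (1 + F) / (1 - F)\<close>. It has the
  Poisson integrals of \<open>\<mu>\<close>.
\<close>

lemma summable_imp_density:
  assumes "summable (\<lambda>k. norm (q k))"
  shows "\<exists>w. positive_wiener_density w \<and> w \<in> borel_measurable borel \<and> \<mu> = density lborel (\<lambda>x. ennreal (w x))"
proof -
  have "strict_schur_wiener (verblunsky q)"
    using assms by (intro summable_imp_strict_schur_wiener schur_parameters_verblunsky) (simp add: summable_verblunsky_iff)
  then obtain f C r where f: "disc.wiener f C" "r < 1" "\<And>\<zeta>. \<zeta> \<in> cball 0 1 \<Longrightarrow> norm (f \<zeta>) \<le> r"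
    "\<And>\<zeta>. \<zeta> \<in> ball 0 1 \<Longrightarrow> f \<zeta> = schur_fun \<zeta>" unfolding strict_schur_wiener_def by blast
  have f1: "norm (f \<zeta>) < 1" if "norm \<zeta> \<le> 1" for \<zeta> using f(2) f(3)[of \<zeta>] that by simp
  have "\<exists>D. disc.wiener (\<lambda>x. 1 / (1 - f x)) D" by (rule disc.wiener_inverse_one_minus[OF f(1,3,2)]) simp_all
  then obtain D where D: "disc.wiener (\<lambda>x. 1 / (1 - f x)) D" ..
  define W where "W \<zeta> = (1 + f \<zeta>) * (1 / (1 - f \<zeta>))" for \<zeta>
  have W: "disc.wiener W ((norm (1 :: complex) + C) * D)"
    unfolding W_def by (intro disc.wiener_mult disc.wiener_add disc.wiener_const f D)
  then obtain c where c: "disc.expansion c W" by (auto simp: disc.wiener_def)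
  note cs = disc_expansion_suminf(1)[OF c] and cW = disc_expansion_suminf(2)[OF c]
  have cW': "norm \<zeta> \<le> 1 \<Longrightarrow> (\<lambda>n. c n * \<zeta> ^ n) sums W \<zeta>" for \<zeta> using cW[of \<zeta>] by simp
  define w where "w x = Re (W (exp (2 * \<i> * of_real x)))" for x :: real
  have wcont: "continuous_on UNIV w"
  proof -
    have "continuous_on UNIV (\<lambda>x::real. W (exp (2 * \<i> * of_real x)))"
      by (rule continuous_on_compose2[OF disc_wiener_continuous(1)[OF W]]) (auto intro!: continuous_intros)
    then show ?thesis unfolding w_def[abs_def] by (rule continuous_on_Re)
  qed
  have wpos: "w x > 0" for x
  proof -
    define v where "v = f (exp (2 * \<i> * of_real x))"
    have v: "norm v < 1" unfolding v_def by (rule f1) simp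
    then have v1: "v \<noteq> 1" by auto
    have "w x = Re ((1 + v) / (1 - v))" by (simp add: w_def W_def v_def)
    also have "\<dots> = (1 - (norm v)\<^sup>2) / (norm (1 - v))\<^sup>2" using caratheodory_real_part[OF v1] by simp
    also have "\<dots> > 0" using v v1 by (intro divide_pos_pos) (simp_all add: abs_square_less_1)
    finally show ?thesis .
  qed
  have wm: "w \<in> borel_measurable borel" by (rule borel_measurable_continuous_onI[OF wcont])
  have "circle.wiener W ((norm (1 :: complex) + C) * D)" by (rule circle_wiener_of_disc[OF W])
  from circle.wiener_scale[OF circle.wiener_add[OF this circle_wiener_cnj[OF this]], of "1 / 2"]
  obtain d where d: "(\<lambda>k. norm (d k)) summable_on UNIV"
    "\<And>x. x \<in> sphere 0 1 \<Longrightarrow> 1 / 2 * (W x + cnj (W x)) = (\<Sum>\<^sub>\<infinity>k. d k * x powi k)"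
    unfolding circle.wiener_def circle.expansion_def by blast
  have "of_real (w x) = (\<Sum>\<^sub>\<infinity>k. d k * exp (2 * \<i> * of_int k * of_real x))" for x
  proof -
    have "of_real (w x) = 1 / 2 * (W (exp (2 * \<i> * of_real x)) + cnj (W (exp (2 * \<i> * of_real x))))"
      by (simp add: w_def complex_add_cnj)
    also have "\<dots> = (\<Sum>\<^sub>\<infinity>k. d k * exp (2 * \<i> * of_real x) powi k)" by (rule d(2)) simp
    finally show ?thesis unfolding exp_circle_power .
  qed
  moreover have "\<exists>x0. \<forall>x. w x0 \<le> w x"
  proof (rule periodic_attains_min[OF wcont])
    fix x and n :: int
    have "exp (2 * \<i> * of_real (x + of_int n * pi)) = exp (2 * \<i> * of_real x) * exp (\<i> * (of_int n * (of_real pi * 2)))"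
      by (simp add: exp_add[symmetric] algebra_simps)
    also have "exp (\<i> * (of_int n * (of_real pi * 2))) = 1"
      unfolding exp_eq_1 by (auto intro!: exI[of _ n])
    finally show "w (x + of_int n * pi) = w x" by (simp add: w_def)
  qed
  ultimately have pw: "positive_wiener_density w" unfolding positive_wiener_density_def using d(1) wpos by blast
  define \<nu> where "\<nu> = density lborel (\<lambda>x. ennreal (w x))"
  have w0: "AE x in lborel. 0 \<le> w x" using wpos by (simp add: less_imp_le)
  have ip: "integrable lborel (\<lambda>x. w x * poisson z x) \<and> (\<integral>x. w x * poisson z x \<partial>lborel) = pi * Re (W (exp (2 * \<i> * z)))"
    if z: "Im z > 0" for z
  proof -
    note i = poisson_power_series[OF z cs cW']
    have e: "Re (of_real (poisson z x) * W (exp (2 * \<i> * of_real x))) = w x * poisson z x" for x by (simp add: w_def)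
    have "integrable lborel (\<lambda>x. Re (of_real (poisson z x) * W (exp (2 * \<i> * of_real x))))" using i(1) by (rule integrable_Re)
    moreover have "(\<integral>x. Re (of_real (poisson z x) * W (exp (2 * \<i> * of_real x))) \<partial>lborel) = Re (of_real pi * W (exp (2 * \<i> * z)))"
      using integral_Re[OF i(1)] i(2) by simp
    ultimately show ?thesis unfolding e by simp
  qed
  have \<nu>p: "poisson_integrable \<nu>"
  proof
    show "sets \<nu> = sets borel" by (simp add: \<nu>_def)
    fix z :: complex assume z: "Im z > 0"
    show "integrable \<nu> (poisson z)" unfolding \<nu>_def
      by (subst integrable_real_density) (use wm w0 ip[OF z] in simp_all)
  qed
  have "\<mu> = \<nu>"
  proof (rule poisson_unique[OF poisson_integrable \<nu>p])
    fix z :: complex assume z: "Im z > 0"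
    have b: "exp (2 * \<i> * z) \<in> ball 0 1" using z by simp
    have "(\<integral>x. poisson z x \<partial>\<nu>) = (\<integral>x. w x * poisson z x \<partial>lborel)" unfolding \<nu>_def
      by (rule integral_real_density) (use wm w0 in simp_all)
    also have "\<dots> = pi * Re (W (exp (2 * \<i> * z)))" using ip[OF z] by simp
    also have "\<dots> = (\<integral>x. poisson z x \<partial>\<mu>)" unfolding poisson_eq_caratheodory[OF z] W_def f(4)[OF b] by simp
    finally show "(\<integral>x. poisson z x \<partial>\<mu>) = (\<integral>x. poisson z x \<partial>\<nu>)" by simp
  qed
  then show ?thesis using pw wm unfolding \<nu>_def by blast
qed

text \<open>
  The Poisson integrals identify \<open>Re W\<close> with \<open>Re u\<close>, where \<open>u\<close> is analytic with boundary real part \<open>w\<close>; so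
  \<open>W = u + K\<close> with \<open>Re K = 0\<close>, and \<open>F = (v - 2) / v\<close> for \<open>v = 1 + W\<close>.
\<close>

lemma density_imp_summable:
  assumes pw: "positive_wiener_density w" and \<mu>: "\<mu> = density lborel (\<lambda>x. ennreal (w x))"
  shows "summable (\<lambda>k. norm (q k))"
proof -
  from pw obtain c x0 where c: "(\<lambda>k :: int. norm (c k)) summable_on UNIV"
    and cw0: "\<forall>x. of_real (w x) = (\<Sum>\<^sub>\<infinity>k. c k * exp (2 * \<i> * of_int k * of_real x))"
    and x00: "\<forall>x. w x0 \<le> w x" and x01: "w x0 > 0"
    unfolding positive_wiener_density_def by (elim exE conjE)
  note cw = cw0[rule_format] and x0 = x00[rule_format] x01
  define m where "m = w x0"
  have m: "m > 0" "\<And>x. m \<le> w x" using x0 by (simp_all add: m_def)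
  define g where "g \<zeta> = (\<Sum>\<^sub>\<infinity>k. c k * \<zeta> powi k)" for \<zeta>
  have "circle.wiener g (\<Sum>\<^sub>\<infinity>k. norm (c k))"
    unfolding circle.wiener_def circle.expansion_def using c by (intro exI[of _ c]) (simp add: g_def)
  from real_part_of_disc[OF this] obtain u Cu where u: "disc.wiener u Cu"
    and ug0: "\<forall>x. norm x = 1 \<longrightarrow> Re (u x) = Re (g x)" by (elim exE conjE)
  note ug = ug0[rule_format]
  have gw: "g (exp (2 * \<i> * of_real x)) = of_real (w x)" for x
    unfolding g_def exp_circle_power cw ..
  have wu: "w x = Re (u (exp (2 * \<i> * of_real x)))" for x
    using ug[of "exp (2 * \<i> * of_real x)"] gw[of x] by simp
  have wcont: "continuous_on UNIV w"
  proof -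
    have "continuous_on UNIV (\<lambda>x::real. u (exp (2 * \<i> * of_real x)))"
      by (rule continuous_on_compose2[OF disc_wiener_continuous(1)[OF u]]) (auto intro!: continuous_intros)
    then show ?thesis unfolding wu[abs_def] by (rule continuous_on_Re)
  qed
  have wm: "w \<in> borel_measurable borel" by (rule borel_measurable_continuous_onI[OF wcont])
  have w0: "AE x in lborel. 0 \<le> w x" using m by (intro AE_I2) (meson less_le_trans less_imp_le)
  obtain e where e: "disc.expansion e u" using u by (auto simp: disc.wiener_def)
  have eu: "norm \<zeta> \<le> 1 \<Longrightarrow> (\<lambda>n. e n * \<zeta> ^ n) sums u \<zeta>" for \<zeta>
    using disc_expansion_suminf(2)[OF e, of \<zeta>] by simp
  have ip: "integrable lborel (\<lambda>x. w x * poisson z x) \<and> (\<integral>x. w x * poisson z x \<partial>lborel) = pi * Re (u (exp (2 * \<i> * z)))"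
    if z: "Im z > 0" for z
  proof -
    note i = poisson_power_series[OF z disc_expansion_suminf(1)[OF e] eu]
    have e: "Re (of_real (poisson z x) * u (exp (2 * \<i> * of_real x))) = w x * poisson z x" for x by (simp add: wu)
    have "integrable lborel (\<lambda>x. Re (of_real (poisson z x) * u (exp (2 * \<i> * of_real x))))" using i(1) by (rule integrable_Re)
    moreover have "(\<integral>x. Re (of_real (poisson z x) * u (exp (2 * \<i> * of_real x))) \<partial>lborel) = Re (of_real pi * u (exp (2 * \<i> * z)))"
      using integral_Re[OF i(1)] i(2) by simp
    ultimately show ?thesis unfolding e by simp
  qed
  define V where "V \<zeta> = (1 + schur_fun \<zeta>) / (1 - schur_fun \<zeta>)" for \<zeta>
  have F1: "schur_fun \<zeta> \<noteq> 1" if "norm \<zeta> < 1" for \<zeta> using norm_schur_fun_less[OF that] by auto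
  have Vh: "V holomorphic_on ball 0 1"
    unfolding V_def using F1 by (intro holomorphic_intros schur_fun_holomorphic) auto
  have uh: "u holomorphic_on ball 0 1" by (rule disc_wiener_continuous(2)[OF u])
  have VR: "Re (V \<zeta>) = Re (u \<zeta>)" if \<zeta>: "norm \<zeta> < 1" for \<zeta>
  proof -
    have "complex_of_real (Re (V \<zeta>)) = of_real (Re (u \<zeta>))"
    proof (rule continuous_eq_off_0[where F = "\<lambda>\<zeta>. complex_of_real (Re (V \<zeta>))" and G = "\<lambda>\<zeta>. complex_of_real (Re (u \<zeta>))", OF _ _ _ \<zeta>])
      show "continuous_on (ball 0 1) (\<lambda>\<zeta>. complex_of_real (Re (V \<zeta>)))"
        by (intro continuous_intros holomorphic_on_imp_continuous_on[OF Vh])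
      show "continuous_on (ball 0 1) (\<lambda>\<zeta>. complex_of_real (Re (u \<zeta>)))"
        by (intro continuous_intros holomorphic_on_imp_continuous_on[OF uh])
      fix \<zeta> :: complex assume "norm \<zeta> < 1" "\<zeta> \<noteq> 0"
      then obtain z where z: "Im z > 0" "exp (2 * \<i> * z) = \<zeta>" using disc_parametrisation by blast
      have "pi * Re (V \<zeta>) = (\<integral>x. poisson z x \<partial>\<mu>)" unfolding poisson_eq_caratheodory[OF z(1)] V_def z(2) ..
      also have "\<dots> = (\<integral>x. w x * poisson z x \<partial>lborel)" unfolding \<mu>
        by (rule integral_real_density) (use wm w0 in simp_all)
      also have "\<dots> = pi * Re (u \<zeta>)" using ip[OF z(1)] z(2) by simp
      finally show "complex_of_real (Re (V \<zeta>)) = of_real (Re (u \<zeta>))" by simp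
    qed
    then show ?thesis by (simp only: of_real_eq_iff)
  qed
  have upos: "Re (u \<zeta>) > 0" if "norm \<zeta> \<le> 1" for \<zeta>
  proof (cases "norm \<zeta> < 1")
    case True
    have "Re (V \<zeta>) = (1 - (norm (schur_fun \<zeta>))\<^sup>2) / (norm (1 - schur_fun \<zeta>))\<^sup>2"
      unfolding V_def using caratheodory_real_part[OF F1[OF True]] by simp
    also have "\<dots> > 0"
      using norm_schur_fun_less[OF True] F1[OF True] by (intro divide_pos_pos) (simp_all add: abs_square_less_1)
    finally show ?thesis using VR[OF True] by simp
  next
    case False
    then have n1: "norm \<zeta> = 1" using that by simp
    then have "\<zeta> \<noteq> 0" by auto
    from Arg_eq[OF this] n1 have "\<zeta> = exp (2 * \<i> * of_real (Arg \<zeta> / 2))" by simp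
    then have "Re (u \<zeta>) = w (Arg \<zeta> / 2)" using wu[of "Arg \<zeta> / 2"] by simp
    then show ?thesis using m(1) m(2)[of "Arg \<zeta> / 2"] by simp
  qed
  define K where "K = V 0 - u 0"
  have K: "Re K = 0" using VR[of 0] by (simp add: K_def)
  have VK: "V \<zeta> = u \<zeta> + K" if "norm \<zeta> < 1" for \<zeta>
  proof -
    have "V \<zeta> - u \<zeta> = V 0 - u 0"
      by (rule holomorphic_zero_real_part[OF _ _ that, where H = "\<lambda>\<zeta>. V \<zeta> - u \<zeta>"])
         (use VR in \<open>auto intro!: holomorphic_intros Vh uh\<close>)
    then show ?thesis by (simp add: K_def algebra_simps)
  qed
  define v where "v \<zeta> = 1 + (u \<zeta> + K)" for \<zeta>
  define B where "B = norm (1 :: complex) + (Cu + norm K)"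
  have v: "disc.wiener v B" unfolding v_def B_def by (intro disc.wiener_add disc.wiener_const u)
  have v1: "Re (v \<zeta>) > 1" if "norm \<zeta> \<le> 1" for \<zeta> using upos[OF that] K by (simp add: v_def)
  have vB: "norm (v \<zeta>) \<le> B" if "norm \<zeta> \<le> 1" for \<zeta> using disc.wiener_norm_le[OF v, of \<zeta>] that by simp
  have B1: "B \<ge> 1" using disc.wiener_nonneg[OF u] by (simp add: B_def)
  \<comment> \<open>\<open>Re v \<ge> 1\<close> and \<open>\<bar>v\<bar>\<^sup>2 \<le> M\<close> give \<open>\<bar>1 - v / M\<bar>\<^sup>2 \<le> 1 - 1 / M\<close>,
      so \<open>v / M\<close> is inverted by a geometric series\<close>
  define M where "M = B\<^sup>2"
  have M1: "M \<ge> 1" using B1 by (simp add: M_def)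
  have bound: "norm (1 - of_real (1 / M) * v \<zeta>) \<le> sqrt (1 - 1 / M)" if z: "norm \<zeta> \<le> 1" for \<zeta>
  proof (rule real_le_rsqrt)
    have "(norm (1 - of_real (1 / M) * v \<zeta>))\<^sup>2 = 1 - 2 / M * Re (v \<zeta>) + (norm (v \<zeta>))\<^sup>2 / M\<^sup>2"
      using M1 unfolding cmod_power2 by (simp add: power2_eq_square field_simps)
    also have "\<dots> \<le> 1 - 2 / M * 1 + M / M\<^sup>2"
    proof (intro add_mono diff_left_mono mult_left_mono divide_right_mono)
      show "(norm (v \<zeta>))\<^sup>2 \<le> M" unfolding M_def using vB[OF z] by (intro power_mono) simp_all
    qed (use v1[OF z] M1 in simp_all)
    also have "\<dots> = 1 - 1 / M" using M1 by (simp add: power2_eq_square)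
    finally show "(norm (1 - of_real (1 / M) * v \<zeta>))\<^sup>2 \<le> 1 - 1 / M" .
  qed
  have "sqrt (1 - 1 / M) < sqrt 1" using M1 by (intro real_sqrt_less_mono) simp
  then have lt: "sqrt (1 - 1 / M) < 1" by simp
  have wI: "disc.wiener (\<lambda>\<zeta>. 1 - of_real (1 / M) * v \<zeta>) (norm (1 :: complex) + norm (complex_of_real (1 / M)) * B)"
    by (intro disc.wiener_diff disc.wiener_scale disc.wiener_const v)
  have "\<exists>D. disc.wiener (\<lambda>\<zeta>. 1 / (1 - (1 - of_real (1 / M) * v \<zeta>))) D"
    by (rule disc.wiener_inverse_one_minus[OF wI _ lt]) (use bound in simp_all)
  then obtain D where D: "disc.wiener (\<lambda>\<zeta>. 1 / (1 - (1 - of_real (1 / M) * v \<zeta>))) D" ..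
  define f where "f \<zeta> = 1 - of_real (2 / M) * (1 / (1 - (1 - of_real (1 / M) * v \<zeta>)))" for \<zeta>
  have f: "disc.wiener f (norm (1 :: complex) + norm (complex_of_real (2 / M)) * D)"
    unfolding f_def by (intro disc.wiener_diff disc.wiener_scale disc.wiener_const D)
  have v0: "v \<zeta> \<noteq> 0" if "norm \<zeta> \<le> 1" for \<zeta> using v1[OF that] by auto
  have fv: "f \<zeta> = (v \<zeta> - 2) / v \<zeta>" if "norm \<zeta> \<le> 1" for \<zeta>
    using v0[OF that] M1 by (simp add: f_def field_simps)
  have fb: "norm (f \<zeta>) < 1" if z: "norm \<zeta> \<le> 1" for \<zeta>
  proof -
    have "(norm (v \<zeta> - 2))\<^sup>2 < (norm (v \<zeta>))\<^sup>2"
      unfolding cmod_power2 using v1[OF z] by (simp add: power2_eq_square algebra_simps)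
    then have "norm (v \<zeta> - 2) < norm (v \<zeta>)" by (rule power2_less_imp_less) simp
    then show ?thesis unfolding fv[OF z] using v0[OF z] by (simp add: norm_divide)
  qed
  have fF: "f \<zeta> = schur_fun \<zeta>" if z: "norm \<zeta> < 1" for \<zeta>
  proof -
    have "v \<zeta> = 1 + V \<zeta>" using VK[OF z] by (simp add: v_def)
    also have "\<dots> = 2 / (1 - schur_fun \<zeta>)" using F1[OF z] by (simp add: V_def field_simps)
    finally have "v \<zeta> = 2 / (1 - schur_fun \<zeta>)" .
    then have "v \<zeta> - 2 = v \<zeta> * schur_fun \<zeta>" using F1[OF z] by (simp add: field_simps)
    then show ?thesis using fv[of \<zeta>] v0[of \<zeta>] z by simp
  qed
  have "continuous_on (cball 0 1) (\<lambda>\<zeta>. norm (f \<zeta>))"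
    by (intro continuous_intros disc_wiener_continuous(1)[OF f])
  then obtain \<zeta>0 where z0: "\<zeta>0 \<in> cball 0 1" "\<And>\<zeta>. \<zeta> \<in> cball 0 1 \<Longrightarrow> norm (f \<zeta>) \<le> norm (f \<zeta>0)"
    using continuous_attains_sup[of "cball (0::complex) 1" "\<lambda>\<zeta>. norm (f \<zeta>)"] by auto
  have "strict_schur_wiener (verblunsky q)"
    unfolding strict_schur_wiener_def
  proof (intro exI conjI ballI)
    show "disc.wiener f (norm (1 :: complex) + norm (complex_of_real (2 / M)) * D)" by (rule f)
    show "norm (f \<zeta>0) < 1" using fb z0(1) by simp
    show "norm (f \<zeta>) \<le> norm (f \<zeta>0)" if "\<zeta> \<in> cball 0 1" for \<zeta> by (rule z0(2)[OF that])
    show "f \<zeta> = schur_fun \<zeta>" if "\<zeta> \<in> ball 0 1" for \<zeta> using fF that by simp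
  qed
  then have "summable (\<lambda>k. norm (verblunsky q k))"
    by (rule strict_schur_wiener_imp_summable[OF schur_parameters_verblunsky])
  then show ?thesis by (simp only: summable_verblunsky_iff)
qed

end

theorem corollary1p6:
  fixes q :: "nat \<Rightarrow> complex" and \<mu> :: "real measure"
  assumes "main_spectral_measure q \<mu>"
  shows "(summable (\<lambda>k. norm (q k)) \<longrightarrow>
            sigma_p \<mu> = {} \<and> sigma_sc \<mu> = {} \<and>
            (\<exists>w. positive_wiener_density w \<and> \<mu> = density lborel (\<lambda>x. ennreal (w x)))) \<and>
         ((\<exists>w. positive_wiener_density w \<and> \<mu> = density lborel (\<lambda>x. ennreal (w x))) \<longrightarrow>
            summable (\<lambda>k. norm (q k)))"
proof -
  interpret dirac_measure q \<mu> by unfold_locales (rule assms)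
  show ?thesis
  proof (intro conjI impI)
    assume s: "summable (\<lambda>k. norm (q k))"
    obtain w where w: "positive_wiener_density w" "w \<in> borel_measurable borel" "\<mu> = density lborel (\<lambda>x. ennreal (w x))"
      using summable_imp_density[OF s] by blast
    show "sigma_p \<mu> = {}" "sigma_sc \<mu> = {}" unfolding w(3) by (rule sigma_density_empty[OF w(2)])+
    show "\<exists>w. positive_wiener_density w \<and> \<mu> = density lborel (\<lambda>x. ennreal (w x))" using w by blast
  next
    assume "\<exists>w. positive_wiener_density w \<and> \<mu> = density lborel (\<lambda>x. ennreal (w x))"
    then show "summable (\<lambda>k. norm (q k))" using density_imp_summable by blast
  qed
qed

end
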